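(* Let $\nu\in(0,1/2]$. Assume the standing hypotheses (H) and the CFL condition $$\Big(3+\frac{C_{\rm cont}}{c_{\rm coer}}\Big)C_{\rm cont}C_{\rm inv}^2\Big(\frac{\Delta t}{h_{\rm c}}\Big)^2\le\frac{\nu}{\nu+1}.$$ Consider the eigenvalues $\lambda_{p,\nu}$ of $a^{p,\nu}$ with respect to $(\cdot,\cdot)_{\mathcal T}$, i.e. the numbers $\lambda$ for which there is $\eta\in S\setminus\{0\}$ with $a^{p,\nu}(\eta,v)=\lambda(\eta,v)_{\mathcal T}$ for all $v\in S$ (they are real and positive). Then the largest eigenvalue satisfies $$\Delta t^2\lambda^{\max}_{p,\nu}\le 4-\frac{\nu}{\nu+1},$$ and the smallest eigenvalue satisfies $$\lambda^{\min}_{p,\nu}\ge c_\nu:=\frac12\min\Big\{\frac{c_{\rm coer}}{C_{\rm eq}^2},\ \frac{2\nu}{(\nu+1)\Delta t^2}\Big\}.$$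
   Context: Let $d\in\{1,2,3\}$ and let $\Omega\subset\mathbb R^d$ be a bounded Lipschitz domain which is an interval ($d=1$), a polygon ($d=2$) or a polyhedron ($d=3$); all function spaces are real. $(\cdot,\cdot)$ and $\|\cdot\|$ denote the $L^2(\Omega)$ inner product and norm. $V\subset H^1(\Omega)$ is a closed subspace and $a:V\times V\to\mathbb R$ is a bilinear form. $\mathcal T$ is a conforming simplicial mesh of $\Omega$ (simplices are closed sets), $h_\tau=\operatorname{diam}\tau$, $h=\max_{\tau\in\mathcal T}h_\tau$, $\rho_\tau$ is the diameter of the largest ball inscribed in $\tau$, and $\gamma(\mathcal T)=1$ if $d=1$, $\gamma(\mathcal T)=\max_\tau h_\tau/\rho_\tau$ if $d=2,3$. $h_0>0$ is a fixed number. For $k\ge1$, $S^k_{\mathcal T}=\{u\in C^0(\overline\Omega):u|_\tau\in\mathbb P_k(\tau)\ \forall\tau\in\mathcal T\}$, where $\mathbb P_k$ denotes polynomials of total degree $\le k$. Fix integers $1\le m\le m'$, the reference simplex $\hat\tau$, affine bijections $\phi_\tau:\hat\tau\to\tau$, and a polynomial space $P$ with $\mathbb P_m(\hat\tau)\subset P\subset\mathbb P_{m'}(\hat\tau)$; the finite element space is $S=\{u\in V:u\circ\phi_\tau\in P\ \forall\tau\in\mathcal T\}$. $S$ has a basis $(b_z)_{z\in\Sigma}$, indexed by a finite set of nodes $\Sigma\subset\overline\Omega$, with $\operatorname{supp}b_z\subset\bigcup\{\tau\in\mathcal T:z\in\tau\}$; every $u\in S$ is written $u=\sum_{z\in\Sigma}u_zb_z$.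 Mass lumping: there are weights $d_z>0$, and $(u,v)_{\mathcal T}:=\sum_{z\in\Sigma}d_zu_zv_z$, $\|u\|_{\mathcal T}=(u,u)_{\mathcal T}^{1/2}$ for $u,v\in S$. The operator $A^S:S\to S$ is defined by $(A^Su,v)_{\mathcal T}=a(u,v)$ for all $u,v\in S$. Coarse/fine splitting: $\mathcal T=\mathcal T_{\rm c}\cup\mathcal T_{\rm f}$ disjointly; $h_{\rm c}:=h$; $C_{\rm qu,c}:=h_{\rm c}/\min\{h_\tau:\tau\in\mathcal T_{\rm c}\}$; $p\ge1$ is an integer; $\Omega_{\rm f}$ is the interior of $\bigcup_{\tau\in\mathcal T_{\rm f}}\tau$; $\Sigma_{\rm f}:=\Sigma\cap\overline{\Omega_{\rm f}}$, $\Sigma_{\rm c}:=\Sigma\setminus\Sigma_{\rm f}$, $S_{\rm c}:=\operatorname{span}\{b_z:z\in\Sigma_{\rm c}\}$, $S_{\rm f}:=\operatorname{span}\{b_z:z\in\Sigma_{\rm f}\}$, so $S=S_{\rm c}\oplus S_{\rm f}$; for $u=u_{\rm c}+u_{\rm f}$ with $u_{\rm c}\in S_{\rm c}$, $u_{\rm f}\in S_{\rm f}$ set $\Pi^S_{\rm c}u:=u_{\rm c}$, $\Pi^S_{\rm f}u:=u_{\rm f}$. $C_{\rm inv,loc}$ is the smallest constant such that $\|\nabla u\|_{L^2(\tau)}\le C_{\rm inv,loc}h_\tau^{-1}\|u\|_{L^2(\tau)}$ for all $\tau\in\mathcal T$ and $u\in S^{m'}_{\mathcal T}$, and $C_{\rm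 inv}:=C_{\rm eq}\sqrt{h_0^2+C_{\rm qu,c}^2C_{\rm inv,loc}^2}$. Stabilized Chebyshev polynomials: $T_k$ is the Chebyshev polynomial of the first kind of degree $k$; $\nu\in[0,1/2]$; $\delta_{p,\nu}:=1+\nu/p^2$, $\omega_{p,\nu}:=2T_p'(\delta_{p,\nu})/T_p(\delta_{p,\nu})$, $P_{p,\nu}(x):=2\big(1-T_p(\delta_{p,\nu}-x/\omega_{p,\nu})/T_p(\delta_{p,\nu})\big)$ (so $P_{p,\nu}(0)=0$, $P_{p,\nu}'(0)=1$). For a time step $\Delta t>0$, $P^{\Delta t}_{p,\nu}(x):=P_{p,\nu}(\Delta t^2x)/(\Delta t^2x)$ (a polynomial of degree $p-1$) and $Q^{\Delta t}_{p,\nu}:=1-P^{\Delta t}_{p,\nu}$; these polynomials are applied to linear maps $S\to S$ in the usual way. Define $A^{S,p,\nu}:=A^SP^{\Delta t}_{p,\nu}(\Pi^S_{\rm f}A^S)$ and $a^{p,\nu}(u,v):=a\big(u-Q^{\Delta t}_{p,\nu}(\Pi^S_{\rm f}A^S)u,v\big)=(A^{S,p,\nu}u,v)_{\mathcal T}$ for $u,v\in S$. Standing hypotheses (H): $a$ is symmetric, $|a(u,v)|\le C_{\rm cont}\|u\|_{H^1(\Omega)}\|v\|_{H^1(\Omega)}$ and $a(u,u)\ge c_{\rm coer}\|u\|^2_{H^1(\Omega)}$ for all $u,v\in V$ with $0<c_{\rm coer}\le C_{\rm cont}$; $h\le h_0$; $C_{\rm eq}^{-1}\|u\|_{\mathcal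 T}\le\|u\|\le C_{\rm eq}\|u\|_{\mathcal T}$ for all $u\in S$, with a constant $C_{\rm eq}>0$; and $h_{\rm c}/h_\tau\le C_{\rm qu,c}\,p$ for all $\tau\in\mathcal T$. *)

theory Defs
  imports "HOL-Analysis.Analysis" "HOL-Computational_Algebra.Polynomial"
begin

definition in_L2 :: "(real^'n) set \<Rightarrow> (real^'n \<Rightarrow> real) \<Rightarrow> bool" where
  "in_L2 A u \<longleftrightarrow> set_borel_measurable lebesgue A u \<and> set_integrable lebesgue A (\<lambda>x. (u x)^2)"

definition L2_norm :: "(real^'n) set \<Rightarrow> (real^'n \<Rightarrow> real) \<Rightarrow> real" where
  "L2_norm A u = sqrt (LINT x:A|lebesgue. (u x)^2)"

definition grad :: "(real^'n \<Rightarrow> real) \<Rightarrow> real^'n \<Rightarrow> real^'n" where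
  "grad f x = (SOME g. GDERIV f x :> g)"

fun Ck :: "nat \<Rightarrow> (real^'n \<Rightarrow> real) set" where
  "Ck 0 = {f. continuous_on UNIV f}"
| "Ck (Suc k) = {f. \<exists>g. (\<forall>x. GDERIV f x :> g x) \<and> (\<forall>i. (\<lambda>x. g x $ i) \<in> Ck k)}"

definition smooth_fun :: "(real^'n \<Rightarrow> real) \<Rightarrow> bool" where
  "smooth_fun f \<longleftrightarrow> (\<forall>k. f \<in> Ck k)"

definition test_fun :: "(real^'n) set \<Rightarrow> (real^'n \<Rightarrow> real) \<Rightarrow> bool" where
  "test_fun Om \<phi> \<longleftrightarrow> smooth_fun \<phi> \<and> compact (closure {x. \<phi> x \<noteq> 0})
      \<and> closure {x. \<phi> x \<noteq> 0} \<subseteq> Om"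

definition weak_grad :: "(real^'n) set \<Rightarrow> (real^'n \<Rightarrow> real) \<Rightarrow> (real^'n \<Rightarrow> real^'n) \<Rightarrow> bool" where
  "weak_grad Om u G \<longleftrightarrow> (\<forall>i. in_L2 Om (\<lambda>x. G x $ i)) \<and>
     (\<forall>\<phi>. test_fun Om \<phi> \<longrightarrow> (\<forall>i.
        (LINT x:Om|lebesgue. u x * (grad \<phi> x $ i)) = - (LINT x:Om|lebesgue. G x $ i * \<phi> x)))"

definition H1 :: "(real^'n) set \<Rightarrow> (real^'n \<Rightarrow> real) \<Rightarrow> bool" where
  "H1 Om u \<longleftrightarrow> in_L2 Om u \<and> (\<exists>G. weak_grad Om u G)"

definition H1_norm :: "(real^'n) set \<Rightarrow> (real^'n \<Rightarrow> real) \<Rightarrow> real" where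
  "H1_norm Om u = sqrt ((LINT x:Om|lebesgue. (u x)^2)
      + (LINT x:Om|lebesgue. (norm ((SOME G. weak_grad Om u G) x))^2))"

definition H1_closed_subspace :: "(real^'n) set \<Rightarrow> (real^'n \<Rightarrow> real) set \<Rightarrow> bool" where
  "H1_closed_subspace Om V \<longleftrightarrow> V \<subseteq> {u. H1 Om u} \<and> (\<lambda>x. 0) \<in> V \<and>
     (\<forall>u\<in>V. \<forall>w\<in>V. \<forall>\<alpha> \<beta>::real. (\<lambda>x. \<alpha> * u x + \<beta> * w x) \<in> V) \<and>
     (\<forall>u f. H1 Om u \<and> (\<forall>n. f n \<in> V) \<and> (\<lambda>n. H1_norm Om (\<lambda>x. f n x - u x)) \<longlonglongrightarrow> 0
            \<longrightarrow> u \<in> V)"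

definition lipschitz_domain :: "(real^'n) set \<Rightarrow> bool" where
  "lipschitz_domain Om \<longleftrightarrow> open Om \<and> connected Om \<and> bounded Om \<and> Om \<noteq> {} \<and>
     (\<forall>x\<in>frontier Om. \<exists>e r L g. norm e = 1 \<and> 0 < r \<and>
        (\<forall>y z. \<bar>g y - g z\<bar> \<le> L * dist y z) \<and>
        (\<forall>y\<in>ball x r. y \<in> Om \<longleftrightarrow> y \<bullet> e < g (y - (y \<bullet> e) *\<^sub>R e)))"

definition d_simplex :: "(real^'n) set \<Rightarrow> bool" where
  "d_simplex \<tau> \<longleftrightarrow> (\<exists>X. finite X \<and> card X = CARD('n) + 1 \<and> \<not> affine_dependent X
      \<and> \<tau> = convex hull X)"

definition simplex_vertices :: "(real^'n) set \<Rightarrow> (real^'n) set" where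
  "simplex_vertices \<tau> = {v. v extreme_point_of \<tau>}"

definition conforming_mesh :: "(real^'n) set \<Rightarrow> (real^'n) set set \<Rightarrow> bool" where
  "conforming_mesh Om T \<longleftrightarrow> finite T \<and> (\<forall>\<tau>\<in>T. d_simplex \<tau>) \<and> \<Union>T = closure Om \<and>
     (\<forall>\<tau>\<in>T. \<forall>\<tau>'\<in>T. \<tau> \<inter> \<tau>' = convex hull (simplex_vertices \<tau> \<inter> simplex_vertices \<tau>'))"

definition mesh_size :: "(real^'n) set set \<Rightarrow> real" where
  "mesh_size T = Max (diameter ` T)"

definition ref_simplex :: "(real^'n) set" where
  "ref_simplex = convex hull (insert 0 {axis i 1 | i. True})"

definition affine_bij :: "(real^'n \<Rightarrow> real^'n) \<Rightarrow> (real^'n) set \<Rightarrow> bool" where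
  "affine_bij \<phi> \<tau> \<longleftrightarrow> (\<exists>A b. \<forall>x. \<phi> x = A *v x + b) \<and> bij_betw \<phi> ref_simplex \<tau>"

definition poly_deg_le :: "nat \<Rightarrow> (real^'n \<Rightarrow> real) \<Rightarrow> bool" where
  "poly_deg_le k q \<longleftrightarrow> (\<exists>c. \<forall>x. q x =
     (\<Sum>\<alpha>\<in>{\<alpha>::'n \<Rightarrow> nat. (\<Sum>i\<in>UNIV. \<alpha> i) \<le> k}. c \<alpha> * (\<Prod>i\<in>UNIV. (x $ i) ^ (\<alpha> i))))"

definition Sk :: "(real^'n) set \<Rightarrow> (real^'n) set set \<Rightarrow> nat \<Rightarrow> (real^'n \<Rightarrow> real) set" where
  "Sk Om T k = {u. continuous_on (closure Om) u \<and>
      (\<forall>\<tau>\<in>T. \<exists>q. poly_deg_le k q \<and> (\<forall>x\<in>\<tau>. u x = q x))}"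

(* ||grad u||_{L2(tau)} for u polynomial on tau *)
definition grad_L2_norm :: "(real^'n) set \<Rightarrow> (real^'n \<Rightarrow> real) \<Rightarrow> real" where
  "grad_L2_norm \<tau> u = sqrt (LINT x:interior \<tau>|lebesgue. (norm (grad u x))^2)"

definition C_inv_loc :: "(real^'n) set \<Rightarrow> (real^'n) set set \<Rightarrow> nat \<Rightarrow> real" where
  "C_inv_loc Om T m' = Inf {C. \<forall>\<tau>\<in>T. \<forall>u\<in>Sk Om T m'.
       grad_L2_norm \<tau> u \<le> C / diameter \<tau> * L2_norm \<tau> u}"

definition C_qu_c :: "(real^'n) set set \<Rightarrow> (real^'n) set set \<Rightarrow> real" where
  "C_qu_c T Tc = mesh_size T / Min (diameter ` Tc)"

definition C_inv :: "real \<Rightarrow> real \<Rightarrow> real \<Rightarrow> real \<Rightarrow> real" where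
  "C_inv Ceq h0 Cqu Cloc = Ceq * sqrt (h0^2 + Cqu^2 * Cloc^2)"

definition fe_space :: "(real^'n \<Rightarrow> real) set \<Rightarrow> (real^'n) set set \<Rightarrow>
    ((real^'n) set \<Rightarrow> real^'n \<Rightarrow> real^'n) \<Rightarrow> (real^'n \<Rightarrow> real) set \<Rightarrow> (real^'n \<Rightarrow> real) set" where
  "fe_space V T \<phi> P = {u\<in>V. \<forall>\<tau>\<in>T. \<exists>f\<in>P. \<forall>x\<in>ref_simplex. u (\<phi> \<tau> x) = f x}"

definition coeffs :: "(real^'n) set \<Rightarrow> (real^'n \<Rightarrow> real) set" where
  "coeffs Sig = {c. \<forall>z. z \<notin> Sig \<longrightarrow> c z = 0}"

definition fun_of :: "(real^'n) set \<Rightarrow> (real^'n \<Rightarrow> real^'n \<Rightarrow> real) \<Rightarrow> (real^'n \<Rightarrow> real) \<Rightarrow> real^'n \<Rightarrow> real" where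
  "fun_of Sig b c = (\<lambda>x. \<Sum>z\<in>Sig. c z * b z x)"

definition lumped :: "(real^'n) set \<Rightarrow> (real^'n \<Rightarrow> real) \<Rightarrow> (real^'n \<Rightarrow> real) \<Rightarrow> (real^'n \<Rightarrow> real) \<Rightarrow> real" where
  "lumped Sig d c c' = (\<Sum>z\<in>Sig. d z * c z * c' z)"

(* A^S: the unique operator with (A^S u, v)_T = a(u,v); in coefficients (A^S u)_z = a(u,b_z)/d_z *)
definition A_S :: "(real^'n) set \<Rightarrow> (real^'n \<Rightarrow> real^'n \<Rightarrow> real) \<Rightarrow> (real^'n \<Rightarrow> real) \<Rightarrow>
    ((real^'n \<Rightarrow> real) \<Rightarrow> (real^'n \<Rightarrow> real) \<Rightarrow> real) \<Rightarrow> (real^'n \<Rightarrow> real) \<Rightarrow> (real^'n \<Rightarrow> real)" where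
  "A_S Sig b d a c = (\<lambda>z. if z \<in> Sig then a (fun_of Sig b c) (b z) / d z else 0)"

definition Pi_f :: "(real^'n) set \<Rightarrow> (real^'n \<Rightarrow> real) \<Rightarrow> (real^'n \<Rightarrow> real)" where
  "Pi_f Sigf c = (\<lambda>z. if z \<in> Sigf then c z else 0)"

definition poly_op :: "real poly \<Rightarrow> ((real^'n \<Rightarrow> real) \<Rightarrow> (real^'n \<Rightarrow> real)) \<Rightarrow> (real^'n \<Rightarrow> real) \<Rightarrow> (real^'n \<Rightarrow> real)" where
  "poly_op q L c = (\<lambda>z. \<Sum>i\<le>degree q. coeff q i * (L ^^ i) c z)"

fun cheb :: "nat \<Rightarrow> real poly" where
  "cheb 0 = 1"
| "cheb (Suc 0) = [:0, 1:]"
| "cheb (Suc (Suc n)) = [:0, 2:] * cheb (Suc n) - cheb n"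

definition delta_pnu :: "nat \<Rightarrow> real \<Rightarrow> real" where
  "delta_pnu p \<nu> = 1 + \<nu> / (real p)^2"

definition omega_pnu :: "nat \<Rightarrow> real \<Rightarrow> real" where
  "omega_pnu p \<nu> = 2 * poly (pderiv (cheb p)) (delta_pnu p \<nu>) / poly (cheb p) (delta_pnu p \<nu>)"

definition P_pnu :: "nat \<Rightarrow> real \<Rightarrow> real poly" where
  "P_pnu p \<nu> = smult 2 (1 - smult (1 / poly (cheb p) (delta_pnu p \<nu>))
      (pcompose (cheb p) [:delta_pnu p \<nu>, - 1 / omega_pnu p \<nu>:]))"

definition P_dt :: "nat \<Rightarrow> real \<Rightarrow> real \<Rightarrow> real poly" where
  "P_dt p \<nu> dt = smult (1 / dt^2) (pcompose (P_pnu p \<nu>) [:0, dt^2:] div [:0, 1:])"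

definition Q_dt :: "nat \<Rightarrow> real \<Rightarrow> real \<Rightarrow> real poly" where
  "Q_dt p \<nu> dt = 1 - P_dt p \<nu> dt"

definition a_pnu :: "(real^'n) set \<Rightarrow> (real^'n) set \<Rightarrow> (real^'n \<Rightarrow> real^'n \<Rightarrow> real) \<Rightarrow> (real^'n \<Rightarrow> real) \<Rightarrow>
    ((real^'n \<Rightarrow> real) \<Rightarrow> (real^'n \<Rightarrow> real) \<Rightarrow> real) \<Rightarrow> nat \<Rightarrow> real \<Rightarrow> real \<Rightarrow>
    (real^'n \<Rightarrow> real) \<Rightarrow> (real^'n \<Rightarrow> real) \<Rightarrow> real" where
  "a_pnu Sig Sigf b d a p \<nu> dt u v =
     a (fun_of Sig b (\<lambda>z. u z - poly_op (Q_dt p \<nu> dt) (Pi_f Sigf \<circ> A_S Sig b d a) u z))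
       (fun_of Sig b v)"

definition is_eig_pnu :: "(real^'n) set \<Rightarrow> (real^'n) set \<Rightarrow> (real^'n \<Rightarrow> real^'n \<Rightarrow> real) \<Rightarrow> (real^'n \<Rightarrow> real) \<Rightarrow>
    ((real^'n \<Rightarrow> real) \<Rightarrow> (real^'n \<Rightarrow> real) \<Rightarrow> real) \<Rightarrow> nat \<Rightarrow> real \<Rightarrow> real \<Rightarrow> real \<Rightarrow> bool" where
  "is_eig_pnu Sig Sigf b d a p \<nu> dt lam \<longleftrightarrow>
     (\<exists>\<eta>\<in>coeffs Sig. \<eta> \<noteq> (\<lambda>z. 0) \<and>
        (\<forall>v\<in>coeffs Sig. a_pnu Sig Sigf b d a p \<nu> dt \<eta> v = lam * lumped Sig d \<eta> v))"

end

theory Submission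
  imports Defs "HOL-Computational_Algebra.Fundamental_Theorem_Algebra"
begin

text \<open>
  Write \<open>N = \<Pi>\<^sub>f A\<close>, \<open>R = P_dt\<close> and \<open>Q = 1 - R\<close>, so that the form in question is \<open>a (R(N) u) v\<close>.
  The operator \<open>N\<close> is self-adjoint both for \<open>a\<close> and, on the fine coefficients, for the lumped inner
  product. The local inverse inequality and the CFL condition bound its spectrum by
  \<open>p\<^sup>2 / dt\<^sup>2\<close>, so an inequality between polynomials on an interval becomes an inequality between
  quadratic forms.

  Lower bound: split \<open>u = R(N) u + Q(N) u\<close>. Coercivity controls \<open>a (R(N) u) (R(N) u)\<close>; since
  \<open>Q(N) u\<close> is a fine function, the cross term \<open>a (R(N) u) (Q(N) u)\<close> is a lumped product and dominates
  \<open>c \<parallel>Q(N) u\<parallel>\<^sup>2\<close> because \<open>(x + c) R(x) \<ge> c\<close> for \<open>x \<ge> c\<close>.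

  Upper bound: split \<open>u\<close> into its coarse and fine part. The damping gives
  \<open>dt\<^sup>2 x R(x) \<le> M = 2 + 2 / (1 + \<nu>)\<close> on the fine part, on the coarse part the mesh is quasi-uniform
  and the energy is at most \<open>k\<close> times the lumped norm with \<open>dt\<^sup>2 k \<le> \<nu> / (4 (\<nu> + 1))\<close>, and the
  Cauchy-Schwarz inequality combines both to the bound \<open>M + dt\<^sup>2 k\<close>.
\<close>

section \<open>Polynomials nonnegative on an interval\<close>

text \<open>The lower bound is not split into coarse and fine parts because \<open>N\<close> may
  have a kernel, and \<open>x R(x)\<close> has no positive lower bound near 0. Only on fine
  coefficients does coercivity push the spectrum of \<open>N\<close> up to at least
  \<open>c\<close>. Since \<open>R\<close> equals 1 at 0, \<open>1 - R\<close> is divisible by the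
  variable, so \<open>(1 - R)(N) u\<close> is the image of the fine vector \<open>N u\<close> under
  a polynomial of \<open>N\<close>, and everything critical happens where the spectrum is under
  control. For the upper bound put y = \<nu> / (\<nu> + 1). Then M = 4 - 2 y, while the CFL factor 3
  + Ccont / ccoer is at least 4 and leaves at most y / 4 for the coarse part; the sum stays below 4
  - y. The analytic obstacle is the link between hypotheses and finite elements. The H1 norm
  contains an arbitrarily chosen weak gradient, and \<open>C_inv_loc\<close> is an infimum of reals,
  informative only if some constant is admissible. Hence the chosen weak gradient is identified a.e.
  with the classical gradient on each simplex, and an inverse inequality for polynomials is
  established.\<close>

text \<open>
  Replaces the spectral theorem: a functional of the form \<open>q \<mapsto> \<langle>q(N) u, u\<rangle>\<close> with \<open>lo \<le> N \<le> hi\<close> is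
  nonnegative on the polynomials that are nonnegative on the interval. Such a polynomial is a product of
  factors, each of which preserves the class of functionals.
\<close>

definition interval_moment_functional :: "real \<Rightarrow> real \<Rightarrow> (real poly \<Rightarrow> real) \<Rightarrow> bool" where
  "interval_moment_functional lo hi L \<longleftrightarrow>
     (\<forall>p q. L (p + q) = L p + L q) \<and> (\<forall>c p. L (smult c p) = c * L p) \<and>
     (\<forall>s. 0 \<le> L (s * s)) \<and> (\<forall>s. 0 \<le> L ([:- lo, 1:] * (s * s))) \<and>
     (\<forall>s. 0 \<le> L ([:hi, - 1:] * (s * s)))"

text \<open>Each admissible factor is a square, a square plus a squared constant, or an endpoint
  factor (x - lo or hi - x) plus a nonnegative constant. Hence only products of two endpoint factors
  need an argument, and two equal ones again form a square.\<close>

lemma interval_moment_functional_mult: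
  assumes L: "interval_moment_functional lo hi L" and lohi: "lo < hi"
    and g: "g = [:-r, 1:] * [:-r, 1:] \<or> (g = [:-r, 1:] \<and> r \<le> lo) \<or> (g = [:r, -1:] \<and> hi \<le> r)
            \<or> (\<exists>b. g = [:-r, 1:] * [:-r, 1:] + [:b^2:])"
  shows "interval_moment_functional lo hi (\<lambda>q. L (g * q))"
proof -
  have add: "L (p + q) = L p + L q" and sm: "L (smult c p) = c * L p"
    and s0: "0 \<le> L (s * s)" and s1: "0 \<le> L ([:- lo, 1:] * (s * s))"
    and s2: "0 \<le> L ([:hi, - 1:] * (s * s))" for p q c s
    using L unfolding interval_moment_functional_def by auto
  have lin: "L (g * (p + q)) = L (g * p) + L (g * q)" "L (g * smult c p) = c * L (g * p)" for p q c
    by (simp_all add: distrib_left add sm)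
  \<comment> \<open>The mixed product follows from (hi - lo)(x - lo)(hi - x) = (x - lo)(hi - x)^2 +
    (hi - x)(x - lo)^2, where \<open>lo < hi\<close> permits the division.\<close>
  have s3: "0 \<le> L ([:- lo, 1:] * ([:hi, -1:] * (s * s)))" for s
  proof -
    have "smult (hi - lo) ([:- lo, 1:] * ([:hi, -1:] * (s * s)))
        = [:- lo, 1:] * (([:hi, -1:] * s) * ([:hi, -1:] * s))
        + [:hi, -1:] * (([:- lo, 1:] * s) * ([:- lo, 1:] * s))"
    proof -
      have e: "[:- lo, 1:] + [:hi, -1:] = [:hi - lo:]" by simp
      have "[:- lo, 1:] * (([:hi, -1:] * s) * ([:hi, -1:] * s))
        + [:hi, -1:] * (([:- lo, 1:] * s) * ([:- lo, 1:] * s))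
        = ([:- lo, 1:] + [:hi, -1:]) * ([:- lo, 1:] * ([:hi, -1:] * (s * s)))"
        by (simp only: distrib_right distrib_left ac_simps)
      then show ?thesis unfolding e by simp
    qed
    then have "(hi - lo) * L ([:- lo, 1:] * ([:hi, -1:] * (s * s))) \<ge> 0"
      by (metis sm add add_nonneg_nonneg s1 s2)
    then show ?thesis using lohi by (simp add: zero_le_mult_iff)
  qed
  have sq: "0 \<le> L (([:-r, 1:] * [:-r, 1:]) * (s * s))"
    "0 \<le> L (([:-r, 1:] * [:-r, 1:]) * ([:- lo, 1:] * (s * s)))"
    "0 \<le> L (([:-r, 1:] * [:-r, 1:]) * ([:hi, -1:] * (s * s)))" for s
  proof -
    have c: "([:-r, 1:] * [:-r, 1:]) * (t * (s * s)) = t * (([:-r, 1:] * s) * ([:-r, 1:] * s))" for t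
      by (simp only: ac_simps)
    show "0 \<le> L (([:-r, 1:] * [:-r, 1:]) * (s * s))" using s0[of "[:-r, 1:] * s"] c[of 1]
      by (metis mult_1)
    show "0 \<le> L (([:-r, 1:] * [:-r, 1:]) * ([:- lo, 1:] * (s * s)))" unfolding c by (rule s1)
    show "0 \<le> L (([:-r, 1:] * [:-r, 1:]) * ([:hi, -1:] * (s * s)))" unfolding c by (rule s2)
  qed
  consider (sq) "g = [:-r, 1:] * [:-r, 1:]" | (lo) "g = [:-r, 1:]" "r \<le> lo"
    | (hi) "g = [:r, -1:]" "hi \<le> r" | (qu) b where "g = [:-r, 1:] * [:-r, 1:] + [:b^2:]"
    using g by blast
  then have "0 \<le> L (g * (s * s)) \<and> 0 \<le> L (g * ([:- lo, 1:] * (s * s)))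
      \<and> 0 \<le> L (g * ([:hi, - 1:] * (s * s)))" for s
  proof cases
    case sq
    then show ?thesis using \<open>0 \<le> L (([:-r, 1:] * [:-r, 1:]) * (s * s))\<close>
      using \<open>\<And>s. 0 \<le> L (([:-r, 1:] * [:-r, 1:]) * ([:- lo, 1:] * (s * s)))\<close>
       \<open>\<And>s. 0 \<le> L (([:-r, 1:] * [:-r, 1:]) * ([:hi, -1:] * (s * s)))\<close> by blast
  next
    case lo
    have g: "g * t = [:-lo, 1:] * t + smult (lo - r) t" for t
    proof -
      have "g = [:-lo, 1:] + [:lo - r:]" unfolding lo by simp
      then show ?thesis by (simp only: distrib_right) simp
    qed
    have c: "[:-lo, 1:] * ([:-lo, 1:] * (s * s)) = ([:-lo, 1:] * s) * ([:-lo, 1:] * s)"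
      by (simp only: ac_simps)
    show ?thesis unfolding g add sm c using lo(2) s0 s1 s2 s3
      by (intro conjI add_nonneg_nonneg mult_nonneg_nonneg) auto
  next
    case hi
    have g: "g * t = [:hi, -1:] * t + smult (r - hi) t" for t
    proof -
      have "g = [:hi, -1:] + [:r - hi:]" unfolding hi by simp
      then show ?thesis by (simp only: distrib_right) simp
    qed
    have c: "[:hi, -1:] * ([:hi, -1:] * (s * s)) = ([:hi, -1:] * s) * ([:hi, -1:] * s)"
      "[:hi, -1:] * ([:-lo, 1:] * (s * s)) = [:-lo, 1:] * ([:hi, -1:] * (s * s))"
      by (simp_all only: ac_simps)
    show ?thesis unfolding g add sm c using hi(2) s0 s1 s2 s3
      by (intro conjI add_nonneg_nonneg mult_nonneg_nonneg) auto
  next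
    case qu
    have g: "g * t = ([:-r, 1:] * [:-r, 1:]) * t + smult (b^2) t" for t
      unfolding qu by (simp only: distrib_right) simp
    show ?thesis unfolding g add sm using s0 s1 s2 sq
      by (intro conjI add_nonneg_nonneg mult_nonneg_nonneg) auto
  qed
  then show ?thesis unfolding interval_moment_functional_def using lin by blast
qed

text \<open>Cancelling a factor leaves the sign of the cofactor open at the root \<open>r\<close>;
  continuity fills in \<open>r\<close> and the two endpoints.\<close>

lemma poly_nonneg_at_limit:
  fixes q :: "real poly"
  assumes "lo < hi" "lo \<le> x" "x \<le> hi" "\<And>y. lo < y \<Longrightarrow> y < hi \<Longrightarrow> y \<noteq> r \<Longrightarrow> 0 \<le> poly q y"
  shows "0 \<le> poly q x"
proof (rule ccontr)
  assume "\<not> 0 \<le> poly q x"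
  then have "poly q x < 0" by simp
  moreover have "isCont (poly q) x" by simp
  ultimately have "\<forall>\<^sub>F y in at x. poly q y < 0"
    unfolding isCont_def using order_tendstoD(2) by blast
  then obtain e where e: "e > 0" "\<And>y. y \<noteq> x \<Longrightarrow> dist y x < e \<Longrightarrow> poly q y < 0"
    unfolding eventually_at by auto
  have "max lo (x - e) < min hi (x + e)" using assms e by auto
  then have "infinite {max lo (x - e)<..<min hi (x + e)}" by (simp add: infinite_Ioo)
  then have "infinite ({max lo (x - e)<..<min hi (x + e)} - {x, r})" by simp
  then obtain y where "y \<in> {max lo (x - e)<..<min hi (x + e)} - {x, r}"
    by (meson finite.emptyI finite_subset subsetI)
  then show False using assms(4)[of y] e(2)[of y] by (auto simp: dist_real_def abs_less_iff)
qed

lemma map_poly_of_real_add: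
  "map_poly complex_of_real (p + q) = map_poly of_real p + map_poly of_real q"
  by (rule poly_eqI) (simp add: coeff_map_poly)

lemma map_poly_of_real_mult:
  "map_poly complex_of_real (p * q) = map_poly of_real p * map_poly of_real q"
  by (rule poly_eqI) (simp add: coeff_map_poly coeff_mult)

lemma poly_map_poly_of_real: "poly (map_poly complex_of_real p) (of_real x) = of_real (poly p x)"
  by (induction p) (auto simp: map_poly_pCons)

text \<open>Division by the real quadratic with roots z and its conjugate leaves a real remainder of
  degree at most 1, and a non-real zero of such a remainder forces it to vanish.\<close>

lemma real_poly_complex_root_factor:
  fixes q :: "real poly" and z :: complex
  assumes "poly (map_poly of_real q) z = 0" "Im z \<noteq> 0"
  shows "[:- Re z, 1:] * [:- Re z, 1:] + [:(Im z)^2:] dvd q"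
proof -
  define g :: "real poly" where "g = [:- Re z, 1:] * [:- Re z, 1:] + [:(Im z)^2:]"
  define ev where "ev = (\<lambda>q::real poly. poly (map_poly of_real q) z)"
  have ev_add: "ev (a + b) = ev a + ev b" and ev_mult: "ev (a * b) = ev a * ev b" for a b
    unfolding ev_def
    by (simp_all add: map_poly_of_real_add map_poly_of_real_mult)
  have deg: "degree g = 2" unfolding g_def by simp
  have "ev g = 0" unfolding g_def ev_def
    by (simp add: complex_eq_iff power2_eq_square algebra_simps map_poly_pCons)
  moreover have "ev q = ev (q div g) * ev g + ev (q mod g)"
    by (metis ev_add ev_mult div_mult_mod_eq)
  ultimately have r: "ev (q mod g) = 0" using assms(1) ev_def by simp
  have "q mod g = 0 \<or> degree (q mod g) < 2" using degree_mod_less'[of g q] deg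
    by (metis degree_0 degree_mod_less zero_neq_numeral)
  then obtain r0 r1 where m: "q mod g = [:r0, r1:]"
    by (metis One_nat_def degree_pCons_eq_if degree_0 degree_eq_zeroE less_2_cases_iff nat.distinct(1)
        nat.inject pCons_0_0 pCons_cases)
  have "of_real r0 + z * of_real r1 = 0" using r unfolding m ev_def by (simp add: map_poly_pCons)
  then have "r1 = 0" "r0 = 0" using assms(2) by (auto simp: complex_eq_iff)
  then have "q mod g = 0" using m by simp
  then show ?thesis unfolding g_def[symmetric] by auto
qed

text \<open>Induction on the degree with the functional generalized: once a factor g is split off,
  the induction hypothesis is applied to the functional that first multiplies by g. The fundamental
  theorem of algebra supplies a root, and its position decides which kind of factor is
  removed.\<close>

lemma interval_moment_functional_nonneg:
  assumes "interval_moment_functional lo hi L" "lo < hi"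
    and "\<And>x. lo \<le> x \<Longrightarrow> x \<le> hi \<Longrightarrow> 0 \<le> poly q x"
  shows "0 \<le> L q"
  using assms(1,3)
proof (induction "degree q" arbitrary: q L rule: less_induct)
  case less
  note L = less.prems(1) and q = less.prems(2)
  have sm: "L (smult c p) = c * L p" and s0: "0 \<le> L (s * s)" for c s p
    using L unfolding interval_moment_functional_def by auto
  show ?case
  proof (cases "degree q = 0")
    case True
    then obtain c where c: "q = [:c:]" by (auto elim: degree_eq_zeroE)
    have "q = smult c (1 * 1)" by (simp add: c)
    moreover have "0 \<le> c" using q[of lo] assms(2) by (simp add: c)
    ultimately show ?thesis using sm s0 by (metis mult_nonneg_nonneg)
  next
    case False
    have q0: "q \<noteq> 0" using False by auto
    have step: "0 \<le> L q" if "q = g * q1" "degree g > 0"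
      "g = [:-r, 1:] * [:-r, 1:] \<or> (g = [:-r, 1:] \<and> r \<le> lo) \<or> (g = [:r, -1:] \<and> hi \<le> r)
            \<or> (\<exists>b. g = [:-r, 1:] * [:-r, 1:] + [:b^2:])"
      "\<And>x. lo \<le> x \<Longrightarrow> x \<le> hi \<Longrightarrow> 0 \<le> poly q1 x" for g r q1
    proof -
      have "degree q1 < degree q" using that(1,2) q0 by (auto simp: degree_mult_eq)
      then have "0 \<le> L (g * q1)"
        using less.hyps[OF _ interval_moment_functional_mult[OF L assms(2) that(3)] that(4)] by simp
      then show ?thesis using that(1) by simp
    qed
    have "degree (map_poly complex_of_real q) \<noteq> 0" using False by (simp add: degree_map_poly)
    then have "\<not> constant (poly (map_poly complex_of_real q))" by (simp add: constant_degree)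
    then obtain z where z: "poly (map_poly complex_of_real q) z = 0"
      using fundamental_theorem_of_algebra by blast
    show ?thesis
    proof (cases "Im z = 0")
      case False
      from real_poly_complex_root_factor[OF z this]
      obtain q1 where q1: "q = ([:- Re z, 1:] * [:- Re z, 1:] + [:(Im z)^2:]) * q1" by (rule dvdE)
      show ?thesis
      proof (rule step[OF q1])
        show "degree ([:- Re z, 1:] * [:- Re z, 1:] + [:(Im z)^2:]) > 0" by simp
        fix x assume x: "lo \<le> x" "x \<le> hi"
        have "poly q x = ((x - Re z)^2 + (Im z)^2) * poly q1 x"
          unfolding q1 by (simp add: power2_eq_square algebra_simps)
        moreover have "(x - Re z)^2 + (Im z)^2 > 0" using False by (simp add: sum_power2_gt_zero_iff)
        ultimately show "0 \<le> poly q1 x" using q[OF x] by (simp add: zero_le_mult_iff)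
      qed auto
    next
      case True
      define r where "r = Re z"
      have "z = of_real r" using True r_def by (simp add: complex_eq_iff)
      then have "poly q r = 0" using z by (simp add: poly_map_poly_of_real)
      then obtain q1 where q1: "q = [:-r, 1:] * q1" using poly_eq_0_iff_dvd by (metis dvdE)
      have pq: "poly q x = (x - r) * poly q1 x" for x unfolding q1 by (simp add: algebra_simps)
      consider "r \<le> lo" | "hi \<le> r" | "lo < r" "r < hi" by linarith
      then show ?thesis
      proof cases
        case 1
        show ?thesis
        proof (rule step[OF q1])
          fix x assume x: "lo \<le> x" "x \<le> hi"
          show "0 \<le> poly q1 x"
          proof (rule poly_nonneg_at_limit[OF assms(2) x, of lo])
            fix y assume "lo < y" "y < hi"
            then show "0 \<le> poly q1 y" using q[of y] pq[of y] 1 by (simp add: zero_le_mult_iff)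
          qed
        qed (use 1 in auto)
      next
        case 2
        have q1': "q = [:r, -1:] * (- q1)" unfolding q1 by (simp add: algebra_simps)
        show ?thesis
        proof (rule step[OF q1'])
          fix x assume x: "lo \<le> x" "x \<le> hi"
          show "0 \<le> poly (- q1) x"
          proof (rule poly_nonneg_at_limit[OF assms(2) x, of lo])
            fix y assume "lo < y" "y < hi"
            then show "0 \<le> poly (- q1) y" using q[of y] pq[of y] 2 by (simp add: zero_le_mult_iff)
          qed
        qed (use 2 in auto)
      next
        case 3
        \<comment> \<open>A root inside the interval is at least double: the cofactor is nonnegative
          to its right and nonpositive to its left, hence zero at \<open>r\<close>.\<close>
        have "0 \<le> poly q1 r"
        proof (rule poly_nonneg_at_limit[of r hi r lo])
          fix y assume "r < y" "y < hi"
          then show "0 \<le> poly q1 y" using q[of y] pq[of y] 3 by (simp add: zero_le_mult_iff)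
        qed (use 3 in auto)
        moreover have "0 \<le> poly (- q1) r"
        proof (rule poly_nonneg_at_limit[of lo r r lo])
          fix y assume "lo < y" "y < r"
          then show "0 \<le> poly (- q1) y" using q[of y] pq[of y] 3 by (simp add: zero_le_mult_iff)
        qed (use 3 in auto)
        ultimately have "poly q1 r = 0" by simp
        then obtain q2 where q2: "q1 = [:-r, 1:] * q2" using poly_eq_0_iff_dvd by (metis dvdE)
        have q2': "q = ([:-r, 1:] * [:-r, 1:]) * q2" unfolding q1 q2 by (simp only: ac_simps)
        have pq2: "poly q x = (x - r)^2 * poly q2 x" for x
          unfolding pq by (simp add: q2 algebra_simps power2_eq_square)
        show ?thesis
        proof (rule step[OF q2'])
          fix x assume x: "lo \<le> x" "x \<le> hi"
          show "0 \<le> poly q2 x"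
          proof (rule poly_nonneg_at_limit[OF assms(2) x, of r])
            fix y assume "lo < y" "y < hi" "y \<noteq> r"
            then show "0 \<le> poly q2 y" using q[of y] pq2[of y] by (simp add: zero_le_mult_iff)
          qed
        qed auto
      qed
    qed
  qed
qed

section \<open>Stabilized Chebyshev polynomials\<close>

lemma poly_cheb_Suc_Suc:
  "poly (cheb (Suc (Suc n))) x = 2 * x * poly (cheb (Suc n)) x - poly (cheb n) x"
  by simp

lemma poly_cheb_cos: "poly (cheb n) (cos t) = cos (real n * t)"
proof (induction n rule: cheb.induct)
  case (3 n)
  have "cos (real (Suc (Suc n)) * t) + cos (real n * t) = 2 * cos t * cos (real (Suc n) * t)"
    using cos_add[of "real (Suc n) * t" t] cos_diff[of "real (Suc n) * t" t]
    by (simp add: algebra_simps)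
  then show ?case using 3 by (simp add: poly_cheb_Suc_Suc del: cheb.simps)
qed simp_all

lemma poly_cheb_cosh: "poly (cheb n) (cosh t) = cosh (real n * t)"
proof (induction n rule: cheb.induct)
  case (3 n)
  have "cosh (real (Suc (Suc n)) * t) + cosh (real n * t) = 2 * cosh t * cosh (real (Suc n) * t)"
    using cosh_add[of "real (Suc n) * t" t] cosh_diff[of "real (Suc n) * t" t]
    by (simp add: algebra_simps)
  then show ?case using 3 by (simp add: poly_cheb_Suc_Suc del: cheb.simps)
qed simp_all

lemma cheb_abs_le_1:
  assumes "-1 \<le> x" "x \<le> 1"
  shows "\<bar>poly (cheb n) x\<bar> \<le> 1"
  using poly_cheb_cos[of n "arccos x"] assms by (simp add: cos_arccos)

lemma abs_sin_mult_le: "\<bar>sin (real n * t)\<bar> \<le> real n * \<bar>sin t\<bar>"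
proof (induction n)
  case (Suc n)
  have "sin (real (Suc n) * t) = sin (real n * t) * cos t + cos (real n * t) * sin t"
    using sin_add[of "real n * t" t] by (simp add: algebra_simps)
  then have "\<bar>sin (real (Suc n) * t)\<bar> \<le> \<bar>sin (real n * t)\<bar> * \<bar>cos t\<bar> + \<bar>cos (real n * t)\<bar> * \<bar>sin t\<bar>"
    by (metis abs_mult abs_triangle_ineq)
  also have "\<dots> \<le> \<bar>sin (real n * t)\<bar> * 1 + 1 * \<bar>sin t\<bar>"
    by (intro add_mono mult_left_mono mult_right_mono) auto
  finally show ?case using Suc by (simp add: algebra_simps)
qed simp

lemma cheb_ge_tangent_at_1:
  assumes "-1 \<le> x" "x \<le> 1"
  shows "poly (cheb n) x \<ge> 1 - (real n)^2 * (1 - x)"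
proof -
  define t where "t = arccos x / 2"
  have x: "x = cos (2 * t)" using assms by (simp add: t_def)
  have "\<bar>sin (real n * t)\<bar>^2 \<le> (real n * \<bar>sin t\<bar>)^2" by (intro power_mono abs_sin_mult_le) simp
  then have "(sin (real n * t))^2 \<le> (real n)^2 * (sin t)^2" by (simp add: power_mult_distrib)
  moreover have "poly (cheb n) x = 1 - 2 * (sin (real n * t))^2"
    unfolding x poly_cheb_cos using cos_double_sin[of "real n * t"] by (simp add: algebra_simps)
  moreover have "1 - x = 2 * (sin t)^2" unfolding x by (simp add: cos_double_sin)
  ultimately show ?thesis by simp
qed

text \<open>One induction carries all the claims, because the recursion can be written as T_{n+2} -
  T_{n+1} = (T_{n+1} - T_n) + 2 (x - 1) T_{n+1}. Differentiating this once or twice produces only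
  terms that are nonnegative for x \<ge> 1.\<close>

lemma cheb_derivs_ge_1:
  assumes "1 \<le> (x::real)"
  shows "poly (cheb n) x \<ge> 1 \<and> poly (cheb (Suc n)) x \<ge> poly (cheb n) x
    \<and> poly (pderiv (cheb n)) x \<ge> 0 \<and> poly (pderiv (cheb (Suc n))) x \<ge> poly (pderiv (cheb n)) x
    \<and> poly (pderiv (pderiv (cheb n))) x \<ge> 0
    \<and> poly (pderiv (pderiv (cheb (Suc n)))) x \<ge> poly (pderiv (pderiv (cheb n))) x"
proof (induction n)
  case 0
  then show ?case using assms by (simp add: pderiv_pCons)
next
  case (Suc n)
  let ?T = "cheb (Suc n)"
  have rec: "cheb (Suc (Suc n)) - ?T = (?T - cheb n) + [:-2, 2:] * ?T"
    by (simp add: algebra_simps numeral_poly)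
  have "poly (cheb (Suc (Suc n)) - ?T) x
      = poly ?T x - poly (cheb n) x + 2 * (x - 1) * poly ?T x"
    unfolding rec by (simp add: algebra_simps)
  moreover have "poly (pderiv (cheb (Suc (Suc n)) - ?T)) x
      = poly (pderiv ?T) x - poly (pderiv (cheb n)) x + 2 * poly ?T x + 2 * (x - 1) * poly (pderiv ?T) x"
    unfolding rec by (simp add: pderiv_add pderiv_diff pderiv_mult pderiv_pCons pderiv_smult algebra_simps del: cheb.simps)
  moreover have "poly (pderiv (pderiv (cheb (Suc (Suc n)) - ?T))) x
      = poly (pderiv (pderiv ?T)) x - poly (pderiv (pderiv (cheb n))) x + 4 * poly (pderiv ?T) x
       + 2 * (x - 1) * poly (pderiv (pderiv ?T)) x"
    unfolding rec by (simp add: pderiv_add pderiv_diff pderiv_mult pderiv_pCons pderiv_smult algebra_simps del: cheb.simps)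
  moreover have "0 \<le> 2 * (x - 1) * poly ?T x" "0 \<le> 2 * (x - 1) * poly (pderiv ?T) x"
    "0 \<le> 2 * (x - 1) * poly (pderiv (pderiv ?T)) x"
    using Suc assms by (auto intro!: mult_nonneg_nonneg simp del: cheb.simps)
  ultimately show ?case using Suc by (auto simp: pderiv_diff simp del: cheb.simps)
qed

lemma cheb_at_1: "poly (cheb n) 1 = 1"
  using poly_cheb_cos[of n 0] by simp

lemma pderiv_cheb_at_1: "poly (pderiv (cheb n)) 1 = (real n)^2"
proof (induction n rule: cheb.induct)
  case (3 n)
  then show ?case using cheb_at_1[of "Suc n"]
    by (simp add: pderiv_diff pderiv_mult pderiv_pCons pderiv_smult power2_eq_square algebra_simps del: cheb.simps(2))
qed (simp_all add: pderiv_pCons)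

lemma pderiv_cheb_mono:
  assumes "1 \<le> x" "x \<le> (y::real)"
  shows "poly (pderiv (cheb n)) x \<le> poly (pderiv (cheb n)) y"
proof (cases "x = y")
  case False
  then obtain z where "x < z" "z < y"
    "poly (pderiv (cheb n)) y - poly (pderiv (cheb n)) x = (y - x) * poly (pderiv (pderiv (cheb n))) z"
    using poly_MVT[of x y "pderiv (cheb n)"] assms by auto
  moreover from this have "0 \<le> (y - x) * poly (pderiv (pderiv (cheb n))) z"
    using cheb_derivs_ge_1[of z n] assms by (intro mult_nonneg_nonneg) auto
  ultimately show ?thesis by linarith
qed simp

text \<open>Mean value theorem: on [1, y] the derivative increases from n^2 at 1 to its value at
  y.\<close>

lemma cheb_increment_bounds:
  assumes "1 \<le> x" "x \<le> (y::real)"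
  shows "poly (cheb n) y - poly (cheb n) x \<ge> (real n)^2 * (y - x)"
    "poly (cheb n) y - poly (cheb n) x \<le> poly (pderiv (cheb n)) y * (y - x)"
proof -
  have "(real n)^2 * (y - x) \<le> poly (cheb n) y - poly (cheb n) x
    \<and> poly (cheb n) y - poly (cheb n) x \<le> poly (pderiv (cheb n)) y * (y - x)"
  proof (cases "x = y")
    case False
    then obtain z where z: "x < z" "z < y"
      "poly (cheb n) y - poly (cheb n) x = (y - x) * poly (pderiv (cheb n)) z"
      using poly_MVT[of x y "cheb n"] assms by auto
    have "(real n)^2 \<le> poly (pderiv (cheb n)) z" "poly (pderiv (cheb n)) z \<le> poly (pderiv (cheb n)) y"
      using pderiv_cheb_mono[of 1 z n] pderiv_cheb_mono[of z y n] z assms pderiv_cheb_at_1[of n] by auto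
    then show ?thesis unfolding z(3) using assms by (simp add: mult.commute mult_left_mono)
  qed simp
  then show "poly (cheb n) y - poly (cheb n) x \<ge> (real n)^2 * (y - x)"
    "poly (cheb n) y - poly (cheb n) x \<le> poly (pderiv (cheb n)) y * (y - x)" by auto
qed

text \<open>A crude bound through cosh 1 \<le> 2. Its factor 2 is what later turns Y into Y / 2 in
  the lower bound for \<open>P_pnu\<close>.\<close>

lemma sinh_le_double:
  assumes "0 \<le> s" "s \<le> (1::real)"
  shows "sinh s \<le> 2 * s"
proof (cases "s = 0")
  case False
  have "\<exists>z. 0 < z \<and> z < s \<and> sinh s - sinh 0 = (s - 0) * cosh z"
    using False assms by (intro MVT2) (auto intro!: derivative_eq_intros)
  then obtain z where z: "0 < z" "z < s" "sinh s = s * cosh z" by auto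
  have "cosh z \<le> cosh (1::real)" using z assms by (intro cosh_real_nonneg_le_iff[THEN iffD2]) auto
  also have "\<dots> \<le> 2"
  proof -
    have "exp (-1::real) \<le> 1" by simp
    then have "exp (1::real) + exp (-1) \<le> 4" using exp_le by linarith
    then show ?thesis unfolding cosh_field_def by simp
  qed
  finally show ?thesis unfolding z(3) using assms by (simp add: mult.commute mult_left_mono)
qed simp

lemma sinh_real_nonneg_ge:
  assumes "0 \<le> (t::real)"
  shows "t \<le> sinh t"
proof (cases "t = 0")
  case False
  have "\<exists>z. 0 < z \<and> z < t \<and> sinh t - sinh 0 = (t - 0) * cosh z"
    using False assms by (intro MVT2) (auto intro!: derivative_eq_intros)
  then obtain z where z: "sinh t = t * cosh z" by auto
  have "t * 1 \<le> t * cosh z" using assms by (intro mult_left_mono cosh_real_ge_1)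
  then show ?thesis unfolding z by simp
qed simp

lemma cosh_ge_quadratic: "1 + t^2 / 2 \<le> cosh (t::real)"
proof -
  have "\<bar>t / 2\<bar> \<le> \<bar>sinh (t / 2)\<bar>"
  proof (cases "0 \<le> t")
    case True
    then show ?thesis using sinh_real_nonneg_ge[of "t/2"] by simp
  next
    case False
    then show ?thesis using sinh_real_nonneg_ge[of "- (t/2)"] by simp
  qed
  then have "(t / 2)^2 \<le> (sinh (t / 2))^2" by (rule abs_le_square_iff[THEN iffD1])
  moreover have "cosh t = 1 + 2 * (sinh (t / 2))^2"
    using cosh_double[of "t/2"] cosh_square_eq[of "t/2"] by simp
  ultimately show ?thesis by (simp add: power_divide)
qed

text \<open>With x = cosh t the derivative is p sinh (p t) / sinh t. From t^2 / 2 \<le> cosh t - 1 =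
  \<nu> / p^2 it follows that (p t)^2 \<le> 2 \<nu> \<le> 1, so numerator and denominator are both
  comparable to their linear parts.\<close>

lemma pderiv_cheb_le_near_1:
  assumes p: "1 \<le> p" and nu: "0 < \<nu>" "\<nu> \<le> 1/2"
  shows "poly (pderiv (cheb p)) (1 + \<nu> / (real p)^2) \<le> 2 * (real p)^2"
proof -
  define x where "x = 1 + \<nu> / (real p)^2"
  have x1: "1 < x" using assms by (simp add: x_def)
  define t where "t = arcosh x"
  have t: "cosh t = x" "0 < t" using x1 by (auto simp: t_def arcosh_real_gt_1_iff)
  have "((\<lambda>t. poly (cheb p) (cosh t)) has_real_derivative (sinh t * poly (pderiv (cheb p)) (cosh t))) (at t)"
    by (auto intro!: derivative_eq_intros DERIV_chain2[OF poly_DERIV])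
  moreover have "((\<lambda>t. cosh (real p * t)) has_real_derivative (real p * sinh (real p * t))) (at t)"
    by (auto intro!: derivative_eq_intros)
  ultimately have D: "sinh t * poly (pderiv (cheb p)) x = real p * sinh (real p * t)"
    unfolding poly_cheb_cosh t(1) using DERIV_unique by blast
  have "t^2 / 2 \<le> \<nu> / (real p)^2" using cosh_ge_quadratic[of t] unfolding t x_def by simp
  then have "(real p * t)^2 \<le> 2 * \<nu>" using p by (simp add: field_simps power_mult_distrib)
  then have "(real p * t)^2 \<le> 1^2" using nu by simp
  then have "real p * t \<le> 1" by (rule power2_le_imp_le) simp
  then have "sinh (real p * t) \<le> 2 * (real p * t)" using t p by (intro sinh_le_double) auto
  then have "sinh t * poly (pderiv (cheb p)) x \<le> real p * (2 * (real p * t))"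
    unfolding D by (intro mult_left_mono) auto
  also have "\<dots> = t * (2 * (real p)^2)" by (simp add: power2_eq_square)
  also have "\<dots> \<le> sinh t * (2 * (real p)^2)" using t by (intro mult_right_mono sinh_real_nonneg_ge) auto
  finally show ?thesis unfolding x_def[symmetric] using t by simp
qed

text \<open>The tangent at \<delta> gives p^2 T \<le> p^2 + D \<nu> \<le> 3/2 D, hence \<omega> = 2
  D / T \<ge> 4/3 p^2. This last bound ensures that for Y \<le> p^2 the argument \<delta> - Y /
  \<omega> stays positive, inside the range where the Chebyshev estimates apply.\<close>

lemma stabilized_cheb_facts:
  assumes p: "1 \<le> p" and nu: "0 < \<nu>" "\<nu> \<le> 1/2"
  defines "\<delta> \<equiv> delta_pnu p \<nu>"
  shows "1 < \<delta>" "poly (cheb p) \<delta> \<ge> 1 + \<nu>" "(real p)^2 \<le> poly (pderiv (cheb p)) \<delta>"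
    "poly (pderiv (cheb p)) \<delta> \<le> 2 * (real p)^2" "4/3 * (real p)^2 \<le> omega_pnu p \<nu>"
proof -
  have p0: "0 < (real p)^2" using p by simp
  have d: "\<delta> - 1 = \<nu> / (real p)^2" by (simp add: \<delta>_def delta_pnu_def)
  then show d1: "1 < \<delta>" using nu p0 by (metis diff_gt_0_iff_gt divide_pos_pos)
  have pd: "(real p)^2 * (\<delta> - 1) = \<nu>" unfolding d using p0 by simp
  show T: "poly (cheb p) \<delta> \<ge> 1 + \<nu>" using cheb_increment_bounds(1)[of 1 \<delta> p] d1 pd
    by (simp add: cheb_at_1)
  show D: "(real p)^2 \<le> poly (pderiv (cheb p)) \<delta>" using pderiv_cheb_mono[of 1 \<delta> p] d1
    by (simp add: pderiv_cheb_at_1)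
  show "poly (pderiv (cheb p)) \<delta> \<le> 2 * (real p)^2"
    unfolding \<delta>_def delta_pnu_def by (rule pderiv_cheb_le_near_1[OF p nu])
  let ?D = "poly (pderiv (cheb p)) \<delta>" and ?T = "poly (cheb p) \<delta>"
  have "(real p)^2 * ?T \<le> (real p)^2 * (1 + ?D * (\<delta> - 1))"
    using cheb_increment_bounds(2)[of 1 \<delta> p] d1 by (intro mult_left_mono) (simp_all add: cheb_at_1)
  also have "\<dots> = (real p)^2 + ?D * ((real p)^2 * (\<delta> - 1))" by (simp add: algebra_simps)
  also have "\<dots> = (real p)^2 + ?D * \<nu>" unfolding pd ..
  also have "\<dots> \<le> ?D + ?D * (1/2)" using D nu less_le_trans[OF p0 D]
    by (intro add_mono mult_left_mono) auto
  finally have "4/3 * ((real p)^2 * ?T) \<le> 2 * ?D" by linarith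
  then show "4/3 * (real p)^2 \<le> omega_pnu p \<nu>"
    unfolding omega_pnu_def \<delta>_def[symmetric] using T nu by (subst pos_le_divide_eq) (auto simp: mult.assoc)
qed

lemma poly_P_pnu:
  "poly (P_pnu p \<nu>) Y = 2 * (1 - poly (cheb p) (delta_pnu p \<nu> - Y / omega_pnu p \<nu>)
      / poly (cheb p) (delta_pnu p \<nu>))"
  by (simp add: P_pnu_def poly_pcompose)

text \<open>In the variable y = \<delta> - Y / \<omega> the polynomial is 2 (T - t) / T and Y itself
  is 2 D (\<delta> - y) / T. So the bound by Y says that T_p lies above its tangent at \<delta>, the
  upper bound comes from t \<ge> -1 and T \<ge> 1 + \<nu>, and the two alternatives in the minimum
  belong to the oscillating and the monotone range of T_p.\<close>

lemma P_pnu_bounds: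
  assumes p: "1 \<le> p" and nu: "0 < \<nu>" "\<nu> \<le> 1/2" and Y: "0 \<le> Y" "Y \<le> (real p)^2"
  shows "0 \<le> poly (P_pnu p \<nu>) Y" "poly (P_pnu p \<nu>) Y \<le> Y"
    "poly (P_pnu p \<nu>) Y \<le> 2 + 2 / (1 + \<nu>)"
    "min (Y / 2) (2 * \<nu> / (1 + \<nu>)) \<le> poly (P_pnu p \<nu>) Y"
proof -
  define \<delta> where "\<delta> = delta_pnu p \<nu>"
  define T where "T = poly (cheb p) \<delta>"
  define D where "D = poly (pderiv (cheb p)) \<delta>"
  define \<omega> where "\<omega> = omega_pnu p \<nu>"
  define y where "y = \<delta> - Y / \<omega>"
  define t where "t = poly (cheb p) y"
  note f = stabilized_cheb_facts[OF p nu, folded \<delta>_def, folded T_def D_def \<omega>_def]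
  have p0: "0 < (real p)^2" using p by simp
  have w0: "0 < \<omega>" using f(5) p0 by linarith
  have T0: "0 < T" using f(2) nu by linarith
  have D0: "0 < D" using f(3) p0 by linarith
  have wD: "\<omega> = 2 * D / T" by (simp add: \<omega>_def omega_pnu_def D_def T_def \<delta>_def)
  have Yw: "Y / \<omega> \<le> 3/4" using f(5) Y w0 by (subst pos_divide_le_eq) auto
  have Yw': "0 \<le> Y / \<omega>" using Y w0 by simp
  have y: "0 \<le> y" "y \<le> \<delta>" "\<delta> - y = Y / \<omega>" using f(1) Yw Yw' unfolding y_def by linarith+
  have P: "poly (P_pnu p \<nu>) Y = 2 * (T - t) / T"
    unfolding poly_P_pnu using T0 by (simp add: T_def t_def y_def \<delta>_def \<omega>_def diff_divide_distrib)
  have YD: "Y = 2 * (D * (\<delta> - y)) / T" unfolding y(3) wD using D0 T0 by simp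
  \<comment> \<open>For y \<le> 1 the graph is compared with the tangent at 1, and the piece from 1
    to \<delta> is added; for y > 1 convexity on [1, \<delta>] suffices.\<close>
  have low: "- 1 \<le> t \<and> t \<le> T \<and> T - t \<le> D * (\<delta> - y)
    \<and> (t \<le> 1 \<or> (real p)^2 * (\<delta> - y) \<le> T - t)"
  proof (cases "y \<le> 1")
    case True
    have t: "\<bar>t\<bar> \<le> 1" unfolding t_def using y True by (intro cheb_abs_le_1) auto
    have "1 - (real p)^2 * (1 - y) \<le> t" unfolding t_def using y True by (intro cheb_ge_tangent_at_1) auto
    moreover have "(real p)^2 * (1 - y) \<le> D * (1 - y)" using f(3) True by (intro mult_right_mono) auto
    moreover have "T - 1 \<le> D * (\<delta> - 1)" using cheb_increment_bounds(2)[of 1 \<delta> p] f(1)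
      by (simp add: cheb_at_1 T_def D_def)
    ultimately have "T - t \<le> D * (\<delta> - y)" by (simp add: algebra_simps)
    then show ?thesis using t f(2) nu by auto
  next
    case False
    have "(real p)^2 * (\<delta> - y) \<le> T - t" "T - t \<le> D * (\<delta> - y)"
      using cheb_increment_bounds[of y \<delta> p] False y by (auto simp: T_def t_def D_def)
    moreover have "0 \<le> (real p)^2 * (\<delta> - y)" using y(2) by (intro mult_nonneg_nonneg) auto
    moreover have "1 \<le> t" using cheb_derivs_ge_1[of y p] False t_def by simp
    ultimately show ?thesis by auto
  qed
  show "0 \<le> poly (P_pnu p \<nu>) Y" unfolding P using low T0 by simp
  show "poly (P_pnu p \<nu>) Y \<le> Y" unfolding P
    by (subst YD) (use low T0 in \<open>auto intro!: divide_right_mono\<close>)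
  have "2 * (T - t) / T \<le> (2 * T + 2) / T" using low T0 by (intro divide_right_mono) auto
  also have "\<dots> = 2 + 2 / T" using T0 by (simp add: add_divide_distrib)
  also have "\<dots> \<le> 2 + 2 / (1 + \<nu>)" using f(2) nu by (intro add_left_mono divide_left_mono) auto
  finally show "poly (P_pnu p \<nu>) Y \<le> 2 + 2 / (1 + \<nu>)" unfolding P .
  from low consider "t \<le> 1" | "(real p)^2 * (\<delta> - y) \<le> T - t" by blast
  then show "min (Y / 2) (2 * \<nu> / (1 + \<nu>)) \<le> poly (P_pnu p \<nu>) Y"
  proof cases
    case 1
    \<comment> \<open>The damping at work: since T \<ge> 1 + \<nu>, the value stays away from 0 as
      soon as t \<le> 1.\<close>
    have "2 * \<nu> / (1 + \<nu>) = 2 - 2 / (1 + \<nu>)" using nu by (simp add: field_simps)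
    also have "\<dots> \<le> 2 - 2 / T" using f(2) nu by (intro diff_left_mono divide_left_mono) auto
    also have "\<dots> \<le> 2 * (T - t) / T" using 1 T0 by (simp add: field_simps)
    finally show ?thesis unfolding P by simp
  next
    case 2
    have "D * (\<delta> - y) \<le> 2 * ((real p)^2 * (\<delta> - y))"
      unfolding mult.assoc[symmetric] using f(4) y by (intro mult_right_mono) auto
    also have "\<dots> \<le> 2 * (T - t)" using 2 by (intro mult_left_mono) auto
    finally have "D * (\<delta> - y) \<le> 2 * (T - t)" .
    then have "Y / 2 \<le> 2 * (T - t) / T" unfolding YD using T0 by (simp add: divide_right_mono)
    then show ?thesis unfolding P min_le_iff_disj by (rule disjI1)
  qed
qed

lemma P_pnu_at_0:
  assumes p: "1 \<le> p" and nu: "0 < \<nu>" "\<nu> \<le> 1/2"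
  shows "poly (P_pnu p \<nu>) 0 = 0" "poly (pderiv (P_pnu p \<nu>)) 0 = 1"
proof -
  note f = stabilized_cheb_facts[OF p nu]
  have p0: "0 < (real p)^2" using p by simp
  have T0: "0 < poly (cheb p) (delta_pnu p \<nu>)" and D0: "0 < poly (pderiv (cheb p)) (delta_pnu p \<nu>)"
    using f nu p0 by linarith+
  show "poly (P_pnu p \<nu>) 0 = 0" unfolding poly_P_pnu using T0 by simp
  show "poly (pderiv (P_pnu p \<nu>)) 0 = 1"
    using T0 D0 by (simp add: P_pnu_def pderiv_smult pderiv_diff pderiv_pcompose pderiv_pCons
        poly_pcompose omega_pnu_def)
qed

text \<open>The division by the variable is exact because \<open>P_pnu\<close> vanishes at 0. The
  identity keeps the factor x so that it also covers x = 0, where the value of \<open>P_dt\<close>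
  is instead the derivative of \<open>P_pnu\<close>.\<close>

lemma P_dt_properties:
  assumes p: "1 \<le> p" and nu: "0 < \<nu>" "\<nu> \<le> 1/2" and dt: "0 < dt"
  shows "dt^2 * (x * poly (P_dt p \<nu> dt) x) = poly (P_pnu p \<nu>) (dt^2 * x)" "poly (P_dt p \<nu> dt) 0 = 1"
proof -
  define G where "G = pcompose (P_pnu p \<nu>) [:0, dt^2:]"
  have "poly G 0 = 0" using P_pnu_at_0(1)[OF p nu] by (simp add: G_def poly_pcompose)
  then have "[:0, 1:] dvd G" using poly_eq_0_iff_dvd[of G 0] by simp
  then have G: "G = [:0, 1:] * (G div [:0, 1:])" by (simp only: dvd_mult_div_cancel)
  have R: "P_dt p \<nu> dt = smult (1 / dt^2) (G div [:0, 1:])" by (simp add: P_dt_def G_def)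
  have "poly G x = x * poly (G div [:0, 1:]) x" by (subst G) simp
  then show "dt^2 * (x * poly (P_dt p \<nu> dt) x) = poly (P_pnu p \<nu>) (dt^2 * x)"
    unfolding R using dt by (simp add: G_def poly_pcompose mult.commute)
  have "poly (pderiv G) 0 = poly (G div [:0, 1:]) 0"
    by (subst G) (simp add: pderiv_mult pderiv_pCons)
  moreover have "poly (pderiv G) 0 = dt^2"
    using P_pnu_at_0(2)[OF p nu] by (simp add: G_def pderiv_pcompose poly_pcompose pderiv_pCons)
  ultimately have "poly (G div [:0, 1:]) 0 = dt^2" by simp
  then show "poly (P_dt p \<nu> dt) 0 = 1" unfolding R poly_smult using dt by simp
qed

lemma P_dt_bounds:
  assumes p: "1 \<le> p" and nu: "0 < \<nu>" "\<nu> \<le> 1/2" and dt: "0 < dt"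
    and x: "0 \<le> x" "x \<le> (real p)^2 / dt^2"
  shows "0 \<le> poly (P_dt p \<nu> dt) x" "poly (P_dt p \<nu> dt) x \<le> 1"
    "dt^2 * (x * poly (P_dt p \<nu> dt) x) \<le> 2 + 2 / (1 + \<nu>)"
    "0 < c \<Longrightarrow> c \<le> x \<Longrightarrow> c \<le> 2 * \<nu> / ((\<nu> + 1) * dt^2) \<Longrightarrow> c \<le> (x + c) * poly (P_dt p \<nu> dt) x"
proof -
  note R = P_dt_properties[OF p nu dt]
  define r where "r = poly (P_dt p \<nu> dt) x"
  have Y: "0 \<le> dt^2 * x" "dt^2 * x \<le> (real p)^2" using x dt by (auto simp: field_simps)
  note B = P_pnu_bounds[OF p nu Y, folded R(1), folded r_def]
  show "dt^2 * (x * r) \<le> 2 + 2 / (1 + \<nu>)" by (rule B(3))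
  have "0 \<le> r \<and> r \<le> 1"
  proof (cases "x = 0")
    case True
    then show ?thesis using R(2) r_def by simp
  next
    case False
    then have "0 < x" using x by simp
    then show ?thesis using B(1,2) dt by (auto simp: zero_le_mult_iff)
  qed
  then show "0 \<le> r" "r \<le> 1" by auto
  assume c: "0 < c" "c \<le> x" "c \<le> 2 * \<nu> / ((\<nu> + 1) * dt^2)"
  have "dt^2 * c \<le> 2 * \<nu> / (1 + \<nu>)" using c(3) dt nu by (simp add: pos_le_divide_eq add_pos_pos ac_simps)
  \<comment> \<open>Either alternative of the minimum is enough: R(x) \<ge> 1/2 together with x
    \<ge> c, or x R(x) \<ge> c outright.\<close>
  then consider "dt^2 * x / 2 \<le> dt^2 * (x * r)" | "dt^2 * c \<le> dt^2 * (x * r)"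
    using B(4) by linarith
  then show "c \<le> (x + c) * r"
  proof cases
    case 1
    then have "x * (1/2) \<le> x * r" using dt by simp
    then have "1/2 \<le> r" using c by (simp add: mult_le_cancel_left)
    then have "(c + c) * (1/2) \<le> (x + c) * r" using c by (intro mult_mono) auto
    then show ?thesis by simp
  next
    case 2
    then have "c \<le> x * r" using dt by simp
    moreover have "0 \<le> c * r" using c \<open>0 \<le> r \<and> r \<le> 1\<close> by simp
    ultimately show ?thesis by (simp add: distrib_right)
  qed
qed

section \<open>Polynomials of self-adjoint operators\<close>

definition linear_op :: "(('i \<Rightarrow> real) \<Rightarrow> ('i \<Rightarrow> real)) \<Rightarrow> bool" where
  "linear_op N \<longleftrightarrow> (\<forall>s t u v. N (\<lambda>z. s * u z + t * v z) = (\<lambda>z. s * N u z + t * N v z))"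

lemma linear_opD: "linear_op N \<Longrightarrow> N (\<lambda>z. s * u z + t * v z) = (\<lambda>z. s * N u z + t * N v z)"
  by (simp add: linear_op_def)

lemma linear_op_zero: "linear_op N \<Longrightarrow> N (\<lambda>z. 0) = (\<lambda>z. 0)"
  using linear_opD[of N 0 "\<lambda>z. 0" 0 "\<lambda>z. 0"] by simp

lemma linear_op_sum:
  assumes "linear_op N"
  shows "N (\<lambda>z. \<Sum>i\<in>I. k i * f i z) = (\<lambda>z. \<Sum>i\<in>I. k i * N (f i) z)"
proof (induction I rule: infinite_finite_induct)
  case (insert x F)
  have "N (\<lambda>z. k x * f x z + 1 * (\<Sum>i\<in>F. k i * f i z))
      = (\<lambda>z. k x * N (f x) z + 1 * N (\<lambda>z. \<Sum>i\<in>F. k i * f i z) z)"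
    by (rule linear_opD[OF assms])
  then show ?case using insert by simp
qed (simp_all add: linear_op_zero[OF assms])

text \<open>Horner form. It lets all further identities be shown by induction on the coefficient
  list, avoiding sums up to \<open>degree\<close>, which behaves badly under cancellation.\<close>

lemma poly_op_pCons:
  assumes "linear_op N"
  shows "poly_op (pCons a q) N c = (\<lambda>z. a * c z + N (poly_op q N c) z)"
proof (cases "q = 0")
  case True
  then show ?thesis using linear_op_zero[OF assms] by (auto simp: poly_op_def)
next
  case False
  have "poly_op (pCons a q) N c z = a * c z + (\<Sum>i\<le>degree q. coeff q i * N ((N ^^ i) c) z)" for z
    using False by (simp add: poly_op_def sum.atMost_Suc_shift del: sum.atMost_Suc)
  moreover have "N (poly_op q N c) z = (\<Sum>i\<le>degree q. coeff q i * N ((N ^^ i) c) z)" for z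
    unfolding poly_op_def by (subst linear_op_sum[OF assms]) simp
  ultimately show ?thesis by auto
qed

lemma poly_op_0: "poly_op 0 N c = (\<lambda>z. 0)"
  by (simp add: poly_op_def)

lemma poly_op_1: "poly_op 1 N c = c"
  by (simp add: poly_op_def)

lemma poly_op_lincomb:
  assumes "linear_op N"
  shows "poly_op (smult s p + smult t q) N c = (\<lambda>z. s * poly_op p N c z + t * poly_op q N c z)"
proof (induction p arbitrary: q)
  case 0
  show ?case
  proof (induction q)
    case (pCons a q)
    have "N (\<lambda>z. t * poly_op q N c z + 0 * poly_op q N c z) = (\<lambda>z. t * N (poly_op q N c) z + 0 * N (poly_op q N c) z)"
      by (rule linear_opD[OF assms])
    then show ?case using pCons by (simp add: poly_op_pCons[OF assms] poly_op_0 algebra_simps)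
  qed (simp add: poly_op_0)
next
  case (pCons a p)
  obtain b q' where q: "q = pCons b q'" by (cases q)
  show ?case unfolding q
    by (simp add: poly_op_pCons[OF assms] pCons.IH linear_opD[OF assms] algebra_simps)
qed

lemma poly_op_linear:
  assumes "linear_op N"
  shows "linear_op (poly_op q N)"
proof (induction q)
  case 0
  then show ?case by (simp add: linear_op_def poly_op_0)
next
  case (pCons a q)
  then show ?case
    by (simp add: linear_op_def poly_op_pCons[OF assms] algebra_simps linear_opD[OF assms])
qed

lemma poly_op_mult:
  assumes "linear_op N"
  shows "poly_op (p * q) N c = poly_op p N (poly_op q N c)"
proof (induction p)
  case 0
  then show ?case by (simp add: poly_op_0)
next
  case (pCons a p)
  have "poly_op (pCons a p * q) N c = poly_op (smult a q + smult 1 (pCons 0 (p * q))) N c"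
    by (simp add: mult_pCons_left)
  also have "\<dots> = (\<lambda>z. a * poly_op q N c z + 1 * poly_op (pCons 0 (p * q)) N c z)"
    by (rule poly_op_lincomb[OF assms])
  also have "\<dots> = poly_op (pCons a p) N (poly_op q N c)"
    by (simp add: poly_op_pCons[OF assms] pCons.IH)
  finally show ?case .
qed

lemma poly_op_X: "linear_op N \<Longrightarrow> poly_op [:0, 1:] N c = N c"
  by (simp add: poly_op_pCons poly_op_0 linear_op_zero)

text \<open>The invariant space \<open>W\<close> is a parameter because the lemma is used twice: for
  the energy on all coefficients, and for the lumped product on fine coefficients only, where
  \<open>N\<close> is self-adjoint for it. \<open>F\<close> may be degenerate.\<close>

lemma selfadjoint_moment_functional:
  assumes N: "linear_op N"
    and W: "\<And>w. w \<in> W \<Longrightarrow> N w \<in> W" "\<And>s t v w. v \<in> W \<Longrightarrow> w \<in> W \<Longrightarrow> (\<lambda>z. s * v z + t * w z) \<in> W"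
    and F: "\<And>s t u v w. F (\<lambda>z. s * u z + t * v z) w = s * F u w + t * F v w"
      "\<And>w. w \<in> W \<Longrightarrow> 0 \<le> F w w"
      "\<And>v w. v \<in> W \<Longrightarrow> w \<in> W \<Longrightarrow> F (N v) w = F v (N w)"
      "\<And>v w. F v w = F w v"
      "\<And>w. w \<in> W \<Longrightarrow> lo * F w w \<le> F (N w) w"
      "\<And>w. w \<in> W \<Longrightarrow> F (N w) w \<le> hi * F w w"
    and u: "u \<in> W"
  shows "interval_moment_functional lo hi (\<lambda>q. F (poly_op q N u) u)"
    and "\<And>q v. v \<in> W \<Longrightarrow> poly_op q N v \<in> W"
    and "\<And>q v w. v \<in> W \<Longrightarrow> w \<in> W \<Longrightarrow> F (poly_op q N v) w = F v (poly_op q N w)"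
proof -
  have z0: "(\<lambda>z. 0) \<in> W" using W(2)[OF u u, of 0 0] by simp
  show inW: "poly_op q N v \<in> W" if "v \<in> W" for q v
  proof (induction q)
    case (pCons a q)
    show ?case using W(2)[OF that W(1)[OF pCons.IH], of a 1] by (simp add: poly_op_pCons[OF N])
  qed (simp add: poly_op_0 z0)
  have F0: "F (\<lambda>z. 0) w = 0" for w using F(1)[of 0 "\<lambda>z. 0" 0 "\<lambda>z. 0" w] by simp
  have Fadd: "F (\<lambda>z. s * u z + v z) w = s * F u w + F v w" for s u v w
    using F(1)[of s u 1 v w] by simp
  show adj: "F (poly_op q N v) w = F v (poly_op q N w)" if vw: "v \<in> W" "w \<in> W" for q v w
    using vw
  proof (induction q arbitrary: v w)
    case 0
    then show ?case using F0 F(4) by (simp add: poly_op_0)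
  next
    case (pCons a q)
    have "F v (\<lambda>z. a * w z + N (poly_op q N w) z) = a * F v w + F v (N (poly_op q N w))"
      by (metis Fadd F(4))
    moreover have "N (poly_op q N w) = poly_op q N (N w)"
      by (simp only: poly_op_X[OF N, symmetric] poly_op_mult[OF N, symmetric] mult.commute)
    ultimately show ?case using pCons F(3) inW by (simp add: poly_op_pCons[OF N] Fadd W(1))
  qed
  have lin: "F (poly_op (smult s p + smult t q) N v) w = s * F (poly_op p N v) w + t * F (poly_op q N v) w"
    for s t p q v w unfolding poly_op_lincomb[OF N] F(1) ..
  show "interval_moment_functional lo hi (\<lambda>q. F (poly_op q N u) u)"
    unfolding interval_moment_functional_def
  proof (intro conjI allI)
    fix p q c
    show "F (poly_op (p + q) N u) u = F (poly_op p N u) u + F (poly_op q N u) u"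
      using lin[of 1 p 1 q] by simp
    show "F (poly_op (smult c p) N u) u = c * F (poly_op p N u) u"
      using lin[of c p 0 p] by simp
  next
    fix s
    let ?w = "poly_op s N u"
    have w: "?w \<in> W" using inW u by blast
    \<comment> \<open>Moving one factor s(N) to the second argument turns the value at g s^2 into
      the quadratic form of g(N) at w = s(N) u, where the spectral bounds are assumed.\<close>
    have sq: "F (poly_op (g * (s * s)) N u) u = F (poly_op g N ?w) ?w" for g
    proof -
      have "poly_op (g * (s * s)) N u = poly_op s N (poly_op g N ?w)"
        by (simp only: poly_op_mult[OF N, symmetric] ac_simps)
      then show ?thesis using adj inW u by simp
    qed
    show "0 \<le> F (poly_op (s * s) N u) u" using sq[of 1] F(2)[OF w] by (simp add: poly_op_1)
    have lo: "poly_op [:- lo, 1:] N ?w = (\<lambda>z. (- lo) * ?w z + 1 * N ?w z)"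
      and hi: "poly_op [:hi, - 1:] N ?w = (\<lambda>z. hi * ?w z + (- 1) * N ?w z)"
    proof -
      have "N (\<lambda>z. (-1) * ?w z + 0 * ?w z) = (\<lambda>z. (-1) * N ?w z + 0 * N ?w z)" by (rule linear_opD[OF N])
      then show "poly_op [:- lo, 1:] N ?w = (\<lambda>z. (- lo) * ?w z + 1 * N ?w z)"
        "poly_op [:hi, - 1:] N ?w = (\<lambda>z. hi * ?w z + (- 1) * N ?w z)"
        by (simp_all add: poly_op_pCons[OF N] poly_op_0 linear_op_zero[OF N])
    qed
    show "0 \<le> F (poly_op ([:- lo, 1:] * (s * s)) N u) u"
      unfolding sq lo F(1) using F(5)[OF w] by simp
    show "0 \<le> F (poly_op ([:hi, - 1:] * (s * s)) N u) u"
      unfolding sq hi F(1) using F(6)[OF w] by simp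
  qed
qed

section \<open>Energy estimates for a splitting into coarse and fine coefficients\<close>

lemma lumped_lincomb: "lumped Sig d (\<lambda>z. s * u z + t * v z) w = s * lumped Sig d u w + t * lumped Sig d v w"
  by (simp add: lumped_def sum_distrib_left sum.distrib[symmetric] algebra_simps)

lemma lumped_commute: "lumped Sig d u v = lumped Sig d v u"
  by (simp add: lumped_def mult.commute mult.left_commute)

lemma lumped_nonneg: "\<forall>z\<in>Sig. 0 < d z \<Longrightarrow> 0 \<le> lumped Sig d u u"
  unfolding lumped_def mult.assoc
  by (intro sum_nonneg mult_nonneg_nonneg[of "d _"] zero_le_square) (auto intro: less_imp_le)

text \<open>Young's inequality, obtained from nonnegativity of the form at s u - v; the weight s is
  kept free so that each application can tune it.\<close>

lemma psd_form_sum_le: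
  fixes F :: "('i \<Rightarrow> real) \<Rightarrow> ('i \<Rightarrow> real) \<Rightarrow> real"
  assumes F: "\<And>s t u v w. F (\<lambda>z. s * u z + t * v z) w = s * F u w + t * F v w"
    "\<And>v w. F v w = F w v" "\<And>w. 0 \<le> F w w" and s: "0 < s"
  shows "F (\<lambda>z. u z + v z) (\<lambda>z. u z + v z) \<le> (1 + s) * F u u + (1 + 1 / s) * F v v"
proof -
  have q: "F (\<lambda>z. a * u z + b * v z) (\<lambda>z. a * u z + b * v z)
      = a^2 * F u u + 2 * a * b * F u v + b^2 * F v v" for a b
    unfolding F(1) F(2)[of _ "\<lambda>z. a * u z + b * v z"] using F(2)[of u v]
    by (simp add: algebra_simps power2_eq_square)
  have "0 \<le> s^2 * F u u + 2 * s * (-1) * F u v + (-1)^2 * F v v" using F(3) q[of s "-1"] by metis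
  then have "s * (2 * F u v) \<le> s * (s * F u u + F v v / s)" using s by (simp add: algebra_simps power2_eq_square)
  then have "2 * F u v \<le> s * F u u + F v v / s" using s by simp
  then show ?thesis using q[of 1 1] by (simp add: algebra_simps)
qed

text \<open>The abstract setting: \<open>E\<close> is the form a in coefficients and
  \<open>N\<close> the fine part of the discrete operator. \<open>N_E\<close> combines the defining
  identity of A^S with the fact that the lumped product is diagonal in nodal coefficients, so that
  \<open>Pi_f\<close> can be moved to the other argument. The bounds \<open>c\<close> and
  \<open>X\<close> compare energy and lumped product.\<close>

locale split_energy =
  fixes Sig Sigf :: "(real^'n) set" and d :: "real^'n \<Rightarrow> real"
    and E :: "(real^'n \<Rightarrow> real) \<Rightarrow> (real^'n \<Rightarrow> real) \<Rightarrow> real"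
    and N :: "(real^'n \<Rightarrow> real) \<Rightarrow> (real^'n \<Rightarrow> real)"
    and c X :: real
  assumes d_pos: "\<forall>z\<in>Sig. 0 < d z"
    and E_lin: "E (\<lambda>z. s * u z + t * v z) w = s * E u w + t * E v w"
    and E_sym: "E u v = E v u"
    and N_lin: "linear_op N"
    and N_supp: "N u \<in> coeffs Sigf"
    and N_E: "lumped Sig d (N u) v = E u (Pi_f Sigf v)"
    and c_pos: "0 < c" and c_X: "c < X"
    and coercive: "c * lumped Sig d u u \<le> E u u"
    and bounded: "E u u \<le> X * lumped Sig d u u"
begin

abbreviation ip where "ip \<equiv> lumped Sig d"

lemma ip_nonneg: "0 \<le> ip u u" by (rule lumped_nonneg[OF d_pos])

lemma Pi_f_id: "v \<in> coeffs Sigf \<Longrightarrow> Pi_f Sigf v = v"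
  by (auto simp: Pi_f_def coeffs_def)

lemma Pi_f_in: "Pi_f Sigf v \<in> coeffs Sigf"
  by (auto simp: Pi_f_def coeffs_def)

lemma ip_N: "v \<in> coeffs Sigf \<Longrightarrow> ip (N u) v = E u v"
  using N_E[of u v] Pi_f_id by simp

lemma E_N: "E (N u) v = ip (N u) (N v)"
  using ip_N[OF N_supp, of v u] E_sym lumped_commute by metis

lemma E_nonneg: "0 \<le> E u u"
  using coercive[of u] ip_nonneg[of u] c_pos by (meson mult_nonneg_nonneg less_imp_le order_trans)

text \<open>With y = ip (N u) (N u) = E (N u) u, expanding the energy of X u - N u and using E (N u)
  (N u) \<le> X y gives X y \<le> X^2 E u u. This transfers the bound \<open>X\<close> from the
  lumped Rayleigh quotient to the energy form.\<close>

lemma E_N_le: "E (N u) u \<le> X * E u u"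
proof -
  have X: "0 < X" using c_pos c_X by linarith
  define y where "y = ip (N u) (N u)"
  have y: "E (N u) u = y" "E u (N u) = y" using E_N E_sym by (auto simp: y_def)
  have "0 \<le> E (\<lambda>z. X * u z + (-1) * N u z) (\<lambda>z. X * u z + (-1) * N u z)" by (rule E_nonneg)
  also have "\<dots> = X^2 * E u u - 2 * X * y + E (N u) (N u)"
    unfolding E_lin E_sym[of _ "\<lambda>z. X * u z + (-1) * N u z"] using y
    by (simp add: algebra_simps power2_eq_square)
  also have "\<dots> \<le> X^2 * E u u - 2 * X * y + X * y" using bounded[of "N u"] by (simp add: y_def)
  finally have "X * y \<le> X * (X * E u u)" by (simp add: power2_eq_square)
  then show ?thesis unfolding y(1) using X by simp
qed

text \<open>\<open>N\<close> is symmetric for \<open>E\<close> because E (N u) v = ip (N u) (N v).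
  On all coefficients the lower endpoint is only 0, as \<open>N\<close> can have a kernel.\<close>

lemma energy_functional:
  shows "interval_moment_functional 0 X (\<lambda>q. E (poly_op q N u) u)"
    and "E (poly_op q N v) w = E v (poly_op q N w)"
proof -
  have e: "E (N v) w = E v (N w)" for v w using E_N E_sym lumped_commute by metis
  have f: "0 * E w w \<le> E (N w) w" for w using ip_nonneg by (simp add: E_N)
  note S = selfadjoint_moment_functional[where W=UNIV and F=E and lo=0 and hi=X,
      OF N_lin UNIV_I UNIV_I E_lin E_nonneg e E_sym f E_N_le UNIV_I]
  show "interval_moment_functional 0 X (\<lambda>q. E (poly_op q N u) u)"
    by (rule S(1))
  show "E (poly_op q N v) w = E v (poly_op q N w)"
    by (rule S(3)[OF UNIV_I UNIV_I])
qed

text \<open>For fine w the lumped form of N w and w is the energy of w, so coercivity raises the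
  lower endpoint to \<open>c\<close>.\<close>

lemma fine_functional:
  assumes "u \<in> coeffs Sigf"
  shows "interval_moment_functional c X (\<lambda>q. ip (poly_op q N u) u)"
    and "\<And>q v. v \<in> coeffs Sigf \<Longrightarrow> poly_op q N v \<in> coeffs Sigf"
    and "\<And>q v w. v \<in> coeffs Sigf \<Longrightarrow> w \<in> coeffs Sigf \<Longrightarrow> ip (poly_op q N v) w = ip v (poly_op q N w)"
proof -
  have a: "\<And>w. w \<in> coeffs Sigf \<Longrightarrow> N w \<in> coeffs Sigf" using N_supp by blast
  have b: "\<And>s t v w. v \<in> coeffs Sigf \<Longrightarrow> w \<in> coeffs Sigf \<Longrightarrow> (\<lambda>z. s * v z + t * w z) \<in> coeffs Sigf"
    by (auto simp: coeffs_def)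
  have e: "ip (N v) w = ip v (N w)" if "v \<in> coeffs Sigf" "w \<in> coeffs Sigf" for v w
    using ip_N[OF that(1), of w] ip_N[OF that(2), of v] E_sym lumped_commute by metis
  have f: "c * ip w w \<le> ip (N w) w" "ip (N w) w \<le> X * ip w w" if "w \<in> coeffs Sigf" for w
    using ip_N[OF that, of w] coercive bounded by auto
  note S = selfadjoint_moment_functional[where W="coeffs Sigf" and F=ip and lo=c and hi=X,
      OF N_lin a b lumped_lincomb ip_nonneg e lumped_commute f assms]
  show "interval_moment_functional c X (\<lambda>q. ip (poly_op q N u) u)" by (rule S(1))
  show "\<And>q v. v \<in> coeffs Sigf \<Longrightarrow> poly_op q N v \<in> coeffs Sigf" by (rule S(2))
  show "\<And>q v w. v \<in> coeffs Sigf \<Longrightarrow> w \<in> coeffs Sigf \<Longrightarrow> ip (poly_op q N v) w = ip v (poly_op q N w)"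
    by (rule S(3))
qed

lemma stabilized_energy_lower:
  assumes R0: "poly R 0 = 1"
    and R: "\<And>x. c \<le> x \<Longrightarrow> x \<le> X \<Longrightarrow> poly R x \<le> 1 \<and> c \<le> (x + c) * poly R x"
  shows "c / 2 * ip u u \<le> E (poly_op R N u) u"
proof -
  have "poly (1 - R) 0 = 0" using R0 by simp
  then have "[:0, 1:] dvd 1 - R" using poly_eq_0_iff_dvd[of "1 - R" 0] by simp
  \<comment> \<open>Here \<open>Q\<close> is the quotient (1 - R) / x, whereas \<open>Qu\<close>
    below is (1 - R)(N) u. The divided factor N u is already fine, which makes \<open>Qu\<close>
    fine for arbitrary u.\<close>
  then obtain Q where Q: "1 - R = [:0, 1:] * Q" by (rule dvdE)
  define Ru where "Ru = poly_op R N u"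
  define Qu where "Qu = poly_op (1 - R) N u"
  define v where "v = N u"
  have v: "v \<in> coeffs Sigf" unfolding v_def by (rule N_supp)
  have uRQ: "u = (\<lambda>z. 1 * Ru z + 1 * Qu z)"
    using poly_op_lincomb[OF N_lin, of 1 R 1 "1 - R" u] by (simp add: poly_op_1 Ru_def Qu_def)
  have Qu: "Qu = poly_op Q N v"
    unfolding Qu_def Q v_def mult.commute[of _ Q] poly_op_mult[OF N_lin] poly_op_X[OF N_lin] ..
  have Qf: "Qu \<in> coeffs Sigf" unfolding Qu by (rule fine_functional(2)[OF v v])
  have "N Ru = poly_op R N v"
    unfolding Ru_def v_def
    by (simp only: poly_op_X[OF N_lin, symmetric] poly_op_mult[OF N_lin, symmetric] mult.commute)
  then have "E Ru Qu = ip (poly_op R N v) (poly_op Q N v)" using ip_N[OF Qf, of Ru] Qu by simp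
  \<comment> \<open>The cross term is the lumped product of R(N) v and Q(N) v, to be compared with c
    times the square of Q(N) v. It suffices that (R - c Q) Q \<ge> 0 on [c, X]; multiplied by x, the
    first factor becomes (x + c) R - c.\<close>
  moreover have "0 \<le> ip (poly_op ((R + smult (- c) Q) * Q) N v) v"
  proof (rule interval_moment_functional_nonneg[OF fine_functional(1)[OF v] c_X])
    fix x assume x: "c \<le> x" "x \<le> X"
    have x0: "0 < x" using x c_pos by linarith
    have q: "1 - poly R x = x * poly Q x" using arg_cong[OF Q, of "\<lambda>p. poly p x"] by simp
    have "0 \<le> x * poly Q x" using q R[OF x] by linarith
    then have "0 \<le> poly Q x" using x0 by (simp add: zero_le_mult_iff)
    moreover have "x * (poly R x - c * poly Q x) = x * poly R x - c * (x * poly Q x)"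
      by (simp add: algebra_simps)
    then have "x * (poly R x - c * poly Q x) = (x + c) * poly R x - c"
      unfolding q[symmetric] by (simp add: algebra_simps)
    then have "0 \<le> x * (poly R x - c * poly Q x)" using R[OF x] by simp
    then have "0 \<le> poly R x - c * poly Q x" using x0 by (simp add: zero_le_mult_iff)
    ultimately show "0 \<le> poly ((R + smult (- c) Q) * Q) x" by simp
  qed
  moreover have "ip (poly_op ((R + smult (- c) Q) * Q) N v) v
      = ip (poly_op R N v) (poly_op Q N v) - c * ip Qu Qu"
  proof -
    have "poly_op ((R + smult (- c) Q) * Q) N v = poly_op Q N (poly_op (smult 1 R + smult (- c) Q) N v)"
      by (simp only: poly_op_mult[OF N_lin, symmetric] mult.commute smult_1_left)
    then have "ip (poly_op ((R + smult (- c) Q) * Q) N v) v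
        = ip (poly_op (smult 1 R + smult (- c) Q) N v) (poly_op Q N v)"
      using fine_functional(3)[OF v fine_functional(2)[OF v v] v] by simp
    also have "\<dots> = ip (poly_op R N v) (poly_op Q N v) - c * ip Qu Qu"
      unfolding poly_op_lincomb[OF N_lin] lumped_lincomb Qu by simp
    finally show ?thesis .
  qed
  ultimately have "c * ip Qu Qu \<le> E Ru Qu" by linarith
  moreover have "E Ru u = E Ru Ru + E Ru Qu"
    using E_lin[of 1 Ru 1 Qu Ru] uRQ E_sym by (metis mult_1)
  \<comment> \<open>The two parts need not be orthogonal for the lumped product, so Young's
    inequality with weight 1 is used; it is the source of the factor 1/2 in the bound.\<close>
  moreover have "ip u u \<le> 2 * ip Ru Ru + 2 * ip Qu Qu"
    using psd_form_sum_le[of ip 1 Ru Qu, OF lumped_lincomb lumped_commute ip_nonneg] uRQ by simp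
  then have "c * ip u u \<le> c * (2 * ip Ru Ru + 2 * ip Qu Qu)" using c_pos by simp
  ultimately show ?thesis using coercive[of Ru] unfolding Ru_def[symmetric]
    by (simp add: algebra_simps)
qed

lemma stabilized_energy_upper:
  assumes R: "\<And>x. 0 \<le> x \<Longrightarrow> x \<le> X \<Longrightarrow> 0 \<le> poly R x \<and> poly R x \<le> 1 \<and> x * poly R x \<le> M"
    and M: "0 < M" and k: "0 < k"
    and coarse: "\<And>u. (\<And>z. z \<in> Sigf \<Longrightarrow> u z = 0) \<Longrightarrow> E u u \<le> k * ip u u"
  shows "E (poly_op R N u) u \<le> (M + k) * ip u u"
proof -
  have X0: "0 < X" using c_pos c_X by linarith
  define F where "F = (\<lambda>u v. E (poly_op R N u) v)"
  have F_lin: "F (\<lambda>z. s * u z + t * v z) w = s * F u w + t * F v w" for s t u v w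
    unfolding F_def linear_opD[OF poly_op_linear[OF N_lin]] by (rule E_lin)
  have F_sym: "F u v = F v u" for u v unfolding F_def using energy_functional(2) E_sym by metis
  have F_nonneg: "0 \<le> F u u" for u unfolding F_def
    by (rule interval_moment_functional_nonneg[OF energy_functional(1) X0]) (use R in auto)
  define uf where "uf = Pi_f Sigf u"
  define uc where "uc = (\<lambda>z. u z - uf z)"
  have u: "u = (\<lambda>z. uf z + uc z)" by (simp add: uc_def)
  have uf: "uf \<in> coeffs Sigf" unfolding uf_def by (rule Pi_f_in)
  \<comment> \<open>\<open>N\<close> need not preserve coarse functions, so this part uses only R
    \<le> 1, through the energy functional on [0, X].\<close>
  have "F uc uc \<le> E uc uc"
  proof -
    have "0 \<le> E (poly_op (1 - R) N uc) uc"
      by (rule interval_moment_functional_nonneg[OF energy_functional(1) X0]) (use R in auto)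
    moreover have "poly_op (1 - R) N uc = (\<lambda>z. 1 * uc z + (-1) * poly_op R N uc z)"
      using poly_op_lincomb[OF N_lin, of 1 1 "-1" R uc]
      by (simp only: smult_1_left smult_minus_left poly_op_1 diff_conv_add_uminus)
    ultimately show ?thesis using E_lin[of 1 uc "-1" "poly_op R N uc" uc] by (simp add: F_def)
  qed
  also have "\<dots> \<le> k * ip uc uc" by (rule coarse) (simp add: uc_def uf_def Pi_f_def)
  finally have Fc: "F uc uc \<le> k * ip uc uc" .
  \<comment> \<open>Tested with a fine function, the energy of R(N) uf is a lumped product
    containing N R(N) uf, so the bound on x R(x) applies on [c, X].\<close>
  have Ff: "F uf uf \<le> M * ip uf uf"
  proof -
    have "0 \<le> ip (poly_op (smult M 1 + smult (-1) ([:0, 1:] * R)) N uf) uf"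
      by (rule interval_moment_functional_nonneg[OF fine_functional(1)[OF uf] c_X])
        (use R c_pos in auto)
    then have "ip (N (poly_op R N uf)) uf \<le> M * ip uf uf"
      unfolding poly_op_lincomb[OF N_lin] lumped_lincomb poly_op_mult[OF N_lin] poly_op_X[OF N_lin]
      by (simp add: poly_op_1)
    then show ?thesis unfolding ip_N[OF uf] F_def .
  qed
  have ip: "ip u u = ip uf uf + ip uc uc"
    unfolding lumped_def sum.distrib[symmetric]
    by (rule sum.cong) (auto simp: uc_def uf_def Pi_f_def)
  \<comment> \<open>The weight k / M balances the two parts: (1 + k / M) M and (1 + M / k) k both
    equal M + k, and the lumped norms of the parts add up exactly.\<close>
  have "F u u \<le> (1 + k / M) * F uf uf + (1 + 1 / (k / M)) * F uc uc"
    using psd_form_sum_le[of F "k / M" uf uc, OF F_lin F_sym F_nonneg] M k u by simp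
  also have "\<dots> \<le> (1 + k / M) * (M * ip uf uf) + (1 + 1 / (k / M)) * (k * ip uc uc)"
    using Ff Fc M k by (intro add_mono mult_left_mono) auto
  also have "\<dots> = (M + k) * ip u u" unfolding ip using M k by (simp add: field_simps)
  finally show ?thesis by (simp add: F_def)
qed

end

section \<open>Test functions and weak gradients\<close>

text \<open>The polynomial factor makes the class closed under differentiation.\<close>

definition flat_exp :: "real poly \<Rightarrow> real \<Rightarrow> real" where
  "flat_exp q t = (if 0 < t then poly q (inverse t) * exp (- inverse t) else 0)"

lemma poly_times_exp_tendsto_0: "((\<lambda>s. poly q s * exp (- s)) \<longlongrightarrow> (0::real)) at_top"
proof -
  have "((\<lambda>s. \<Sum>i\<le>degree q. coeff q i * (s ^ i / exp s)) \<longlongrightarrow> (\<Sum>i\<le>degree q. coeff q i * 0)) at_top"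
    by (intro tendsto_intros tendsto_power_div_exp_0)
  moreover have "(\<lambda>s. \<Sum>i\<le>degree q. coeff q i * (s ^ i / exp s)) = (\<lambda>s. poly q s * exp (- s))"
    by (simp add: poly_altdef sum_divide_distrib exp_minus field_simps)
  ultimately show ?thesis by simp
qed

text \<open>With s = 1 / t the derivative of q(s) exp(-s) is s^2 (q - q')(s) exp(-s). At 0 the
  difference quotient is the same kind of expression with q replaced by s q, and exponential decay
  sends it to 0.\<close>

lemma flat_exp_deriv:
  "(flat_exp q has_real_derivative flat_exp ([:0, 0, 1:] * (q - pderiv q)) t) (at t)"
proof -
  consider "t < 0" | "t = 0" | "0 < t" by linarith
  then show ?thesis
  proof cases
    case 1
    have "((\<lambda>_. 0) has_real_derivative 0) (at t)" by simp
    then have "(flat_exp q has_real_derivative 0) (at t)"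
      by (rule has_field_derivative_transform_within_open[where S="{..<0}"])
        (use 1 in \<open>auto simp: flat_exp_def\<close>)
    then show ?thesis using 1 by (simp add: flat_exp_def)
  next
    case 3
    have "((\<lambda>t. poly q (inverse t) * exp (- inverse t)) has_real_derivative
        flat_exp ([:0, 0, 1:] * (q - pderiv q)) t) (at t)"
      using 3 by (auto intro!: derivative_eq_intros DERIV_chain2[OF poly_DERIV]
          simp: flat_exp_def field_simps power2_eq_square)
    then show ?thesis
      by (rule has_field_derivative_transform_within_open[where S="{0<..}"])
        (use 3 in \<open>auto simp: flat_exp_def\<close>)
  next
    case 2
    have "((\<lambda>h. poly (pCons 0 q) (inverse h) * exp (- inverse h)) \<longlongrightarrow> 0) (at_right 0)"
      by (rule filterlim_compose[OF poly_times_exp_tendsto_0 filterlim_inverse_at_top_right])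
    then have "((\<lambda>h. flat_exp q h / h) \<longlongrightarrow> 0) (at_right 0)"
      by (rule Lim_transform_eventually)
        (auto simp: flat_exp_def field_simps eventually_at_filter)
    moreover have "((\<lambda>h. flat_exp q h / h) \<longlongrightarrow> 0) (at_left 0)"
      by (rule Lim_transform_eventually[OF tendsto_const])
        (auto simp: flat_exp_def eventually_at_filter)
    ultimately have "((\<lambda>h. flat_exp q h / h) \<longlongrightarrow> 0) (at 0)" by (simp add: filterlim_split_at)
    then show ?thesis using 2 by (simp add: DERIV_def flat_exp_def)
  qed
qed

text \<open>One algebra containing both the polynomials and the bump functions. Its closure under
  partial derivatives yields smoothness, integrability and product rules for all of them at
  once.\<close>

inductive_set flat_algebra :: "(real^'n \<Rightarrow> real) set" where
  const: "(\<lambda>x. r) \<in> flat_algebra"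
| coord: "(\<lambda>x. x $ i) \<in> flat_algebra"
| flat: "(\<lambda>x. flat_exp q (s * x $ i + r)) \<in> flat_algebra"
| add: "f \<in> flat_algebra \<Longrightarrow> g \<in> flat_algebra \<Longrightarrow> (\<lambda>x. f x + g x) \<in> flat_algebra"
| mult: "f \<in> flat_algebra \<Longrightarrow> g \<in> flat_algebra \<Longrightarrow> (\<lambda>x. f x * g x) \<in> flat_algebra"

lemma flat_algebra_sum: "(\<And>i. i \<in> I \<Longrightarrow> f i \<in> flat_algebra) \<Longrightarrow> (\<lambda>x. \<Sum>i\<in>I. f i x) \<in> flat_algebra"
  by (induction I rule: infinite_finite_induct) (auto intro: flat_algebra.intros)

lemma flat_algebra_prod: "(\<And>i. i \<in> I \<Longrightarrow> f i \<in> flat_algebra) \<Longrightarrow> (\<lambda>x. \<Prod>i\<in>I. f i x) \<in> flat_algebra"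
  by (induction I rule: infinite_finite_induct) (auto intro: flat_algebra.intros)

lemma flat_algebra_power: "f \<in> flat_algebra \<Longrightarrow> (\<lambda>x. f x ^ k) \<in> flat_algebra"
  by (induction k) (auto intro: flat_algebra.intros)

lemma gderiv_coord: "GDERIV (\<lambda>x::real^'n. x $ i) x :> axis i 1"
  unfolding gderiv_def inner_axis
  by (auto intro!: derivative_eq_intros bounded_linear_imp_has_derivative bounded_linear_vec_nth)

lemma flat_algebra_gderiv:
  fixes g :: "real^'n \<Rightarrow> real"
  assumes "g \<in> flat_algebra"
  shows "\<exists>G. (\<forall>x. GDERIV g x :> G x) \<and> (\<forall>i. (\<lambda>x. G x $ i) \<in> flat_algebra)"
  using assms
proof induction
  case (const r)
  show ?case by (rule exI[of _ "\<lambda>x. 0"]) (auto intro: GDERIV_const flat_algebra.intros)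
next
  case (coord i)
  show ?case by (rule exI[of _ "\<lambda>x. axis i 1"]) (auto intro: gderiv_coord flat_algebra.intros)
next
  case (flat q s i r)
  define q' where "q' = [:0, 0, 1:] * (q - pderiv q)"
  have aff: "GDERIV (\<lambda>x::real^'n. s * x $ i + r) x :> s *\<^sub>R axis i 1" for x
    using GDERIV_add[OF GDERIV_mult[OF GDERIV_const[of s] gderiv_coord[of i]] GDERIV_const[of r]] by simp
  have "GDERIV (\<lambda>x. flat_exp q (s * x $ i + r)) x :> flat_exp q' (s * x $ i + r) *\<^sub>R (s *\<^sub>R axis i 1)" for x
    unfolding q'_def by (rule GDERIV_DERIV_compose[OF aff flat_exp_deriv])
  moreover have "(\<lambda>x. (flat_exp q' (s * x $ i + r) *\<^sub>R (s *\<^sub>R axis i 1)) $ j) \<in> flat_algebra" for j :: 'n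
    by (auto intro!: flat_algebra.intros)
  ultimately show ?case by (intro exI[of _ "\<lambda>x. flat_exp q' (s * x $ i + r) *\<^sub>R (s *\<^sub>R axis i 1)"]) blast
next
  case (add f g)
  then obtain F G where "\<forall>x. GDERIV f x :> F x" "\<forall>i. (\<lambda>x. F x $ i) \<in> flat_algebra"
    "\<forall>x. GDERIV g x :> G x" "\<forall>i. (\<lambda>x. G x $ i) \<in> flat_algebra" by blast
  then show ?case by (intro exI[of _ "\<lambda>x. F x + G x"]) (auto intro: GDERIV_add flat_algebra.intros)
next
  case (mult f g)
  then obtain F G where "\<forall>x. GDERIV f x :> F x" "\<forall>i. (\<lambda>x. F x $ i) \<in> flat_algebra"
    "\<forall>x. GDERIV g x :> G x" "\<forall>i. (\<lambda>x. G x $ i) \<in> flat_algebra" by blast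
  then show ?case using mult.hyps
    by (intro exI[of _ "\<lambda>x. f x *\<^sub>R G x + g x *\<^sub>R F x"]) (auto intro!: GDERIV_mult flat_algebra.intros)
qed

lemma gderiv_isCont: "GDERIV f x :> D \<Longrightarrow> isCont f x"
  unfolding gderiv_def by (rule has_derivative_continuous)

lemma flat_algebra_continuous: "g \<in> flat_algebra \<Longrightarrow> continuous_on S g"
  using flat_algebra_gderiv gderiv_isCont by (metis continuous_at_imp_continuous_on)

lemma flat_algebra_smooth:
  assumes "g \<in> flat_algebra"
  shows "smooth_fun g"
proof -
  have "g \<in> Ck k" for k using assms
  proof (induction k arbitrary: g)
    case 0
    then show ?case by (simp add: flat_algebra_continuous)
  next
    case (Suc k)
    then show ?case using flat_algebra_gderiv[OF Suc.prems] by auto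
  qed
  then show ?thesis by (simp add: smooth_fun_def)
qed

lemma gderiv_unique:
  assumes "GDERIV f x :> D" "GDERIV f x :> D'"
  shows "D = D'"
proof -
  have "(\<lambda>h. inner h D) = (\<lambda>h. inner h D')"
    using assms unfolding gderiv_def by (rule has_derivative_unique)
  then have "inner (D - D') (D - D') = 0" by (metis inner_diff_right right_minus_eq)
  then show ?thesis by simp
qed

lemma grad_eq: "GDERIV f x :> D \<Longrightarrow> grad f x = D"
  unfolding grad_def by (metis gderiv_unique someI)

lemma gderiv_transform_open:
  assumes "GDERIV f x :> D" "open S" "x \<in> S" "\<And>y. y \<in> S \<Longrightarrow> f y = g y"
  shows "GDERIV g x :> D"
  using assms unfolding gderiv_def by (rule has_derivative_transform_within_open)

lemma gderiv_zero_outside: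
  assumes "\<And>x. GDERIV g x :> G x" "closed C" "\<And>x. x \<notin> C \<Longrightarrow> g x = 0" "x \<notin> C"
  shows "G x = 0"
proof -
  have "GDERIV g x :> 0"
    by (rule gderiv_transform_open[OF GDERIV_const[of 0], of "- C"]) (use assms in auto)
  then show ?thesis using assms(1) gderiv_unique by blast
qed

section \<open>Integration by parts and the fundamental lemma of the calculus of variations\<close>

lemma integrable_compact_support:
  fixes f :: "real^'n \<Rightarrow> real"
  assumes "continuous_on UNIV f" "compact C" "\<And>x. x \<notin> C \<Longrightarrow> f x = 0"
  shows "integrable lborel f"
proof -
  have "integrable lborel (\<lambda>x. indicator C x *\<^sub>R f x)"
    using assms by (intro borel_integrable_compact) (auto intro: continuous_on_subset)
  moreover have "(\<lambda>x. indicator C x *\<^sub>R f x) = f" using assms(3) by (fastforce simp: indicator_def)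
  ultimately show ?thesis by simp
qed

text \<open>Difference quotients integrate to zero by translation invariance.\<close>

lemma integral_partial_derivative_zero:
  fixes g :: "real^'n \<Rightarrow> real"
  assumes G: "\<And>x. GDERIV g x :> G x" and cont: "continuous_on UNIV (\<lambda>x. G x $ i)"
    and supp: "\<And>x. x \<notin> cbox a b \<Longrightarrow> g x = 0"
  shows "(LINT x|lborel. G x $ i) = 0"
proof -
  let ?e = "axis i 1 :: real^'n"
  have g_cont: "continuous_on UNIV g" using G gderiv_isCont by (metis continuous_at_imp_continuous_on)
  have G0: "G x $ i = 0" if "x \<notin> cbox a b" for x
    using gderiv_zero_outside[OF G closed_cbox supp that] by simp
  have gi: "integrable lborel g" by (rule integrable_compact_support[OF g_cont compact_cbox supp])
  have "compact ((\<lambda>x. G x $ i) ` cbox a b)"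
    using cont by (intro compact_continuous_image) (auto intro: continuous_on_subset)
  then obtain K where K: "\<And>x. x \<in> cbox a b \<Longrightarrow> \<bar>G x $ i\<bar> \<le> K" "0 < K"
    using bounded_pos[of "(\<lambda>x. G x $ i) ` cbox a b"] compact_imp_bounded by (auto simp: image_iff)
  then have K': "\<bar>G x $ i\<bar> \<le> K" for x using G0[of x] by (cases "x \<in> cbox a b") auto
  have line: "((\<lambda>t. g (x + t *\<^sub>R ?e)) has_real_derivative G (x + t *\<^sub>R ?e) $ i) (at t)" for x t
  proof -
    have "((\<lambda>t. g (x + t *\<^sub>R ?e)) has_derivative (\<lambda>h. inner (h *\<^sub>R ?e) (G (x + t *\<^sub>R ?e)))) (at t)"
      by (rule has_derivative_compose[where f="\<lambda>t. x + t *\<^sub>R ?e" and g=g])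
        (use G[of "x + t *\<^sub>R ?e"] in \<open>auto simp: gderiv_def intro!: derivative_eq_intros\<close>)
    then show ?thesis unfolding has_field_derivative_def
      by (simp add: inner_axis' mult_commute_abs)
  qed
  define D where "D = (\<lambda>n x. real (Suc n) * (g (x + (1 / real (Suc n)) *\<^sub>R ?e) - g x))"
  have D0: "integral\<^sup>L lborel (D n) = 0" for n
  proof -
    define c where "c = (1 / real (Suc n)) *\<^sub>R ?e"
    have d: "distr lborel borel ((+) c) = lborel" by (rule lborel_distr_plus)
    have gm: "g \<in> borel_measurable borel" using g_cont by (rule borel_measurable_continuous_onI)
    have "integral\<^sup>L lborel g = (\<integral>x. g (c + x) \<partial>lborel)"
      using integral_distr[of "(+) c" lborel borel g] gm by (simp add: d)
    moreover have "integrable lborel (\<lambda>x. g (c + x))"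
      using integrable_distr_eq[of "(+) c" lborel borel g] gi gm by (simp add: d)
    ultimately show ?thesis unfolding D_def c_def[symmetric] using gi by (simp add: add.commute)
  qed
  \<comment> \<open>The shifts have length at most 1, so all quotients vanish outside the box
    enlarged by 1; on it the mean value theorem bounds them by \<open>K\<close>.\<close>
  have "(\<lambda>n. integral\<^sup>L lborel (D n)) \<longlonglongrightarrow> (LINT x|lborel. G x $ i)"
  proof (rule integral_dominated_convergence[where w="\<lambda>x. indicator (cbox (a - 1) (b + 1)) x *\<^sub>R K"])
    show "(\<lambda>x. G x $ i) \<in> borel_measurable lborel"
      using cont by (simp add: borel_measurable_continuous_onI)
    show "D n \<in> borel_measurable lborel" for n
    proof -
      have "continuous_on UNIV (D n)" unfolding D_def
        by (intro continuous_intros continuous_on_compose2[OF g_cont]) auto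
      then show ?thesis by (simp add: borel_measurable_continuous_onI)
    qed
    show "integrable lborel (\<lambda>x. indicator (cbox (a - 1) (b + 1)) x *\<^sub>R K)"
      by (intro borel_integrable_compact) auto
    show "AE x in lborel. (\<lambda>n. D n x) \<longlonglongrightarrow> G x $ i"
    proof (rule AE_I2)
      fix x
      have "((\<lambda>h. (g (x + h *\<^sub>R ?e) - g x) / h) \<longlongrightarrow> G x $ i) (at 0)"
        using line[of x 0] by (simp add: DERIV_def)
      moreover have "filterlim (\<lambda>n. 1 / real (Suc n)) (at 0) sequentially"
        unfolding filterlim_at using LIMSEQ_Suc[OF lim_1_over_n] by auto
      ultimately have "(\<lambda>n. (g (x + (1 / real (Suc n)) *\<^sub>R ?e) - g x) / (1 / real (Suc n))) \<longlonglongrightarrow> G x $ i"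
        by (rule filterlim_compose)
      then show "(\<lambda>n. D n x) \<longlonglongrightarrow> G x $ i" unfolding D_def by (simp add: mult.commute)
    qed
    show "AE x in lborel. norm (D n x) \<le> indicator (cbox (a - 1) (b + 1)) x *\<^sub>R K" for n
    proof (rule AE_I2)
      fix x
      let ?h = "1 / real (Suc n)"
      have h: "0 < ?h" "?h \<le> 1" by (auto simp: field_simps)
      show "norm (D n x) \<le> indicator (cbox (a - 1) (b + 1)) x *\<^sub>R K"
      proof (cases "x \<in> cbox (a - 1) (b + 1)")
        case True
        have "\<exists>z>0. z < ?h \<and> g (x + ?h *\<^sub>R ?e) - g (x + 0 *\<^sub>R ?e) = (?h - 0) * G (x + z *\<^sub>R ?e) $ i"
          using h line by (intro MVT2) auto
        then obtain z where z: "g (x + ?h *\<^sub>R ?e) - g x = ?h * G (x + z *\<^sub>R ?e) $ i" by auto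
        have "D n x = G (x + z *\<^sub>R ?e) $ i" unfolding D_def z by simp
        then show ?thesis using True K' by simp
      next
        case False
        have "x \<notin> cbox a b" "x + ?h *\<^sub>R ?e \<notin> cbox a b"
        proof -
          obtain j where "x $ j < a $ j - 1 \<or> b $ j + 1 < x $ j"
            using False by (auto simp: mem_box_cart not_le)
          moreover have "0 \<le> (?h *\<^sub>R ?e) $ j" "(?h *\<^sub>R ?e) $ j \<le> 1" using h by (auto simp: axis_def)
          ultimately show "x \<notin> cbox a b" "x + ?h *\<^sub>R ?e \<notin> cbox a b"
            unfolding mem_box_cart vector_add_component by (smt (verit, best))+
        qed
        then show ?thesis using False supp by (simp add: D_def)
      qed
    qed
  qed
  then show ?thesis unfolding D0 using LIMSEQ_unique tendsto_const by blast
qed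

text \<open>The parameter k stretches the distance to the faces. Since exp (-1/t) tends to 1 for
  large t, the bumps with k = n + 1 tend pointwise to the indicator of the open box while staying in
  [0, 1]; this replaces mollification.\<close>

definition box_bump :: "real^'n \<Rightarrow> real^'n \<Rightarrow> real \<Rightarrow> real^'n \<Rightarrow> real" where
  "box_bump a b k x = (\<Prod>i\<in>UNIV. flat_exp 1 (k * x $ i + (- k * a $ i)) * flat_exp 1 (- k * x $ i + k * b $ i))"

lemma box_bump_in: "box_bump a b k \<in> flat_algebra"
  unfolding box_bump_def[abs_def] by (intro flat_algebra_prod flat_algebra.mult flat_algebra.flat)

lemma flat_exp_1_bounds: "0 \<le> flat_exp 1 t" "flat_exp 1 t \<le> 1"
  by (auto simp: flat_exp_def)

lemma box_bump_bounds: "0 \<le> box_bump a b k x" "box_bump a b k x \<le> 1"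
  unfolding box_bump_def
  by (intro prod_nonneg prod_le_1 conjI ballI mult_nonneg_nonneg mult_le_one flat_exp_1_bounds)+

lemma box_bump_outside:
  assumes "0 < k" "x \<notin> box a b"
  shows "box_bump a b k x = 0"
proof -
  obtain i where i: "x $ i \<le> a $ i \<or> b $ i \<le> x $ i" using assms(2) by (auto simp: mem_box_cart not_less)
  have "flat_exp 1 (k * x $ i + (- k * a $ i)) * flat_exp 1 (- k * x $ i + k * b $ i) = 0"
    using i assms(1) by (auto simp: flat_exp_def)
  then show ?thesis unfolding box_bump_def by (intro prod_zero) auto
qed

lemma flat_exp_1_tendsto: "0 < t \<Longrightarrow> (\<lambda>n. flat_exp 1 (real (Suc n) * t)) \<longlonglongrightarrow> 1"
proof -
  assume t: "0 < t"
  have "(\<lambda>n. exp (- (inverse (real (Suc n)) * inverse t))) \<longlonglongrightarrow> exp (- (0 * inverse t))"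
    by (intro tendsto_intros LIMSEQ_inverse_real_of_nat)
  then show ?thesis using t by (simp add: flat_exp_def)
qed

lemma box_bump_tendsto: "(\<lambda>n. box_bump a b (real (Suc n)) x) \<longlonglongrightarrow> indicator (box a b) x"
proof (cases "x \<in> box a b")
  case True
  have "(\<lambda>n. box_bump a b (real (Suc n)) x) \<longlonglongrightarrow> (\<Prod>i\<in>(UNIV::'a set). 1 * 1)"
    unfolding box_bump_def
  proof (intro tendsto_intros)
    fix i
    have "0 < x $ i - a $ i" "0 < b $ i - x $ i" using True by (auto simp: mem_box_cart)
    from flat_exp_1_tendsto[OF this(1)] flat_exp_1_tendsto[OF this(2)]
    show "(\<lambda>n. flat_exp 1 (real (Suc n) * x $ i + - real (Suc n) * a $ i)) \<longlonglongrightarrow> 1"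
      "(\<lambda>n. flat_exp 1 (- real (Suc n) * x $ i + real (Suc n) * b $ i)) \<longlonglongrightarrow> 1"
      by (simp_all add: algebra_simps)
  qed
  then show ?thesis using True by simp
next
  case False
  then show ?thesis using box_bump_outside[of _ x a b] by simp
qed

lemma box_bump_test_fun:
  assumes "0 < k" "cbox a b \<subseteq> Om"
  shows "test_fun Om (box_bump a b k)"
proof -
  have "{x. box_bump a b k x \<noteq> 0} \<subseteq> cbox a b"
    using box_bump_outside[OF assms(1)] box_subset_cbox by blast
  then have c: "closure {x. box_bump a b k x \<noteq> 0} \<subseteq> cbox a b" by (rule closure_minimal) (rule closed_cbox)
  then have "compact (closure {x. box_bump a b k x \<noteq> 0})"
    by (meson bounded_cbox bounded_subset closed_closure compact_eq_bounded_closed)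
  then show ?thesis using c assms flat_algebra_smooth[OF box_bump_in] by (auto simp: test_fun_def)
qed

text \<open>Open boxes form an intersection-stable generator of the Borel sets, so the vanishing
  integrals extend by Dynkin's argument, with \<open>total\<close> covering complements. Lebesgue
  sets differ from Borel sets by null sets only.\<close>

lemma AE_zero_if_box_integrals_zero:
  fixes f :: "real^'n \<Rightarrow> real"
  assumes f: "integrable lebesgue f" and box: "\<And>a b. (LINT x:box a b|lebesgue. f x) = 0"
    and total: "(LINT x|lebesgue. f x) = 0"
  shows "AE x in lebesgue. f x = 0"
proof -
  have si: "set_integrable lebesgue A f" if "A \<in> sets lebesgue" for A
    unfolding set_integrable_def using integrable_mult_indicator[OF that f] .
  have borel: "(LINT x:A|lebesgue. f x) = 0" if "A \<in> sets borel" for A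
  proof -
    let ?G = "range (\<lambda>(a, b). box a b :: (real^'n) set)"
    have "A \<in> sigma_sets UNIV ?G" using that by (simp add: borel_eq_box)
    have sig: "sigma_sets UNIV ?G \<subseteq> sets lebesgue"
    proof
      fix B assume "B \<in> sigma_sets UNIV ?G"
      then have "B \<in> sets borel" by (simp add: borel_eq_box)
      then show "B \<in> sets lebesgue" by simp
    qed
    have "Int_stable ?G"
    proof (rule Int_stableI)
      fix B B' :: "(real^'n) set" assume "B \<in> ?G" "B' \<in> ?G"
      then obtain a b a' b' where "B = box a b" "B' = box a' b'" by auto
      then obtain s t where "B \<inter> B' = box s t" using box_Int_box[of a b a' b'] by blast
      then have "B \<inter> B' = (\<lambda>(a, b). box a b) (s, t)" by simp
      then show "B \<inter> B' \<in> ?G" by (rule range_eqI)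
    qed
    note ind = sigma_sets_induct_disjoint[OF this, of UNIV, simplified, consumes 1, case_names basic empty compl union]
    show ?thesis using \<open>A \<in> sigma_sets UNIV ?G\<close>
    proof (induction A rule: ind)
      case (basic A)
      then show ?case using box by auto
    next
      case empty
      then show ?case by (simp add: set_lebesgue_integral_def)
    next
      case (compl A)
      have A: "A \<in> sets lebesgue" using sig compl by blast
      have "(LINT x:A \<union> (UNIV - A)|lebesgue. f x) = (LINT x:A|lebesgue. f x) + (LINT x:UNIV - A|lebesgue. f x)"
        by (rule set_integral_Un) (use A in \<open>auto intro!: si\<close>)
      then show ?case using compl total by (simp add: set_lebesgue_integral_def)
    next
      case (union A)
      have A: "A i \<in> sets lebesgue" for i
        using sig union(2) by blast
      have "(LINT x:(\<Union>i. A i)|lebesgue. f x) = (\<Sum>i. (LINT x:A i|lebesgue. f x))"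
        by (rule lebesgue_integral_countable_add)
          (use A union(1) in \<open>auto simp: disjoint_family_on_def intro!: si sets.countable_UN\<close>)
      then show ?case using union by simp
    qed
  qed
  have "AE x in lebesgue. f x = (\<lambda>_. 0) x"
  proof (rule density_unique_real)
    fix A assume "A \<in> sets (lebesgue :: (real^'n) measure)"
    then obtain S N N' where A: "A = S \<union> N" "N \<subseteq> N'" "N' \<in> null_sets lborel" "S \<in> sets lborel"
      by (rule sets_completionE)
    have "(LINT x:A|lebesgue. f x) = (LINT x:S|lebesgue. f x)"
    proof (rule set_integral_cong_set)
      have N': "AE x in lebesgue. x \<notin> N'"
        by (rule AE_not_in) (use A(3) in \<open>simp add: null_sets_completionI\<close>)
      show "AE x in lebesgue. (x \<in> S) = (x \<in> A)" using N' by eventually_elim (use A in auto)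
      have mf: "f \<in> borel_measurable lebesgue" using f by simp
      show "set_borel_measurable lebesgue A f" "set_borel_measurable lebesgue S f"
        unfolding set_borel_measurable_def using \<open>A \<in> sets lebesgue\<close> A(4)
        by (intro borel_measurable_scaleR borel_measurable_indicator mf; simp)+
    qed
    then show "(LINT x:A|lebesgue. f x) = (LINT x:A|lebesgue. (\<lambda>_. 0) x)" using borel[of S] A(4) by simp
  qed (use f in auto)
  then show ?thesis by simp
qed

text \<open>Integrability is given only on closed boxes inside U, so f is cut off to one box at a
  time. Dominated convergence replaces the bumps by the indicator of the open box. Countably many
  closed boxes cover U, and their frontiers are negligible.\<close>

lemma fundamental_lemma_box_bumps:
  fixes f :: "real^'n \<Rightarrow> real"
  assumes U: "open U"
    and int: "\<And>a b. cbox a b \<subseteq> U \<Longrightarrow> set_integrable lebesgue (cbox a b) f"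
    and zero: "\<And>a b n. cbox a b \<subseteq> U \<Longrightarrow> (LINT x|lebesgue. f x * box_bump a b (real (Suc n)) x) = 0"
  shows "AE x in lebesgue. x \<in> U \<longrightarrow> f x = 0"
proof -
  have box0: "(LINT x:box a b|lebesgue. f x) = 0" if ab: "cbox a b \<subseteq> U" for a b
  proof -
    have f: "integrable lebesgue (\<lambda>x. indicator (cbox a b) x *\<^sub>R f x)"
      using int[OF ab] by (simp add: set_integrable_def)
    have eq: "f x * box_bump a b (real (Suc n)) x
        = indicator (cbox a b) x *\<^sub>R f x * box_bump a b (real (Suc n)) x" for x n
      using box_bump_outside[of "real (Suc n)" x a b] box_subset_cbox[of a b]
      by (cases "x \<in> cbox a b") auto
    have "(\<lambda>n. LINT x|lebesgue. f x * box_bump a b (real (Suc n)) x)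
        \<longlonglongrightarrow> (LINT x|lebesgue. indicator (cbox a b) x *\<^sub>R f x * indicator (box a b) x)"
      unfolding eq
    proof (rule integral_dominated_convergence[where w="\<lambda>x. norm (indicator (cbox a b) x *\<^sub>R f x)"])
      have bm: "box_bump a b k \<in> borel_measurable lebesgue" for k
        by (rule measurable_completion)
          (simp add: borel_measurable_continuous_onI flat_algebra_continuous[OF box_bump_in])
      show "(\<lambda>x. indicator (cbox a b) x *\<^sub>R f x * box_bump a b (real (Suc n)) x) \<in> borel_measurable lebesgue" for n
        using f bm by (intro borel_measurable_times) auto
      show "(\<lambda>x. indicator (cbox a b) x *\<^sub>R f x * indicator (box a b) x) \<in> borel_measurable lebesgue"
        using f by (intro borel_measurable_times) (auto intro!: borel_measurable_indicator)
      show "integrable lebesgue (\<lambda>x. norm (indicator (cbox a b) x *\<^sub>R f x))" using f by (rule integrable_norm)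
      show "AE x in lebesgue. (\<lambda>n. indicator (cbox a b) x *\<^sub>R f x * box_bump a b (real (Suc n)) x)
          \<longlonglongrightarrow> indicator (cbox a b) x *\<^sub>R f x * indicator (box a b) x"
        by (intro AE_I2 tendsto_intros box_bump_tendsto)
      show "AE x in lebesgue. norm (indicator (cbox a b) x *\<^sub>R f x * box_bump a b (real (Suc n)) x)
          \<le> norm (indicator (cbox a b) x *\<^sub>R f x)" for n
        using box_bump_bounds[of a b "real (Suc n)"]
        by (intro AE_I2) (auto simp: abs_mult intro!: mult_left_le)
    qed
    then have "(LINT x|lebesgue. indicator (cbox a b) x *\<^sub>R f x * indicator (box a b) x) = 0"
      unfolding zero[OF ab] using LIMSEQ_unique tendsto_const by blast
    moreover have "indicator (cbox a b) x *\<^sub>R f x * indicator (box a b) x = indicator (box a b) x *\<^sub>R f x" for x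
      using box_subset_cbox[of a b] by (auto simp: indicator_def)
    ultimately show ?thesis unfolding set_lebesgue_integral_def by (simp only:)
  qed
  have loc: "AE x in lebesgue. x \<in> box a b \<longrightarrow> f x = 0" if ab: "cbox a b \<subseteq> U" for a b
  proof -
    let ?f = "\<lambda>x. indicator (box a b) x *\<^sub>R f x"
    have "set_integrable lebesgue (box a b) f"
      by (rule set_integrable_subset[OF int[OF ab]]) (auto simp: box_subset_cbox)
    then have fi: "integrable lebesgue ?f" by (simp add: set_integrable_def)
    have "AE x in lebesgue. ?f x = 0"
    proof (rule AE_zero_if_box_integrals_zero[OF fi])
      show "(LINT x|lebesgue. ?f x) = 0" using box0[OF ab] by (simp add: set_lebesgue_integral_def)
      fix c e
      have "box c e \<inter> box a b = box (\<Sum>i\<in>Basis. max (c \<bullet> i) (a \<bullet> i) *\<^sub>R i) (\<Sum>i\<in>Basis. min (e \<bullet> i) (b \<bullet> i) *\<^sub>R i)"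
        by (rule box_Int_box)
      then obtain a' b' where ab': "box c e \<inter> box a b = box a' b'" by blast
      have "(LINT x:box c e|lebesgue. ?f x) = (LINT x:box a' b'|lebesgue. f x)"
        unfolding ab'[symmetric] set_lebesgue_integral_def by (simp add: indicator_inter_arith mult.assoc)
      also have "\<dots> = 0"
      \<comment> \<open>An empty open box can still have a nonempty degenerate \<open>cbox\<close>,
        which might leave U; only a nonempty box has that \<open>cbox\<close> as its
        closure.\<close>
      proof (cases "box a' b' = {}")
        case False
        have "closure (box a' b') \<subseteq> closure (box a b)" using ab' by (intro closure_mono) blast
        moreover have "closure (box a b) \<subseteq> cbox a b" by (rule closure_minimal[OF box_subset_cbox closed_cbox])
        ultimately have "cbox a' b' \<subseteq> cbox a b" using closure_box[OF False] by blast
        then show ?thesis using box0 ab by blast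
      qed (simp add: set_lebesgue_integral_def)
      finally show "(LINT x:box c e|lebesgue. ?f x) = 0" .
    qed
    then show ?thesis by eventually_elim auto
  qed
  obtain C where C: "countable C" "C \<subseteq> Pow U" "\<And>Y. Y \<in> C \<Longrightarrow> \<exists>a b. Y = cbox a b" "\<Union>C = U"
    using open_countable_Union_open_cbox[OF U] by metis
  have "AE x in lebesgue. \<forall>Y\<in>C. x \<in> interior Y \<longrightarrow> f x = 0"
  proof (subst AE_ball_countable[OF C(1)], rule ballI)
    fix Y assume "Y \<in> C"
    then obtain a b where Y: "Y = cbox a b" "Y \<subseteq> U" using C(2,3) by blast
    then show "AE x in lebesgue. x \<in> interior Y \<longrightarrow> f x = 0"
      using loc[of a b] unfolding Y(1) interior_cbox by blast
  qed
  moreover have "AE x in lebesgue. \<forall>Y\<in>C. x \<notin> frontier Y"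
  proof (subst AE_ball_countable[OF C(1)], rule ballI)
    fix Y assume "Y \<in> C"
    then obtain a b where "Y = cbox a b" using C(3) by blast
    then have "negligible (frontier Y)" using negligible_convex_frontier[of Y] convex_box(1)[of a b] by blast
    then show "AE x in lebesgue. x \<notin> frontier Y"
      by (simp add: AE_not_in negligible_iff_null_sets)
  qed
  ultimately show ?thesis
  proof eventually_elim
    case (elim x)
    show ?case
    proof
      assume "x \<in> U"
      then obtain Y where Y: "Y \<in> C" "x \<in> Y" using C(4) by blast
      then have "x \<in> interior Y" using elim(2) by (auto simp: frontier_def closure_def)
      then show "f x = 0" using elim(1) Y by blast
    qed
  qed
qed

lemma in_L2_set_integrable:
  fixes f :: "real^'n \<Rightarrow> real"
  assumes "in_L2 A f" "B \<subseteq> A" "B \<in> lmeasurable"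
  shows "set_integrable lebesgue B f"
proof -
  have m: "set_borel_measurable lebesgue A f" and i: "set_integrable lebesgue A (\<lambda>x. (f x)^2)"
    using assms(1) by (auto simp: in_L2_def)
  have B: "B \<in> sets lebesgue" using assms(3) by auto
  have "set_integrable lebesgue B (\<lambda>x. (f x)^2)" by (rule set_integrable_subset[OF i B assms(2)])
  moreover have "set_integrable lebesgue B (\<lambda>x. 1::real)"
    using assms(3) by (simp add: set_integrable_def lmeasurable_iff_integrable)
  ultimately have "set_integrable lebesgue B (\<lambda>x. 1 + (f x)^2)" by (intro set_integral_add)
  moreover have "set_borel_measurable lebesgue B f"
    using m B assms(2) unfolding set_borel_measurable_def
  proof -
    assume a: "(\<lambda>x. indicat_real A x *\<^sub>R f x) \<in> borel_measurable lebesgue" and B: "B \<in> sets lebesgue"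
    have "(\<lambda>x. indicat_real B x *\<^sub>R (indicat_real A x *\<^sub>R f x)) \<in> borel_measurable lebesgue"
      by (intro borel_measurable_scaleR borel_measurable_indicator B a)
    moreover have "(\<lambda>x. indicat_real B x *\<^sub>R (indicat_real A x *\<^sub>R f x)) = (\<lambda>x. indicat_real B x *\<^sub>R f x)"
      using assms(2) by (auto simp: indicator_def fun_eq_iff)
    ultimately show "(\<lambda>x. indicat_real B x *\<^sub>R f x) \<in> borel_measurable lebesgue" by simp
  qed
  moreover have "\<bar>y\<bar> \<le> 1 + y^2" for y :: real
  proof -
    have "0 \<le> (\<bar>y\<bar> - 1/2)^2" by simp
    then show ?thesis by (simp add: power2_diff power_divide)
  qed
  ultimately show ?thesis
    by (intro set_integrable_bound[of lebesgue B "\<lambda>x. 1 + (f x)^2" f]) (auto intro!: AE_I2)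
qed

text \<open>The weak gradient inside \<open>H1_norm\<close> is a \<open>SOME\<close> term, about
  which only the defining property is known. Testing with bumps supported in U and integrating q
  times the bump by parts shows that it can differ from the classical gradient only on a null
  set.\<close>

lemma weak_grad_eq_classical:
  fixes u :: "real^'n \<Rightarrow> real"
  assumes wg: "weak_grad Om u G" and U: "open U" "U \<subseteq> Om"
    and q: "q \<in> flat_algebra" and Gq: "\<And>x. GDERIV q x :> Gq x" and eq: "\<And>x. x \<in> U \<Longrightarrow> u x = q x"
  shows "AE x in lebesgue. x \<in> U \<longrightarrow> G x = Gq x"
proof -
  have Gq_in: "(\<lambda>x. Gq x $ i) \<in> flat_algebra" for i
  proof -
    obtain Gq' where "\<forall>x. GDERIV q x :> Gq' x" "\<forall>i. (\<lambda>x. Gq' x $ i) \<in> flat_algebra"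
      using flat_algebra_gderiv[OF q] by blast
    moreover from this have "Gq' = Gq" using Gq gderiv_unique by blast
    ultimately show ?thesis by blast
  qed
  have "AE x in lebesgue. x \<in> U \<longrightarrow> G x $ i - Gq x $ i = 0" for i
  proof (rule fundamental_lemma_box_bumps[OF U(1)])
    fix a b assume ab: "cbox a b \<subseteq> U"
    have Gint: "set_integrable lebesgue (cbox a b) (\<lambda>x. G x $ i)"
      by (rule in_L2_set_integrable[of Om]) (use wg ab U(2) in \<open>auto simp: weak_grad_def\<close>)
    moreover have "set_integrable lebesgue (cbox a b) (\<lambda>x. Gq x $ i)"
      by (rule absolutely_integrable_continuous) (rule flat_algebra_continuous[OF Gq_in])
    ultimately show "set_integrable lebesgue (cbox a b) (\<lambda>x. G x $ i - Gq x $ i)"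
      by (rule set_integral_diff)
    fix n
    define \<phi> where "\<phi> = box_bump a b (real (Suc n))"
    have \<phi>_in: "\<phi> \<in> flat_algebra" unfolding \<phi>_def by (rule box_bump_in)
    have \<phi>0: "\<phi> x = 0" if "x \<notin> cbox a b" for x
      unfolding \<phi>_def by (rule box_bump_outside) (use that box_subset_cbox in auto)
    have tf: "test_fun Om \<phi>" unfolding \<phi>_def by (rule box_bump_test_fun) (use ab U(2) in auto)
    obtain \<Phi> where \<Phi>: "\<And>x. GDERIV \<phi> x :> \<Phi> x" "\<And>i. (\<lambda>x. \<Phi> x $ i) \<in> flat_algebra"
      using flat_algebra_gderiv[OF \<phi>_in] by blast
    have \<Phi>0: "\<Phi> x = 0" if "x \<notin> cbox a b" for x
      by (rule gderiv_zero_outside[OF \<Phi>(1) closed_cbox \<phi>0 that])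
    have "GDERIV (\<lambda>x. q x * \<phi> x) x :> q x *\<^sub>R \<Phi> x + \<phi> x *\<^sub>R Gq x" for x
      by (rule GDERIV_mult[OF Gq \<Phi>(1)])
    then have "(LINT x|lborel. (q x *\<^sub>R \<Phi> x + \<phi> x *\<^sub>R Gq x) $ i) = 0"
    proof (rule integral_partial_derivative_zero)
      show "continuous_on UNIV (\<lambda>x. (q x *\<^sub>R \<Phi> x + \<phi> x *\<^sub>R Gq x) $ i)"
        using q \<Phi>(2) \<phi>_in Gq_in
        by (auto intro!: flat_algebra_continuous flat_algebra.add flat_algebra.mult)
      show "q x * \<phi> x = 0" if "x \<notin> cbox a b" for x using \<phi>0[OF that] by simp
    qed
    moreover have i1: "integrable lborel (\<lambda>x. q x * \<Phi> x $ i)"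
      by (rule integrable_compact_support[OF flat_algebra_continuous[OF flat_algebra.mult[OF q \<Phi>(2)]] compact_cbox[of a b]])
        (simp add: \<Phi>0)
    moreover have i2: "integrable lborel (\<lambda>x. Gq x $ i * \<phi> x)"
      by (rule integrable_compact_support[OF flat_algebra_continuous[OF flat_algebra.mult[OF Gq_in \<phi>_in]] compact_cbox[of a b]])
        (simp add: \<phi>0)
    ultimately have parts: "(LINT x|lborel. q x * \<Phi> x $ i) = - (LINT x|lborel. Gq x $ i * \<phi> x)"
      by (simp add: mult.commute)
    have lb: "(LINT x|lebesgue. f x) = (LINT x|lborel. f x)" if "integrable lborel f" for f :: "real^'n \<Rightarrow> real"
      using that by (intro integral_completion) auto
    have "(LINT x:Om|lebesgue. u x * (grad \<phi> x $ i)) = (LINT x|lebesgue. q x * \<Phi> x $ i)"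
      unfolding set_lebesgue_integral_def
    proof (rule Bochner_Integration.integral_cong[OF refl])
      fix x
      show "indicator Om x *\<^sub>R (u x * (grad \<phi> x $ i)) = q x * \<Phi> x $ i"
        using \<Phi>0[of x] subsetD[OF ab, of x] subsetD[OF U(2), of x] eq[of x] grad_eq[OF \<Phi>(1)[of x]]
        by (cases "x \<in> cbox a b") auto
    qed
    moreover have "(LINT x:Om|lebesgue. G x $ i * \<phi> x) = (LINT x|lebesgue. G x $ i * \<phi> x)"
      unfolding set_lebesgue_integral_def
    proof (rule Bochner_Integration.integral_cong[OF refl])
      fix x
      show "indicator Om x *\<^sub>R (G x $ i * \<phi> x) = G x $ i * \<phi> x"
        using \<phi>0[of x] subsetD[OF ab, of x] subsetD[OF U(2), of x] by (cases "x \<in> cbox a b") auto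
    qed
    moreover have "(LINT x:Om|lebesgue. u x * (grad \<phi> x $ i)) = - (LINT x:Om|lebesgue. G x $ i * \<phi> x)"
      using wg tf by (auto simp: weak_grad_def)
    ultimately have eqn: "(LINT x|lebesgue. G x $ i * \<phi> x) = (LINT x|lebesgue. Gq x $ i * \<phi> x)"
      using parts lb[OF i1] lb[OF i2] by simp
    have "integrable lebesgue (\<lambda>x. G x $ i * \<phi> x)"
    proof (rule Bochner_Integration.integrable_bound)
      show gi: "integrable lebesgue (\<lambda>x. indicator (cbox a b) x *\<^sub>R (G x $ i))"
        using Gint by (simp add: set_integrable_def)
      have "\<phi> \<in> borel_measurable lebesgue"
        by (rule measurable_completion)
          (simp add: borel_measurable_continuous_onI flat_algebra_continuous[OF \<phi>_in])
      then have "(\<lambda>x. (indicator (cbox a b) x *\<^sub>R (G x $ i)) * \<phi> x) \<in> borel_measurable lebesgue"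
        using gi by (intro borel_measurable_times) auto
      moreover have "(\<lambda>x. (indicator (cbox a b) x *\<^sub>R (G x $ i)) * \<phi> x) = (\<lambda>x. G x $ i * \<phi> x)"
      proof
        fix x show "(indicator (cbox a b) x *\<^sub>R (G x $ i)) * \<phi> x = G x $ i * \<phi> x"
          using \<phi>0[of x] by (cases "x \<in> cbox a b") auto
      qed
      ultimately show "(\<lambda>x. G x $ i * \<phi> x) \<in> borel_measurable lebesgue" by simp
      show "AE x in lebesgue. norm (G x $ i * \<phi> x) \<le> norm (indicator (cbox a b) x *\<^sub>R (G x $ i))"
      proof (rule AE_I2)
        fix x
        have "\<bar>\<phi> x\<bar> \<le> 1" using box_bump_bounds[of a b "real (Suc n)" x] by (simp add: \<phi>_def)
        then show "norm (G x $ i * \<phi> x) \<le> norm (indicator (cbox a b) x *\<^sub>R (G x $ i))"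
          using \<phi>0[of x] by (cases "x \<in> cbox a b") (auto simp: abs_mult intro!: mult_left_le)
      qed
    qed
    moreover have "integrable lebesgue (\<lambda>x. Gq x $ i * \<phi> x)"
      using i2 by (simp add: integrable_completion)
    ultimately have "(LINT x|lebesgue. G x $ i * \<phi> x - Gq x $ i * \<phi> x) = 0" using eqn by simp
    then show "(LINT x|lebesgue. (G x $ i - Gq x $ i) * box_bump a b (real (Suc n)) x) = 0"
      unfolding \<phi>_def[symmetric] by (simp add: left_diff_distrib)
  qed
  then have "AE x in lebesgue. \<forall>i. x \<in> U \<longrightarrow> G x $ i - Gq x $ i = 0"
    by (subst AE_all_countable) blast
  then show ?thesis by eventually_elim (auto simp: vec_eq_iff)
qed

section \<open>Simplicial meshes\<close>

text \<open>The mesh covers only the closure of \<open>Om\<close>, and for a slit domain a simplex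
  could cross the slit. A Lipschitz boundary excludes this: a small move from a frontier point in
  direction e reaches an open set above the graph that misses \<open>Om\<close>.\<close>

lemma lipschitz_domain_interior_closure:
  fixes Om :: "(real^'n) set"
  assumes "lipschitz_domain Om"
  shows "interior (closure Om) \<subseteq> Om"
proof
  fix x assume x: "x \<in> interior (closure Om)"
  show "x \<in> Om"
  proof (rule ccontr)
    assume nx: "x \<notin> Om"
    have opn: "open Om" using assms by (simp add: lipschitz_domain_def)
    have "x \<in> frontier Om" using x nx interior_subset opn by (auto simp: frontier_def interior_open)
    then obtain e :: "real^'n" and r L and g :: "real^'n \<Rightarrow> real" where e: "norm e = 1" and r: "0 < r"
      and g: "\<And>y z. \<bar>g y - g z\<bar> \<le> L * dist y z"
      and iff: "\<And>y. y \<in> ball x r \<Longrightarrow> y \<in> Om \<longleftrightarrow> y \<bullet> e < g (y - (y \<bullet> e) *\<^sub>R e)"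
      using assms unfolding lipschitz_domain_def by meson
    have ee: "e \<bullet> e = 1" using e by (simp add: norm_eq_1)
    have xg: "g (x - (x \<bullet> e) *\<^sub>R e) \<le> x \<bullet> e" using iff[of x] nx r by auto
    obtain \<epsilon> where \<epsilon>: "0 < \<epsilon>" "ball x \<epsilon> \<subseteq> closure Om" using x by (meson mem_interior)
    define t where "t = min \<epsilon> r / 2"
    have t: "0 < t" "t < \<epsilon>" "t < r" using \<epsilon>(1) r by (auto simp: t_def)
    define y where "y = x + t *\<^sub>R e"
    have yx: "dist x y = t" using t e by (simp add: y_def dist_norm)
    have y: "y \<in> ball x r" "y \<in> ball x \<epsilon>" using yx t by auto
    define V where "V = {z \<in> ball x r. g (z - (z \<bullet> e) *\<^sub>R e) < z \<bullet> e}"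
    \<comment> \<open>The definition of the domain leaves the sign of L open; a negative L is
      refuted by x and y, which have positive distance.\<close>
    have "L-lipschitz_on UNIV g \<or> L < 0"
      using g by (auto simp: lipschitz_on_def dist_real_def not_less)
    moreover have "\<not> L < 0"
    proof
      assume "L < 0"
      moreover have "0 \<le> L * dist y x" using g[of y x] by linarith
      ultimately show False using t(1) yx by (simp add: dist_commute zero_le_mult_iff)
    qed
    ultimately have gc: "continuous_on UNIV g" using lipschitz_on_continuous_on by blast
    have "open V" unfolding V_def Collect_conj_eq
      by (intro open_Int open_Collect_less continuous_intros continuous_on_compose2[OF gc])
        (auto simp: ball_def intro!: open_Collect_less continuous_intros)
    moreover have "y \<in> V"
    proof -
      have "y \<bullet> e = x \<bullet> e + t" using ee by (simp add: y_def inner_add_left)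
      moreover have "y - (y \<bullet> e) *\<^sub>R e = x - (x \<bullet> e) *\<^sub>R e"
        unfolding calculation by (simp add: y_def algebra_simps)
      ultimately show ?thesis using xg t y(1) by (simp add: V_def)
    qed
    moreover have "V \<inter> Om = {}" using iff by (auto simp: V_def)
    ultimately have "y \<notin> closure Om" by (meson disjoint_iff open_Int_closure_eq_empty)
    then show False using y(2) \<epsilon>(2) by blast
  qed
qed

lemma d_simplex_props:
  fixes \<tau> :: "(real^'n) set"
  assumes "d_simplex \<tau>"
  shows "compact \<tau>" "convex \<tau>" "interior \<tau> \<noteq> {}" "closure (interior \<tau>) = \<tau>"
    "negligible (frontier \<tau>)" "0 < diameter \<tau>"
    "card (simplex_vertices \<tau>) = CARD('n) + 1" "finite (simplex_vertices \<tau>)"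
    "\<tau> = convex hull (simplex_vertices \<tau>)"
proof -
  obtain X where X: "finite X" "card X = CARD('n) + 1" "\<not> affine_dependent X" "\<tau> = convex hull X"
    using assms unfolding d_simplex_def by blast
  have v: "simplex_vertices \<tau> = X"
    unfolding simplex_vertices_def X(4) using extreme_point_of_convex_hull_affine_independent[OF X(3)] by auto
  show "card (simplex_vertices \<tau>) = CARD('n) + 1" "finite (simplex_vertices \<tau>)"
    "\<tau> = convex hull (simplex_vertices \<tau>)" using v X by auto
  show c: "compact \<tau>" unfolding X(4) using X(1) by (simp add: finite_imp_compact_convex_hull)
  show cv: "convex \<tau>" unfolding X(4) by simp
  show i: "interior \<tau> \<noteq> {}" unfolding X(4) using interior_convex_hull_eq_empty[of X] X by simp
  show "closure (interior \<tau>) = \<tau>" using convex_closure_interior[OF cv i] closure_closed[OF compact_imp_closed[OF c]] by simp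
  show "negligible (frontier \<tau>)" by (rule negligible_convex_frontier[OF cv])
  have "card X > 1" using X(2) by simp
  then obtain x y where xy: "x \<in> X" "y \<in> X" "x \<noteq> y" by (metis card_gt_0_iff card_le_Suc0_iff_eq X(1) One_nat_def not_le)
  then have "x \<in> \<tau>" "y \<in> \<tau>" unfolding X(4) by (auto intro: hull_inc)
  then have "dist x y \<le> diameter \<tau>" using diameter_bounded_bound c compact_imp_bounded by blast
  then show "0 < diameter \<tau>" using xy(3) by (metis less_le_trans zero_less_dist_iff)
qed

text \<open>Distinct simplices have distinct vertex sets of equal size, so they share at most as
  many vertices as the dimension, and the convex hull of so few points has empty interior.\<close>

lemma conforming_mesh_overlap:
  fixes T :: "(real^'n) set set"
  assumes mesh: "conforming_mesh Om T" and T: "\<tau> \<in> T" "\<tau>' \<in> T" "\<tau> \<noteq> \<tau>'"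
  shows "negligible (\<tau> \<inter> \<tau>')" "interior \<tau> \<inter> interior \<tau>' = {}"
proof -
  have ds: "d_simplex \<tau>" "d_simplex \<tau>'" using mesh T by (auto simp: conforming_mesh_def)
  let ?X = "simplex_vertices \<tau>" and ?Y = "simplex_vertices \<tau>'"
  have inter: "\<tau> \<inter> \<tau>' = convex hull (?X \<inter> ?Y)" using mesh T by (auto simp: conforming_mesh_def)
  have "?X \<noteq> ?Y" using d_simplex_props(9)[OF ds(1)] d_simplex_props(9)[OF ds(2)] T(3) by metis
  then have "?X \<inter> ?Y \<subset> ?X"
    using d_simplex_props(7,8)[OF ds(1)] d_simplex_props(7,8)[OF ds(2)]
    by (metis Int_lower1 Int_lower2 card_subset_eq psubsetI)
  then have "card (?X \<inter> ?Y) < CARD('n) + 1"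
    using d_simplex_props(7,8)[OF ds(1)] psubset_card_mono by metis
  then have e: "interior (\<tau> \<inter> \<tau>') = {}" unfolding inter
    using d_simplex_props(8)[OF ds(1)] by (intro empty_interior_convex_hull) auto
  then show "interior \<tau> \<inter> interior \<tau>' = {}" by simp
  show "negligible (\<tau> \<inter> \<tau>')"
    using e negligible_convex_interior[of "\<tau> \<inter> \<tau>'"] d_simplex_props(2)[OF ds(1)] d_simplex_props(2)[OF ds(2)]
    by (simp add: convex_Int)
qed

lemma mesh_AE_interior:
  assumes "conforming_mesh Om T"
  shows "AE x in lebesgue. x \<in> Om \<longrightarrow> (\<exists>\<tau>\<in>T. x \<in> interior \<tau>)"
proof -
  have T: "finite T" "\<And>\<tau>. \<tau> \<in> T \<Longrightarrow> d_simplex \<tau>" "\<Union>T = closure Om"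
    using assms by (auto simp: conforming_mesh_def)
  have "AE x in lebesgue. \<forall>\<tau>\<in>T. x \<notin> frontier \<tau>"
  proof (subst AE_ball_countable[OF countable_finite[OF T(1)]], rule ballI)
    fix \<tau> assume "\<tau> \<in> T"
    then show "AE x in lebesgue. x \<notin> frontier \<tau>"
      using d_simplex_props(5)[OF T(2)] by (simp add: AE_not_in negligible_iff_null_sets)
  qed
  then show ?thesis
  proof eventually_elim
    case (elim x)
    show ?case
    proof
      assume "x \<in> Om"
      then obtain \<tau> where "\<tau> \<in> T" "x \<in> \<tau>" using T(3) closure_subset by blast
      then show "\<exists>\<tau>\<in>T. x \<in> interior \<tau>" using elim by (auto simp: frontier_def closure_def)
    qed
  qed
qed

lemma mesh_interior_subset:
  assumes "lipschitz_domain Om" "conforming_mesh Om T" "\<tau> \<in> T"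
  shows "interior \<tau> \<subseteq> Om"
proof -
  have "\<tau> \<subseteq> closure Om" using assms(2,3) by (auto simp: conforming_mesh_def)
  then show ?thesis using interior_mono lipschitz_domain_interior_closure[OF assms(1)] by blast
qed

lemma set_integral_mesh:
  fixes f :: "real^'n \<Rightarrow> real"
  assumes dom: "lipschitz_domain Om" and mesh: "conforming_mesh Om T"
    and f: "set_integrable lebesgue Om f"
  shows "(LINT x:Om|lebesgue. f x) = (\<Sum>\<tau>\<in>T. LINT x:interior \<tau>|lebesgue. f x)"
proof -
  have T: "finite T" using mesh by (auto simp: conforming_mesh_def)
  have sub: "interior \<tau> \<subseteq> Om" if "\<tau> \<in> T" for \<tau> by (rule mesh_interior_subset[OF dom mesh that])
  have meas: "A \<in> sets lebesgue" if "open A" for A :: "(real^'n) set" using that by simp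
  have int: "set_integrable lebesgue A f" if "open A" "A \<subseteq> Om" for A
    by (rule set_integrable_subset[OF f meas[OF that(1)] that(2)])
  have Om: "open Om" using dom by (simp add: lipschitz_domain_def)
  let ?U = "\<Union>\<tau>\<in>T. interior \<tau>"
  have U: "open ?U" "?U \<subseteq> Om" using sub by auto
  have bm: "set_borel_measurable lebesgue A f" if "open A" "A \<subseteq> Om" for A
    using int[OF that] by (simp add: set_borel_measurable_def set_integrable_def)
  have "(LINT x:Om|lebesgue. f x) = (LINT x:?U|lebesgue. f x)"
  proof (rule set_integral_cong_set)
    show "AE x in lebesgue. (x \<in> ?U) = (x \<in> Om)"
      using mesh_AE_interior[OF mesh] by eventually_elim (use U(2) in auto)
    show "set_borel_measurable lebesgue Om f" by (rule bm[OF Om order_refl])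
    show "set_borel_measurable lebesgue ?U f" by (rule bm[OF U])
  qed
  also have "\<dots> = (\<Sum>\<tau>\<in>T. LINT x:interior \<tau>|lebesgue. f x)"
  proof (rule set_integral_finite_Union[OF T])
    show "disjoint_family_on interior T"
      using conforming_mesh_overlap(2)[OF mesh] by (auto simp: disjoint_family_on_def)
    show "set_integrable lebesgue (interior \<tau>) f" if "\<tau> \<in> T" for \<tau>
      using int sub that by auto
    show "interior \<tau> \<in> sets lebesgue" if "\<tau> \<in> T" for \<tau> by simp
  qed
  finally show ?thesis .
qed

section \<open>Piecewise polynomials and the inverse inequality\<close>

definition mon :: "('n \<Rightarrow> nat) \<Rightarrow> real^'n \<Rightarrow> real" where
  "mon \<alpha> x = (\<Prod>i\<in>UNIV. (x $ i) ^ \<alpha> i)"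

definition multi_indices :: "nat \<Rightarrow> ('n::finite \<Rightarrow> nat) set" where
  "multi_indices k = {\<alpha>. (\<Sum>i\<in>UNIV. \<alpha> i) \<le> k}"

lemma finite_multi_indices: "finite (multi_indices k :: ('n::finite \<Rightarrow> nat) set)"
proof (rule finite_subset)
  show "multi_indices k \<subseteq> (PiE UNIV (\<lambda>_. {..k}) :: ('n \<Rightarrow> nat) set)"
    by (auto simp: multi_indices_def PiE_def intro: order_trans[OF member_le_sum[of _ UNIV]])
  show "finite (PiE UNIV (\<lambda>_. {..k}) :: ('n \<Rightarrow> nat) set)" by (intro finite_PiE) auto
qed

lemma poly_deg_le_iff:
  "poly_deg_le k q \<longleftrightarrow> (\<exists>c. \<forall>x. q x = (\<Sum>\<alpha>\<in>multi_indices k. c \<alpha> * mon \<alpha> x))"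
  by (simp add: poly_deg_le_def multi_indices_def mon_def)

lemma poly_deg_le_add:
  assumes "poly_deg_le k f" "poly_deg_le k g"
  shows "poly_deg_le k (\<lambda>x. f x + g x)"
proof -
  obtain c c' where "\<forall>x. f x = (\<Sum>\<alpha>\<in>multi_indices k. c \<alpha> * mon \<alpha> x)"
    "\<forall>x. g x = (\<Sum>\<alpha>\<in>multi_indices k. c' \<alpha> * mon \<alpha> x)" using assms by (auto simp: poly_deg_le_iff)
  then show ?thesis unfolding poly_deg_le_iff
    by (intro exI[of _ "\<lambda>\<alpha>. c \<alpha> + c' \<alpha>"]) (simp add: distrib_right sum.distrib)
qed

lemma poly_deg_le_scale:
  assumes "poly_deg_le k f"
  shows "poly_deg_le k (\<lambda>x. r * f x)"
proof -
  obtain c where "\<forall>x. f x = (\<Sum>\<alpha>\<in>multi_indices k. c \<alpha> * mon \<alpha> x)"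
    using assms by (auto simp: poly_deg_le_iff)
  then show ?thesis unfolding poly_deg_le_iff
    by (intro exI[of _ "\<lambda>\<alpha>. r * c \<alpha>"]) (simp add: sum_distrib_left mult.assoc)
qed

lemma poly_deg_le_mon:
  assumes "\<alpha> \<in> multi_indices k"
  shows "poly_deg_le k (mon \<alpha>)"
  unfolding poly_deg_le_iff
proof (intro exI[of _ "\<lambda>\<beta>. if \<beta> = \<alpha> then 1 else 0"] allI)
  fix x
  have "(\<Sum>\<beta>\<in>multi_indices k. (if \<beta> = \<alpha> then 1 else 0) * mon \<beta> x)
      = (\<Sum>\<beta>\<in>multi_indices k. if \<beta> = \<alpha> then mon \<beta> x else 0)" by (intro sum.cong) auto
  then show "mon \<alpha> x = (\<Sum>\<beta>\<in>multi_indices k. (if \<beta> = \<alpha> then 1 else 0) * mon \<beta> x)"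
    using assms by (simp add: finite_multi_indices)
qed

lemma poly_deg_le_const: "poly_deg_le k (\<lambda>x. r)"
proof -
  have "poly_deg_le k (\<lambda>x. r * mon (\<lambda>_. 0) x)"
    by (intro poly_deg_le_scale poly_deg_le_mon) (simp add: multi_indices_def)
  then show ?thesis by (simp add: mon_def)
qed

lemma poly_deg_le_sum:
  "(\<And>i. i \<in> I \<Longrightarrow> poly_deg_le k (f i)) \<Longrightarrow> poly_deg_le k (\<lambda>x. \<Sum>i\<in>I. f i x)"
  by (induction I rule: infinite_finite_induct) (auto intro: poly_deg_le_const poly_deg_le_add)

lemma poly_deg_le_mono:
  assumes "poly_deg_le k f" "k \<le> l"
  shows "poly_deg_le l f"
proof -
  obtain c where "\<And>x. f x = (\<Sum>\<alpha>\<in>multi_indices k. c \<alpha> * mon \<alpha> x)"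
    using assms by (auto simp: poly_deg_le_iff)
  then have f: "f = (\<lambda>x. \<Sum>\<alpha>\<in>multi_indices k. c \<alpha> * mon \<alpha> x)" by auto
  show ?thesis unfolding f
    by (intro poly_deg_le_sum poly_deg_le_scale poly_deg_le_mon) (use assms(2) in \<open>auto simp: multi_indices_def\<close>)
qed

lemma poly_deg_le_mult_coord:
  assumes "poly_deg_le k f"
  shows "poly_deg_le (Suc k) (\<lambda>x. f x * x $ j)"
proof -
  obtain c where "\<And>x. f x = (\<Sum>\<alpha>\<in>multi_indices k. c \<alpha> * mon \<alpha> x)"
    using assms by (auto simp: poly_deg_le_iff)
  moreover have "mon \<alpha> x * x $ j = mon (\<alpha>(j := Suc (\<alpha> j))) x" for \<alpha> x
  proof -
    have "mon \<alpha> x = x $ j ^ \<alpha> j * (\<Prod>i\<in>UNIV - {j}. x $ i ^ \<alpha> i)"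
      unfolding mon_def by (intro prod.remove) auto
    moreover have "mon (\<alpha>(j := Suc (\<alpha> j))) x = x $ j ^ Suc (\<alpha> j) * (\<Prod>i\<in>UNIV - {j}. x $ i ^ \<alpha> i)"
      unfolding mon_def by (subst prod.remove[of UNIV j]) (auto intro!: prod.cong)
    ultimately show ?thesis by simp
  qed
  ultimately have f: "(\<lambda>x. f x * x $ j) = (\<lambda>x. \<Sum>\<alpha>\<in>multi_indices k. c \<alpha> * mon (\<alpha>(j := Suc (\<alpha> j))) x)"
    by (simp add: sum_distrib_right mult.assoc)
  show ?thesis unfolding f
  proof (intro poly_deg_le_sum poly_deg_le_scale poly_deg_le_mon)
    fix \<alpha> :: "'a \<Rightarrow> nat" assume \<alpha>: "\<alpha> \<in> multi_indices k"
    have "(\<Sum>i\<in>UNIV. (\<alpha>(j := Suc (\<alpha> j))) i) = Suc (\<alpha> j) + (\<Sum>i\<in>UNIV - {j}. \<alpha> i)"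
      by (subst sum.remove[of UNIV j]) (auto intro!: sum.cong)
    also have "\<dots> = Suc (\<Sum>i\<in>UNIV. \<alpha> i)" by (subst sum.remove[of UNIV j]) auto
    finally show "\<alpha>(j := Suc (\<alpha> j)) \<in> multi_indices (Suc k)" using \<alpha> by (simp add: multi_indices_def)
  qed
qed

lemma poly_deg_le_mult_affine_power:
  fixes f :: "real^'n \<Rightarrow> real"
  assumes "poly_deg_le k f"
  shows "poly_deg_le (k + n) (\<lambda>x. f x * ((\<Sum>j\<in>UNIV. s j * x $ j) + r) ^ n)"
proof (induction n)
  case 0
  then show ?case using assms by simp
next
  case (Suc n)
  let ?g = "\<lambda>x::real^'n. f x * ((\<Sum>j\<in>UNIV. s j * x $ j) + r) ^ n"
  have "poly_deg_le (Suc (k + n)) (\<lambda>x. (\<Sum>j\<in>UNIV. s j * (?g x * x $ j)) + r * ?g x)"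
    by (intro poly_deg_le_add poly_deg_le_sum poly_deg_le_scale poly_deg_le_mult_coord Suc
        poly_deg_le_mono[OF Suc]) simp
  moreover have "(\<Sum>j\<in>UNIV. s j * (?g x * x $ j)) + r * ?g x
      = f x * ((\<Sum>j\<in>UNIV. s j * x $ j) + r) ^ Suc n" for x
  proof -
    have "(\<Sum>j\<in>UNIV. s j * (?g x * x $ j)) = ?g x * (\<Sum>j\<in>UNIV. s j * x $ j)"
      by (subst sum_distrib_left) (intro sum.cong refl, simp add: ac_simps)
    then show ?thesis by (simp add: algebra_simps)
  qed
  ultimately show ?case by simp
qed

text \<open>Total degree survives the substitution because the power \<alpha> i of a coordinate
  becomes the same power of an affine function, and these degrees add up over the
  coordinates.\<close>

lemma poly_deg_le_compose_affine:
  fixes f :: "real^'n \<Rightarrow> real"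
  assumes f: "poly_deg_le k f" and \<psi>: "\<And>x i. \<psi> x $ i = (\<Sum>j\<in>UNIV. s i j * x $ j) + r i"
  shows "poly_deg_le k (\<lambda>x::real^'n. f (\<psi> x))"
proof -
  obtain c where "\<And>x. f x = (\<Sum>\<alpha>\<in>multi_indices k. c \<alpha> * mon \<alpha> x)"
    using f by (auto simp: poly_deg_le_iff)
  then have eq: "(\<lambda>x. f (\<psi> x)) = (\<lambda>x. \<Sum>\<alpha>\<in>multi_indices k. c \<alpha> * mon \<alpha> (\<psi> x))" by auto
  show ?thesis unfolding eq
  proof (intro poly_deg_le_sum poly_deg_le_scale)
    fix \<alpha> :: "'n \<Rightarrow> nat" assume \<alpha>: "\<alpha> \<in> multi_indices k"
    have "poly_deg_le (\<Sum>i\<in>I. \<alpha> i) (\<lambda>x. \<Prod>i\<in>I. (\<psi> x $ i) ^ \<alpha> i)" if "finite I" for I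
      using that
    proof induction
      case empty
      then show ?case by (simp add: poly_deg_le_const)
    next
      case (insert i I)
      then show ?case using poly_deg_le_mult_affine_power[OF insert.IH, of "\<alpha> i" "s i" "r i"]
        by (simp add: \<psi> mult.commute add.commute)
    qed
    from this[of UNIV] show "poly_deg_le k (\<lambda>x. mon \<alpha> (\<psi> x))"
      using \<alpha> unfolding mon_def by (auto simp: multi_indices_def intro: poly_deg_le_mono)
  qed
qed

lemma mon_in_flat_algebra: "mon \<alpha> \<in> flat_algebra"
  unfolding mon_def[abs_def] by (intro flat_algebra_prod flat_algebra_power flat_algebra.coord)

lemma poly_deg_le_flat_algebra:
  assumes "poly_deg_le k f"
  shows "f \<in> flat_algebra"
proof -
  obtain c where "\<And>x. f x = (\<Sum>\<alpha>\<in>multi_indices k. c \<alpha> * mon \<alpha> x)"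
    using assms by (auto simp: poly_deg_le_iff)
  then have f: "f = (\<lambda>x. \<Sum>\<alpha>\<in>multi_indices k. c \<alpha> * mon \<alpha> x)" by auto
  show ?thesis unfolding f
    by (intro flat_algebra_sum flat_algebra.mult flat_algebra.const mon_in_flat_algebra)
qed

text \<open>Bijectivity is assumed only between the simplices. A ball inside the reference simplex
  turns it into injectivity of the matrix, so the inverse is globally affine.\<close>

lemma affine_bij_inverse:
  fixes \<phi> :: "real^'n \<Rightarrow> real^'n"
  assumes "affine_bij \<phi> \<tau>"
  obtains \<psi> s r where "\<And>x i. \<psi> x $ i = (\<Sum>j\<in>UNIV. s i j * x $ j) + r i"
    "\<And>y. y \<in> \<tau> \<Longrightarrow> \<psi> y \<in> ref_simplex \<and> \<phi> (\<psi> y) = y"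
proof -
  obtain A b where Ab: "\<And>x. \<phi> x = A *v x + b" and bij: "bij_betw \<phi> ref_simplex \<tau>"
    using assms by (auto simp: affine_bij_def)
  have "{axis i 1 | i. True} = (Basis :: (real^'n) set)" by (auto simp: Basis_vec_def)
  then have "interior (ref_simplex :: (real^'n) set) \<noteq> {}"
    unfolding ref_simplex_def using interior_std_simplex_nonempty by auto
  then obtain p :: "real^'n" and e where e: "0 < e" "ball p e \<subseteq> ref_simplex"
    by (metis all_not_in_conv mem_interior)
  have "A *v v \<noteq> 0" if "v \<noteq> 0" for v
  proof
    assume Av: "A *v v = 0"
    define t where "t = e / (2 * norm v)"
    have t: "t > 0" "norm (t *\<^sub>R v) < e" using e(1) that by (auto simp: t_def)
    have "\<phi> (p + t *\<^sub>R v) = \<phi> p" by (simp add: Ab matrix_vector_right_distrib matrix_vector_mult_scaleR Av)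
    moreover have "p \<in> ref_simplex" "p + t *\<^sub>R v \<in> ref_simplex" using e t by (auto simp: dist_norm subset_iff)
    ultimately have "p + t *\<^sub>R v = p" using bij inj_onD[of \<phi> ref_simplex] by (metis bij_betw_def)
    then show False using t that by simp
  qed
  then obtain A' where A': "A' ** A = mat 1"
    using matrix_left_invertible_ker[of A] by blast
  define \<psi> where "\<psi> = (\<lambda>y. A' *v (y - b))"
  have inv: "\<psi> (\<phi> x) = x" for x by (simp add: \<psi>_def Ab matrix_vector_mul_assoc A')
  show thesis
  proof (rule that[of \<psi> "\<lambda>i j. A' $ i $ j" "\<lambda>i. - (\<Sum>j\<in>UNIV. A' $ i $ j * b $ j)"])
    show "\<psi> x $ i = (\<Sum>j\<in>UNIV. A' $ i $ j * x $ j) + - (\<Sum>j\<in>UNIV. A' $ i $ j * b $ j)" for x i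
      by (simp add: \<psi>_def matrix_vector_mult_def right_diff_distrib sum_subtractf)
    show "\<psi> y \<in> ref_simplex \<and> \<phi> (\<psi> y) = y" if "y \<in> \<tau>" for y
      using that bij inv unfolding bij_betw_def by force
  qed
qed

text \<open>Continuity is not part of \<open>fe_space\<close>. It follows because a single function
  u agrees with a polynomial on every closed simplex, so the pieces match on shared faces and can be
  glued over finitely many closed sets.\<close>

lemma fe_space_subset_Sk:
  fixes V :: "(real^'n \<Rightarrow> real) set"
  assumes mesh: "conforming_mesh Om T" and phi: "\<forall>\<tau>\<in>T. affine_bij (\<phi> \<tau>) \<tau>"
    and P_hi: "\<forall>f\<in>P. \<exists>q. poly_deg_le m' q \<and> (\<forall>x\<in>ref_simplex. f x = q x)"
  shows "fe_space V T \<phi> P \<subseteq> Sk Om T m'"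
proof
  fix u assume u: "u \<in> fe_space V T \<phi> P"
  have loc: "\<exists>q. poly_deg_le m' q \<and> (\<forall>x\<in>\<tau>. u x = q x)" if \<tau>: "\<tau> \<in> T" for \<tau>
  proof -
    obtain f where f: "f \<in> P" "\<And>x. x \<in> ref_simplex \<Longrightarrow> u (\<phi> \<tau> x) = f x" using u \<tau> by (auto simp: fe_space_def)
    obtain q where q: "poly_deg_le m' q" "\<And>x. x \<in> ref_simplex \<Longrightarrow> f x = q x" using P_hi f(1) by blast
    obtain \<psi> s r where \<psi>: "\<And>x i. \<psi> x $ i = (\<Sum>j\<in>UNIV. s i j * x $ j) + r i"
      "\<And>y. y \<in> \<tau> \<Longrightarrow> \<psi> y \<in> ref_simplex \<and> \<phi> \<tau> (\<psi> y) = y"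
      using affine_bij_inverse phi \<tau> by metis
    have "u y = q (\<psi> y)" if "y \<in> \<tau>" for y using \<psi>(2)[OF that] f(2)[of "\<psi> y"] q(2)[of "\<psi> y"] by simp
    then show ?thesis using poly_deg_le_compose_affine[OF q(1) \<psi>(1)] by blast
  qed
  have T: "finite T" "\<Union>T = closure Om" "\<And>\<tau>. \<tau> \<in> T \<Longrightarrow> d_simplex \<tau>"
    using mesh by (auto simp: conforming_mesh_def)
  have "continuous_on (\<Union>\<tau>\<in>T. \<tau>) u"
  proof (rule continuous_on_closed_Union[OF T(1)])
    fix \<tau> assume \<tau>: "\<tau> \<in> T"
    then show "closed \<tau>" using d_simplex_props(1)[OF T(3)] compact_imp_closed by blast
    obtain q where q: "poly_deg_le m' q" "\<And>x. x \<in> \<tau> \<Longrightarrow> u x = q x" using loc[OF \<tau>] by blast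
    have "continuous_on \<tau> q" by (rule flat_algebra_continuous[OF poly_deg_le_flat_algebra[OF q(1)]])
    then show "continuous_on \<tau> u" using q(2) by (simp cong: continuous_on_cong)
  qed
  then show "u \<in> Sk Om T m'" using loc T(2) by (simp add: Sk_def)
qed

section \<open>Comparison of semidefinite forms in finitely many coordinates\<close>

lemma psd_form_null:
  fixes B :: "('i \<Rightarrow> real) \<Rightarrow> ('i \<Rightarrow> real) \<Rightarrow> real"
  assumes lin: "\<And>s t u v w. B (\<lambda>i. s * u i + t * v i) w = s * B u w + t * B v w"
    and sym: "\<And>u v. B u v = B v u" and psd: "\<And>u. 0 \<le> B u u" and r: "B r r = 0"
  shows "B w r = 0"
proof (rule ccontr)
  assume n: "B w r \<noteq> 0"
  \<comment> \<open>Along w + t r the form is affine in t; this t gives it the value -1.\<close>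
  define t where "t = - (B w w + 1) / (2 * B w r)"
  have "0 \<le> B (\<lambda>i. 1 * w i + t * r i) (\<lambda>i. 1 * w i + t * r i)" by (rule psd)
  also have "\<dots> = B w w + 2 * t * B w r"
    unfolding lin sym[of _ "\<lambda>i. 1 * w i + t * r i"] using sym[of r w] r by (simp add: algebra_simps)
  also have "\<dots> = - 1" using n by (simp add: t_def field_simps)
  finally show False by simp
qed

text \<open>Gram-Schmidt: the unit vector of a new index is replaced by its residual against the span
  of the previous ones, so no nondegeneracy of the form is needed.\<close>

lemma psd_form_dominated:
  fixes B D :: "('i \<Rightarrow> real) \<Rightarrow> ('i \<Rightarrow> real) \<Rightarrow> real"
  assumes B_lin: "\<And>s t u v w. B (\<lambda>i. s * u i + t * v i) w = s * B u w + t * B v w"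
    and B_sym: "\<And>u v. B u v = B v u" and B_psd: "\<And>u. 0 \<le> B u u"
    and D_lin: "\<And>s t u v w. D (\<lambda>i. s * u i + t * v i) w = s * D u w + t * D v w"
    and D_sym: "\<And>u v. D u v = D v u" and D_psd: "\<And>u. 0 \<le> D u u"
    and null: "\<And>u. B u u = 0 \<Longrightarrow> D u u = 0"
    and J: "finite J"
  shows "\<exists>C\<ge>0. \<forall>u. (\<forall>i. i \<notin> J \<longrightarrow> u i = 0) \<longrightarrow> D u u \<le> C * B u u"
proof -
  \<comment> \<open>The induction is strengthened by a Riesz-type statement: pairing with any w is
    represented, on vectors supported in J, by some g supported in J. This is what supplies the
    residuals.\<close>
  have "(\<forall>w. \<exists>g. (\<forall>i. i \<notin> J \<longrightarrow> g i = 0) \<and> (\<forall>f. (\<forall>i. i \<notin> J \<longrightarrow> f i = 0) \<longrightarrow> B w f = B g f))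
    \<and> (\<exists>C\<ge>0. \<forall>u. (\<forall>i. i \<notin> J \<longrightarrow> u i = 0) \<longrightarrow> D u u \<le> C * B u u)"
    using J
  proof (induction J)
    case empty
    have z: "f = (\<lambda>_. 0)" if "\<forall>i. f i = 0" for f :: "'i \<Rightarrow> real" using that by auto
    have B0: "B u (\<lambda>_. 0) = 0" and D0: "D u (\<lambda>_. 0) = 0" for u
      using B_lin[of 0 u 0 u u] D_lin[of 0 u 0 u u] B_sym D_sym by simp_all
    show ?case
    proof (intro conjI allI exI[of _ "\<lambda>_. 0"] exI[of _ 0] impI)
      fix w f :: "'i \<Rightarrow> real" assume "\<forall>i. i \<notin> {} \<longrightarrow> f i = 0"
      then have "f = (\<lambda>_. 0)" by (intro z) simp
      then show "B w f = B (\<lambda>_. 0) f" by (simp add: B0)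
    next
      fix u :: "'i \<Rightarrow> real" assume "\<forall>i. i \<notin> {} \<longrightarrow> u i = 0"
      then have "u = (\<lambda>_. 0)" by (intro z) simp
      then show "D u u \<le> 0 * B u u" by (simp add: D0)
    qed simp_all
  next
    case (insert k J)
    define supp where "supp = (\<lambda>f::'i \<Rightarrow> real. \<forall>i. i \<notin> J \<longrightarrow> f i = 0)"
    obtain C where C: "0 \<le> C" "\<And>u. supp u \<Longrightarrow> D u u \<le> C * B u u"
      using insert.IH unfolding supp_def by blast
    have proj: "\<exists>g. supp g \<and> (\<forall>f. supp f \<longrightarrow> B w f = B g f)" for w
      using insert.IH unfolding supp_def by blast
    define e where "e = (\<lambda>i. if i = k then 1 else 0::real)"
    obtain ge where ge: "supp ge" "\<And>f. supp f \<Longrightarrow> B e f = B ge f" using proj by blast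
    define r where "r = (\<lambda>i. 1 * e i + (-1) * ge i)"
    have rk: "r k = 1" using ge(1) insert(2) by (simp add: r_def e_def supp_def)
    have r0: "r i = 0" if "i \<notin> insert k J" for i using that ge(1) by (simp add: r_def e_def supp_def)
    have rB: "B r f = 0" if "supp f" for f unfolding r_def B_lin using ge(2)[OF that] by simp
    have split: "\<exists>f'. supp f' \<and> f = (\<lambda>i. 1 * f' i + f k * r i)" if "\<forall>i. i \<notin> insert k J \<longrightarrow> f i = 0" for f
    proof (intro exI[of _ "\<lambda>i. f i - f k * r i"] conjI)
      show "supp (\<lambda>i. f i - f k * r i)" unfolding supp_def
      proof (intro allI impI)
        fix i assume "i \<notin> J"
        then show "f i - f k * r i = 0" using that r0[of i] rk by (cases "i = k") auto
      qed
    qed simp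
    have "\<exists>g. (\<forall>i. i \<notin> insert k J \<longrightarrow> g i = 0)
        \<and> (\<forall>f. (\<forall>i. i \<notin> insert k J \<longrightarrow> f i = 0) \<longrightarrow> B w f = B g f)" for w
    proof -
      obtain g where g: "supp g" "\<And>f. supp f \<Longrightarrow> B w f = B g f" using proj by blast
      \<comment> \<open>If the residual r is a null vector, every pairing with it vanishes as well,
        so the coefficient 0 is still correct.\<close>
      define \<alpha> where "\<alpha> = (if B r r = 0 then 0 else B w r / B r r)"
      have \<alpha>: "B w r = \<alpha> * B r r" using psd_form_null[of B r w, OF B_lin B_sym B_psd] by (auto simp: \<alpha>_def)
      show ?thesis
      proof (intro exI[of _ "\<lambda>i. 1 * g i + \<alpha> * r i"] conjI allI impI)
        fix i assume "i \<notin> insert k J"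
        then show "1 * g i + \<alpha> * r i = 0" using g(1) r0 by (simp add: supp_def)
      next
        fix f :: "'i \<Rightarrow> real" assume "\<forall>i. i \<notin> insert k J \<longrightarrow> f i = 0"
        then obtain f' t where f': "supp f'" and f: "f = (\<lambda>i. 1 * f' i + t * r i)" using split by blast
        have x: "B u f = B u f' + t * B u r" for u
          unfolding B_sym[of u f] unfolding f B_lin by (simp add: B_sym)
        have "B g r = 0" using rB[OF g(1)] B_sym by metis
        then show "B w f = B (\<lambda>i. 1 * g i + \<alpha> * r i) f"
          unfolding B_lin x using g(2)[OF f'] rB[OF f'] \<alpha> by simp
      qed
    qed
    moreover have "\<exists>C\<ge>0. \<forall>u. (\<forall>i. i \<notin> insert k J \<longrightarrow> u i = 0) \<longrightarrow> D u u \<le> C * B u u"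
    proof -
      define K where "K = (if B r r = 0 then 0 else D r r / B r r)"
      have K: "D r r = K * B r r" "0 \<le> K" using null[of r] B_psd[of r] D_psd[of r] by (auto simp: K_def)
      show ?thesis
      \<comment> \<open>\<open>B\<close> splits orthogonally into the parts f and t r, whereas
        \<open>D\<close> does not; bounding its mixed term costs the factor 2.\<close>
      proof (intro exI[of _ "2 * C + 2 * K"] conjI allI impI)
        show "0 \<le> 2 * C + 2 * K" using C(1) K(2) by simp
        fix u :: "'i \<Rightarrow> real" assume "\<forall>i. i \<notin> insert k J \<longrightarrow> u i = 0"
        then obtain f t where f: "supp f" and u: "u = (\<lambda>i. 1 * f i + t * r i)" using split by blast
        have "B u u = B f f + t^2 * B r r"
          unfolding u B_lin unfolding B_sym[of _ "\<lambda>i. 1 * f i + t * r i"] B_lin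
          using rB[OF f] B_sym[of f r] by (simp add: power2_eq_square)
        moreover have "D u u = D f f + 2 * t * D f r + t^2 * D r r"
          unfolding u D_lin unfolding D_sym[of _ "\<lambda>i. 1 * f i + t * r i"] D_lin
          using D_sym[of f r] by (simp add: power2_eq_square algebra_simps)
        moreover have "0 \<le> D f f - 2 * t * D f r + t^2 * D r r"
          using D_psd[of "\<lambda>i. 1 * f i + (- t) * r i"]
          unfolding D_lin unfolding D_sym[of _ "\<lambda>i. 1 * f i + (- t) * r i"] D_lin
          using D_sym[of f r] by (simp add: power2_eq_square algebra_simps)
        moreover have "D f f \<le> C * B f f" by (rule C(2)[OF f])
        moreover have "0 \<le> C * (t^2 * B r r)" "0 \<le> K * B f f" using C(1) K(2) B_psd by auto
        ultimately show "D u u \<le> (2 * C + 2 * K) * B u u"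
          using K(1) by (simp add: algebra_simps)
      qed
    qed
    ultimately show ?case by blast
  qed
  then show ?thesis by blast
qed

lemma flat_algebra_set_integrable:
  fixes g :: "real^'n \<Rightarrow> real"
  assumes "g \<in> flat_algebra" "open U" "bounded U"
  shows "set_integrable lebesgue U g"
proof -
  obtain a b where "U \<subseteq> cbox a b" using bounded_subset_cbox_symmetric[OF assms(3)] by metis
  moreover have "set_integrable lebesgue (cbox a b) g"
    by (rule absolutely_integrable_continuous) (rule flat_algebra_continuous[OF assms(1)])
  moreover have "U \<in> sets lebesgue" using assms(2) by simp
  ultimately show ?thesis using set_integrable_subset by blast
qed

lemma continuous_zero_if_square_integral_zero:
  fixes q :: "real^'n \<Rightarrow> real"
  assumes q: "q \<in> flat_algebra" and U: "open U" "bounded U"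
    and z: "(LINT x:U|lebesgue. q x * q x) = 0" and x: "x \<in> U"
  shows "q x = 0"
proof (rule ccontr)
  assume qx: "q x \<noteq> 0"
  have i: "integrable lebesgue (\<lambda>x. indicator U x *\<^sub>R (q x * q x))"
    using flat_algebra_set_integrable[OF flat_algebra.mult[OF q q] U] by (simp add: set_integrable_def)
  have "AE x in lebesgue. indicator U x *\<^sub>R (q x * q x) = 0"
    using z integral_nonneg_eq_0_iff_AE[OF i] by (auto simp: set_lebesgue_integral_def)
  then have ae: "AE x in lebesgue. \<not> (x \<in> U \<and> q x \<noteq> 0)" by eventually_elim auto
  let ?V = "U \<inter> q -` (- {0})"
  have V: "open ?V" using continuous_open_preimage[OF flat_algebra_continuous[OF q] U(1), of "- {0}"]
    by (simp add: open_Compl)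
  have "negligible ?V"
    unfolding negligible_iff_null_sets
    using ae V AE_iff_null_sets[of ?V lebesgue] by auto
  then show False using open_not_negligible[OF V] x qx by auto
qed

text \<open>Mass and gradient energy are two semidefinite forms on coefficient vectors. Zero mass
  makes the polynomial vanish on the open set U, hence also its gradient, so the second form is
  dominated by the first. Arguing through the null space makes linear independence of the monomials
  on U unnecessary.\<close>

lemma polynomial_inverse_inequality:
  fixes U :: "(real^'n) set"
  assumes U: "open U" "bounded U"
  shows "\<exists>C\<ge>0. \<forall>q. poly_deg_le k q \<longrightarrow>
    (LINT x:U|lebesgue. (norm (grad q x))^2) \<le> C * (LINT x:U|lebesgue. (q x)^2)"
proof -
  let ?J = "multi_indices k :: ('n \<Rightarrow> nat) set"
  obtain gm where gm: "\<And>\<alpha> x. GDERIV (mon \<alpha> :: real^'n \<Rightarrow> real) x :> gm \<alpha> x"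
    "\<And>\<alpha> i. (\<lambda>x. gm \<alpha> x $ i) \<in> flat_algebra"
    using flat_algebra_gderiv[OF mon_in_flat_algebra] by metis
  define Q where "Q = (\<lambda>c (x::real^'n). \<Sum>\<alpha>\<in>?J. c \<alpha> * mon \<alpha> x)"
  define G where "G = (\<lambda>c (x::real^'n). \<Sum>\<alpha>\<in>?J. c \<alpha> *\<^sub>R gm \<alpha> x)"
  have Q_in: "Q c \<in> flat_algebra" for c unfolding Q_def
    by (intro flat_algebra_sum flat_algebra.mult flat_algebra.const mon_in_flat_algebra)
  have G_in: "(\<lambda>x. G c x $ i) \<in> flat_algebra" for c i
    unfolding G_def sum_component vector_scaleR_component real_scaleR_def
    by (intro flat_algebra_sum flat_algebra.mult flat_algebra.const gm) 
  have GQ: "GDERIV (Q c) x :> G c x" for c x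
  proof -
    have "GDERIV (\<lambda>x. \<Sum>\<alpha>\<in>J. c \<alpha> * mon \<alpha> x) x :> (\<Sum>\<alpha>\<in>J. c \<alpha> *\<^sub>R gm \<alpha> x)" for J :: "('n \<Rightarrow> nat) set"
    proof (induction J rule: infinite_finite_induct)
      case (insert \<alpha> J)
      have "GDERIV (\<lambda>x. c \<alpha> * mon \<alpha> x) x :> c \<alpha> *\<^sub>R gm \<alpha> x"
        using GDERIV_mult[OF GDERIV_const gm(1)] by simp
      from GDERIV_add[OF this insert.IH] show ?case using insert.hyps by simp
    qed (simp_all add: GDERIV_const)
    then show ?thesis unfolding Q_def G_def .
  qed
  have Q_lin: "Q (\<lambda>i. s * u i + t * v i) x = s * Q u x + t * Q v x" for s t u v x
    by (simp add: Q_def sum_distrib_left sum.distrib[symmetric] algebra_simps)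
  have G_lin: "G (\<lambda>i. s * u i + t * v i) x = s *\<^sub>R G u x + t *\<^sub>R G v x" for s t u v x
    by (simp add: G_def scaleR_right.sum sum.distrib[symmetric] algebra_simps)
  have inner_in: "(\<lambda>x. G u x \<bullet> G v x) \<in> flat_algebra" for u v
    unfolding inner_vec_def inner_real_def by (intro flat_algebra_sum flat_algebra.mult G_in)
  note si = flat_algebra_set_integrable[OF _ U]
  define B where "B = (\<lambda>u v. LINT x:U|lebesgue. Q u x * Q v x)"
  define D where "D = (\<lambda>u v. LINT x:U|lebesgue. G u x \<bullet> G v x)"
  have B_lin: "B (\<lambda>i. s * u i + t * v i) w = s * B u w + t * B v w" for s t u v w
  proof -
    have "B (\<lambda>i. s * u i + t * v i) w = (LINT x:U|lebesgue. s * (Q u x * Q w x) + t * (Q v x * Q w x))"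
      by (simp add: B_def Q_lin algebra_simps)
    also have "\<dots> = (LINT x:U|lebesgue. s * (Q u x * Q w x)) + (LINT x:U|lebesgue. t * (Q v x * Q w x))"
      by (intro set_integral_add si flat_algebra.mult flat_algebra.const Q_in)
    finally show ?thesis by (simp add: B_def)
  qed
  have D_lin: "D (\<lambda>i. s * u i + t * v i) w = s * D u w + t * D v w" for s t u v w
  proof -
    have "D (\<lambda>i. s * u i + t * v i) w = (LINT x:U|lebesgue. s * (G u x \<bullet> G w x) + t * (G v x \<bullet> G w x))"
      by (simp add: D_def G_lin inner_add_left)
    also have "\<dots> = (LINT x:U|lebesgue. s * (G u x \<bullet> G w x)) + (LINT x:U|lebesgue. t * (G v x \<bullet> G w x))"
      by (intro set_integral_add si flat_algebra.mult flat_algebra.const inner_in)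
    finally show ?thesis by (simp add: D_def)
  qed
  have "\<exists>C\<ge>0. \<forall>u. (\<forall>i. i \<notin> ?J \<longrightarrow> u i = 0) \<longrightarrow> D u u \<le> C * B u u"
  proof (rule psd_form_dominated[OF B_lin _ _ D_lin])
    show "B u v = B v u" "D u v = D v u" for u v by (simp_all add: B_def D_def mult.commute inner_commute)
    show "0 \<le> B u u" "0 \<le> D u u" for u
      by (auto simp: B_def D_def set_lebesgue_integral_def intro!: Bochner_Integration.integral_nonneg)
    show "D u u = 0" if "B u u = 0" for u
    proof -
      have q0: "Q u x = 0" if "x \<in> U" for x
        using continuous_zero_if_square_integral_zero[OF Q_in U _ that, of u] \<open>B u u = 0\<close> by (simp add: B_def)
      have "G u x = 0" if "x \<in> U" for x
      proof -
        have "GDERIV (Q u) x :> 0"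
          by (rule gderiv_transform_open[OF GDERIV_const[of 0] U(1) that]) (simp add: q0)
        then show ?thesis using GQ gderiv_unique by blast
      qed
      then have "D u u = (LINT x:U|lebesgue. 0)" unfolding D_def
        by (intro set_lebesgue_integral_cong) (use U in auto)
      then show ?thesis by simp
    qed
  qed (rule finite_multi_indices)
  then obtain C where C: "0 \<le> C" "\<And>u. (\<forall>i. i \<notin> ?J \<longrightarrow> u i = 0) \<Longrightarrow> D u u \<le> C * B u u" by blast
  show ?thesis
  proof (intro exI[of _ C] conjI allI impI C(1))
    fix q :: "real^'n \<Rightarrow> real" assume "poly_deg_le k q"
    then obtain c where c: "\<And>x. q x = (\<Sum>\<alpha>\<in>?J. c \<alpha> * mon \<alpha> x)" by (auto simp: poly_deg_le_iff)
    define c' where "c' = (\<lambda>\<alpha>. if \<alpha> \<in> ?J then c \<alpha> else 0)"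
    have q: "q = Q c'" by (auto simp: Q_def c c'_def fun_eq_iff intro!: sum.cong)
    have "grad q x = G c' x" for x unfolding q by (rule grad_eq[OF GQ])
    then have "(LINT x:U|lebesgue. (norm (grad q x))^2) = D c' c'" by (simp add: D_def power2_norm_eq_inner)
    moreover have "(LINT x:U|lebesgue. (q x)^2) = B c' c'" unfolding q by (simp add: B_def power2_eq_square)
    ultimately show "(LINT x:U|lebesgue. (norm (grad q x))^2) \<le> C * (LINT x:U|lebesgue. (q x)^2)"
      using C(2)[of c'] by (simp add: c'_def)
  qed
qed

section \<open>The local inverse constant and the H1 norm on the mesh\<close>

lemma L2_norm_simplex:
  fixes u :: "real^'n \<Rightarrow> real"
  assumes ds: "d_simplex \<tau>" and q: "q \<in> flat_algebra" "\<And>x. x \<in> \<tau> \<Longrightarrow> u x = q x"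
  shows "L2_norm \<tau> u = sqrt (LINT x:interior \<tau>|lebesgue. (u x)^2)"
proof -
  note dp = d_simplex_props[OF ds]
  have cl: "closed \<tau>" using dp(1) by (rule compact_imp_closed)
  have qm: "(\<lambda>x. (q x)^2) \<in> borel_measurable lebesgue"
    by (rule measurable_completion)
      (simp add: borel_measurable_continuous_onI flat_algebra_continuous[OF flat_algebra_power[OF q(1)]])
  have sm: "set_borel_measurable lebesgue A (\<lambda>x. (q x)^2)" if "A \<in> sets lebesgue" for A
    unfolding set_borel_measurable_def
    by (intro borel_measurable_scaleR borel_measurable_indicator qm that)
  have ts: "\<tau> \<in> sets lebesgue" "interior \<tau> \<in> sets lebesgue" using cl by auto
  have "(LINT x:\<tau>|lebesgue. (u x)^2) = (LINT x:\<tau>|lebesgue. (q x)^2)"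
    by (rule set_lebesgue_integral_cong) (use ts q(2) in auto)
  also have "\<dots> = (LINT x:interior \<tau>|lebesgue. (q x)^2)"
  proof (rule set_integral_cong_set[OF sm[OF ts(2)] sm[OF ts(1)]])
    have "AE x in lebesgue. x \<notin> frontier \<tau>"
      using dp(5) by (simp add: AE_not_in negligible_iff_null_sets)
    then show "AE x in lebesgue. (x \<in> interior \<tau>) = (x \<in> \<tau>)"
      by eventually_elim (use cl interior_subset in \<open>auto simp: frontier_def\<close>)
  qed
  also have "\<dots> = (LINT x:interior \<tau>|lebesgue. (u x)^2)"
    by (rule set_lebesgue_integral_cong) (use ts q(2) subsetD[OF interior_subset, of _ \<tau>] in auto)
  finally show ?thesis by (simp add: L2_norm_def)
qed

lemma L2_norm_nonneg: "0 \<le> L2_norm A u"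
  by (auto simp: L2_norm_def set_lebesgue_integral_def intro!: Bochner_Integration.integral_nonneg)

lemma grad_L2_norm_nonneg: "0 \<le> grad_L2_norm A u"
  by (auto simp: grad_L2_norm_def set_lebesgue_integral_def intro!: Bochner_Integration.integral_nonneg)

lemma grad_eq_on_open:
  assumes "q \<in> flat_algebra" "open U" "x \<in> U" "\<And>y. y \<in> U \<Longrightarrow> u y = q y"
  shows "grad u x = grad q x"
proof -
  obtain G where G: "\<And>x. GDERIV q x :> G x" using flat_algebra_gderiv[OF assms(1)] by blast
  have "GDERIV u x :> G x" by (rule gderiv_transform_open[OF G assms(2,3)]) (use assms(4) in auto)
  then show ?thesis using G grad_eq by metis
qed

text \<open>Every admissible constant is at least the quotient formed with u0, hence so is the
  infimum, provided the admissible set is nonempty; that is the content of the polynomial inverse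
  inequality on the finitely many simplices.\<close>

lemma C_inv_loc_bound:
  fixes T :: "(real^'n) set set"
  assumes mesh: "conforming_mesh Om T" and \<tau>0: "\<tau>0 \<in> T" and u0: "u0 \<in> Sk Om T m'"
  shows "grad_L2_norm \<tau>0 u0 \<le> C_inv_loc Om T m' / diameter \<tau>0 * L2_norm \<tau>0 u0"
proof -
  let ?S = "{C. \<forall>\<tau>\<in>T. \<forall>u\<in>Sk Om T m'. grad_L2_norm \<tau> u \<le> C / diameter \<tau> * L2_norm \<tau> u}"
  have T: "finite T" "\<And>\<tau>. \<tau> \<in> T \<Longrightarrow> d_simplex \<tau>" using mesh by (auto simp: conforming_mesh_def)
  have loc: "\<exists>C\<ge>0. \<forall>u\<in>Sk Om T m'. grad_L2_norm \<tau> u \<le> C * L2_norm \<tau> u" if \<tau>: "\<tau> \<in> T" for \<tau>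
  proof -
    note dp = d_simplex_props[OF T(2)[OF \<tau>]]
    have bd: "bounded (interior \<tau>)" using dp(1) compact_imp_bounded bounded_interior by blast
    obtain C where C: "0 \<le> C" "\<And>q. poly_deg_le m' q \<Longrightarrow>
      (LINT x:interior \<tau>|lebesgue. (norm (grad q x))^2) \<le> C * (LINT x:interior \<tau>|lebesgue. (q x)^2)"
      using polynomial_inverse_inequality[OF open_interior bd, of m'] by blast
    show ?thesis
    proof (intro exI[of _ "sqrt C"] conjI ballI)
      fix u assume "u \<in> Sk Om T m'"
      then obtain q where q: "poly_deg_le m' q" "\<And>x. x \<in> \<tau> \<Longrightarrow> u x = q x" using \<tau> by (auto simp: Sk_def)
      note qf = poly_deg_le_flat_algebra[OF q(1)]
      have sub: "x \<in> interior \<tau> \<Longrightarrow> u x = q x" for x using q(2) interior_subset by blast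
      have "(LINT x:interior \<tau>|lebesgue. (norm (grad u x))^2) = (LINT x:interior \<tau>|lebesgue. (norm (grad q x))^2)"
        by (rule set_lebesgue_integral_cong) (use grad_eq_on_open[OF qf open_interior _ sub] in auto)
      also have "\<dots> \<le> C * (LINT x:interior \<tau>|lebesgue. (q x)^2)" by (rule C(2)[OF q(1)])
      also have "(LINT x:interior \<tau>|lebesgue. (q x)^2) = (LINT x:interior \<tau>|lebesgue. (u x)^2)"
        by (rule set_lebesgue_integral_cong) (use sub in auto)
      finally have "sqrt (LINT x:interior \<tau>|lebesgue. (norm (grad u x))^2)
          \<le> sqrt (C * (LINT x:interior \<tau>|lebesgue. (u x)^2))" by (rule real_sqrt_le_mono)
      moreover have "L2_norm \<tau> u = sqrt (LINT x:interior \<tau>|lebesgue. (u x)^2)"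
        by (rule L2_norm_simplex[OF T(2)[OF \<tau>] qf]) (rule q(2))
      ultimately show "grad_L2_norm \<tau> u \<le> sqrt C * L2_norm \<tau> u"
        unfolding grad_L2_norm_def by (simp add: real_sqrt_mult)
    qed (use C(1) in simp)
  qed
  then obtain C where C: "\<And>\<tau>. \<tau> \<in> T \<Longrightarrow> 0 \<le> C \<tau>"
    "\<And>\<tau> u. \<tau> \<in> T \<Longrightarrow> u \<in> Sk Om T m' \<Longrightarrow> grad_L2_norm \<tau> u \<le> C \<tau> * L2_norm \<tau> u" by metis
  \<comment> \<open>A common constant for all simplices: the sum dominates each product of a local
    constant with the diameter.\<close>
  define K where "K = (\<Sum>\<tau>\<in>T. C \<tau> * diameter \<tau>)"
  have "K \<in> ?S"
  proof (intro CollectI ballI)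
    fix \<tau> u assume \<tau>: "\<tau> \<in> T" and u: "u \<in> Sk Om T m'"
    have dpos: "0 < diameter \<sigma>" if "\<sigma> \<in> T" for \<sigma> by (rule d_simplex_props(6)[OF T(2)[OF that]])
    have "C \<tau> * diameter \<tau> \<le> K" unfolding K_def
    proof (rule member_le_sum[OF \<tau> _ T(1)])
      fix \<sigma> assume "\<sigma> \<in> T - {\<tau>}"
      then show "0 \<le> C \<sigma> * diameter \<sigma>" using C(1)[of \<sigma>] dpos[of \<sigma>] by simp
    qed
    then have "C \<tau> \<le> K / diameter \<tau>" using dpos[OF \<tau>] by (simp add: pos_le_divide_eq)
    then have "C \<tau> * L2_norm \<tau> u \<le> K / diameter \<tau> * L2_norm \<tau> u"
      by (rule mult_right_mono[OF _ L2_norm_nonneg])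
    then show "grad_L2_norm \<tau> u \<le> K / diameter \<tau> * L2_norm \<tau> u" using C(2)[OF \<tau> u] by linarith
  qed
  then have ne: "?S \<noteq> {}" by blast
  have d0: "0 < diameter \<tau>0" by (rule d_simplex_props(6)[OF T(2)[OF \<tau>0]])
  show ?thesis
  \<comment> \<open>With zero L2 norm the quotient is meaningless; the local inequality then makes
    the gradient norm vanish directly.\<close>
  proof (cases "L2_norm \<tau>0 u0 = 0")
    case True
    then show ?thesis using C(2)[OF \<tau>0 u0] by simp
  next
    case False
    then have L: "0 < L2_norm \<tau>0 u0" using L2_norm_nonneg[of \<tau>0 u0] by simp
    have "grad_L2_norm \<tau>0 u0 * diameter \<tau>0 / L2_norm \<tau>0 u0 \<le> C_inv_loc Om T m'"
      unfolding C_inv_loc_def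
    proof (rule cInf_greatest[OF ne])
      fix C assume "C \<in> ?S"
      then have "grad_L2_norm \<tau>0 u0 \<le> C / diameter \<tau>0 * L2_norm \<tau>0 u0" using \<tau>0 u0 by blast
      then show "grad_L2_norm \<tau>0 u0 * diameter \<tau>0 / L2_norm \<tau>0 u0 \<le> C"
        using L d0 by (simp add: field_simps)
    qed
    then show ?thesis using L d0 by (simp add: field_simps)
  qed
qed

text \<open>\<open>T'\<close> collects the simplices on which u may be nonzero, and the inverse
  constant is needed only there. This makes one lemma serve both arbitrary functions and coarse
  ones, for which the small fine simplices drop out.\<close>

lemma H1_norm_bound:
  fixes u :: "real^'n \<Rightarrow> real"
  assumes dom: "lipschitz_domain Om" and mesh: "conforming_mesh Om T"
    and u: "u \<in> Sk Om T m'" "H1 Om u"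
    and vanish: "\<And>\<tau>. \<tau> \<in> T - T' \<Longrightarrow> AE x in lebesgue. x \<in> interior \<tau> \<longrightarrow> u x = 0"
    and K: "\<And>\<tau>. \<tau> \<in> T \<inter> T' \<Longrightarrow> (C_inv_loc Om T m' / diameter \<tau>)^2 \<le> K"
  shows "(H1_norm Om u)^2 \<le> (1 + K) * (L2_norm Om u)^2"
proof -
  have T: "finite T" "\<And>\<tau>. \<tau> \<in> T \<Longrightarrow> d_simplex \<tau>" using mesh by (auto simp: conforming_mesh_def)
  define G where "G = (SOME G. weak_grad Om u G)"
  have G: "weak_grad Om u G" using u(2) unfolding G_def H1_def by (metis someI_ex)
  have iu: "set_integrable lebesgue Om (\<lambda>x. (u x)^2)" using u(2) by (simp add: H1_def in_L2_def)
  have iG: "set_integrable lebesgue Om (\<lambda>x. (norm (G x))^2)"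
  proof -
    have "set_integrable lebesgue Om (\<lambda>x. \<Sum>i\<in>UNIV. (G x $ i)^2)"
      using G unfolding set_integrable_def scaleR_sum_right
      by (intro Bochner_Integration.integrable_sum) (auto simp: weak_grad_def in_L2_def set_integrable_def)
    moreover have "(norm y)^2 = (\<Sum>i\<in>UNIV. (y $ i)^2)" for y :: "real^'n"
      unfolding power2_norm_eq_inner inner_vec_def by (simp add: power2_eq_square)
    ultimately show ?thesis by simp
  qed
  have loc: "(LINT x:interior \<tau>|lebesgue. (norm (G x))^2) \<le> K * (LINT x:interior \<tau>|lebesgue. (u x)^2)"
    if \<tau>: "\<tau> \<in> T" for \<tau>
  proof -
    obtain q where q: "poly_deg_le m' q" "\<And>x. x \<in> \<tau> \<Longrightarrow> u x = q x" using \<tau> u(1) by (auto simp: Sk_def)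
    note qf = poly_deg_le_flat_algebra[OF q(1)]
    note dp = d_simplex_props[OF T(2)[OF \<tau>]]
    have L2: "L2_norm \<tau> u = sqrt (LINT x:interior \<tau>|lebesgue. (u x)^2)"
      by (rule L2_norm_simplex[OF T(2)[OF \<tau>] qf]) (rule q(2))
    have sub: "interior \<tau> \<subseteq> Om" by (rule mesh_interior_subset[OF dom mesh \<tau>])
    have uq: "u x = q x" if "x \<in> interior \<tau>" for x using q(2) interior_subset that by blast
    obtain Gq where Gq: "\<And>x. GDERIV q x :> Gq x" "\<And>i. (\<lambda>x. Gq x $ i) \<in> flat_algebra"
      using flat_algebra_gderiv[OF qf] by blast
    have gu: "grad u x = Gq x" if "x \<in> interior \<tau>" for x
      using grad_eq_on_open[OF qf open_interior that uq] grad_eq[OF Gq(1)] by simp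
    have ae: "AE x in lebesgue. x \<in> interior \<tau> \<longrightarrow> G x = Gq x"
      by (rule weak_grad_eq_classical[OF G open_interior sub qf Gq(1) uq])
    have "(LINT x:interior \<tau>|lebesgue. (norm (G x))^2) = (LINT x:interior \<tau>|lebesgue. (norm (Gq x))^2)"
      unfolding set_lebesgue_integral_def
    proof (rule integral_cong_AE)
      have "set_integrable lebesgue (interior \<tau>) (\<lambda>x. (norm (G x))^2)"
        by (rule set_integrable_subset[OF iG _ sub]) simp
      then show "(\<lambda>x. indicat_real (interior \<tau>) x *\<^sub>R (norm (G x))^2) \<in> borel_measurable lebesgue"
        unfolding set_integrable_def by (rule borel_measurable_integrable)
      have "(\<lambda>x. Gq x \<bullet> Gq x) \<in> flat_algebra"
        unfolding inner_vec_def inner_real_def by (intro flat_algebra_sum flat_algebra.mult Gq(2))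
      from flat_algebra_set_integrable[OF this open_interior bounded_interior[OF compact_imp_bounded[OF dp(1)]]]
      show "(\<lambda>x. indicat_real (interior \<tau>) x *\<^sub>R (norm (Gq x))^2) \<in> borel_measurable lebesgue"
        unfolding set_integrable_def power2_norm_eq_inner by (rule borel_measurable_integrable)
      show "AE x in lebesgue. indicat_real (interior \<tau>) x *\<^sub>R (norm (G x))^2
          = indicat_real (interior \<tau>) x *\<^sub>R (norm (Gq x))^2"
        using ae by eventually_elim (auto simp: indicator_def)
    qed
    also have "\<dots> = (LINT x:interior \<tau>|lebesgue. (norm (grad u x))^2)"
      by (rule set_lebesgue_integral_cong) (use gu in auto)
    also have "\<dots> = (grad_L2_norm \<tau> u)^2"
      unfolding grad_L2_norm_def
      by (subst real_sqrt_pow2) (auto simp: set_lebesgue_integral_def intro!: Bochner_Integration.integral_nonneg)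
    also have "\<dots> \<le> (C_inv_loc Om T m' / diameter \<tau> * L2_norm \<tau> u)^2"
      by (rule power_mono[OF C_inv_loc_bound[OF mesh \<tau> u(1)] grad_L2_norm_nonneg])
    also have "\<dots> = (C_inv_loc Om T m' / diameter \<tau>)^2 * (LINT x:interior \<tau>|lebesgue. (u x)^2)"
      unfolding L2 power_mult_distrib
      by (subst real_sqrt_pow2) (auto simp: set_lebesgue_integral_def intro!: Bochner_Integration.integral_nonneg)
    also have "\<dots> \<le> K * (LINT x:interior \<tau>|lebesgue. (u x)^2)"
    proof (cases "\<tau> \<in> T'")
      case True
      have "0 \<le> (LINT x:interior \<tau>|lebesgue. (u x)^2)"
        by (auto simp: set_lebesgue_integral_def intro!: Bochner_Integration.integral_nonneg)
      then show ?thesis using K True \<tau> by (intro mult_right_mono) auto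
    next
      case False
      have "AE x in lebesgue. indicat_real (interior \<tau>) x *\<^sub>R (u x)^2 = 0"
        using vanish[of \<tau>] False \<tau> by (auto simp: indicator_def)
      then have "(LINT x:interior \<tau>|lebesgue. (u x)^2) = 0"
        unfolding set_lebesgue_integral_def by (rule integral_eq_zero_AE)
      then show ?thesis by simp
    qed
    finally show ?thesis .
  qed
  have "(LINT x:Om|lebesgue. (norm (G x))^2) \<le> K * (LINT x:Om|lebesgue. (u x)^2)"
    unfolding set_integral_mesh[OF dom mesh iG] set_integral_mesh[OF dom mesh iu] sum_distrib_left
    by (rule sum_mono) (rule loc)
  moreover have "(H1_norm Om u)^2 = (LINT x:Om|lebesgue. (u x)^2) + (LINT x:Om|lebesgue. (norm (G x))^2)"
    unfolding H1_norm_def G_def[symmetric]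
    by (subst real_sqrt_pow2)
      (auto simp: set_lebesgue_integral_def intro!: add_nonneg_nonneg Bochner_Integration.integral_nonneg)
  moreover have "(L2_norm Om u)^2 = (LINT x:Om|lebesgue. (u x)^2)"
    unfolding L2_norm_def
    by (subst real_sqrt_pow2) (auto simp: set_lebesgue_integral_def intro!: Bochner_Integration.integral_nonneg)
  ultimately show ?thesis by (simp add: algebra_simps)
qed

lemma L2_norm_le_H1_norm: "(L2_norm Om u)^2 \<le> (H1_norm Om u)^2"
  unfolding L2_norm_def H1_norm_def
  by (intro power_mono real_sqrt_le_mono)
    (auto simp: set_lebesgue_integral_def intro!: Bochner_Integration.integral_nonneg)

section \<open>Eigenvalue bounds\<close>

theorem theorem3p7:
  fixes Om :: "(real^'n) set"
    and V :: "(real^'n \<Rightarrow> real) set"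
    and a :: "(real^'n \<Rightarrow> real) \<Rightarrow> (real^'n \<Rightarrow> real) \<Rightarrow> real"
    and T Tc Tf :: "(real^'n) set set"
    and h0 Ccont ccoer Ceq \<nu> dt :: real
    and m m' p :: nat
    and \<phi> :: "(real^'n) set \<Rightarrow> real^'n \<Rightarrow> real^'n"
    and P :: "(real^'n \<Rightarrow> real) set"
    and Sig :: "(real^'n) set"
    and b :: "real^'n \<Rightarrow> real^'n \<Rightarrow> real"
    and d :: "real^'n \<Rightarrow> real"
  defines "S \<equiv> fe_space V T \<phi> P"
    and "hc \<equiv> mesh_size T"
    and "Sigf \<equiv> Sig \<inter> closure (interior (\<Union>Tf))"
    and "Cinv \<equiv> C_inv Ceq h0 (C_qu_c T Tc) (C_inv_loc Om T m')"
  assumes dim: "CARD('n) \<le> 3"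
    and dom: "lipschitz_domain Om"
    and Vsub: "H1_closed_subspace Om V"
    and mesh: "conforming_mesh Om T"
    and h0: "0 < h0"
    and mm': "1 \<le> m" "m \<le> m'"
    and phi: "\<forall>\<tau>\<in>T. affine_bij (\<phi> \<tau>) \<tau>"
    and P_sub: "\<forall>f\<in>P. \<forall>g\<in>P. \<forall>\<alpha> \<beta>::real. (\<lambda>x. \<alpha> * f x + \<beta> * g x) \<in> P"
    and P_lo: "\<forall>q. poly_deg_le m q \<longrightarrow> (\<exists>f\<in>P. \<forall>x\<in>ref_simplex. f x = q x)"
    and P_hi: "\<forall>f\<in>P. \<exists>q. poly_deg_le m' q \<and> (\<forall>x\<in>ref_simplex. f x = q x)"
    and Sig_fin: "finite Sig" and Sig_sub: "Sig \<subseteq> closure Om"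
    and b_in: "\<forall>z\<in>Sig. b z \<in> S"
    and b_basis: "\<forall>u\<in>S. \<exists>!c. c \<in> coeffs Sig \<and> (\<forall>x\<in>closure Om. u x = fun_of Sig b c x)"
    and b_supp: "\<forall>z\<in>Sig. closure {x\<in>Om. b z x \<noteq> 0} \<subseteq> \<Union>{\<tau>\<in>T. z \<in> \<tau>}"
    and d_pos: "\<forall>z\<in>Sig. 0 < d z"
    and split: "T = Tc \<union> Tf" "Tc \<inter> Tf = {}"
    and p: "1 \<le> p"
    and nu: "0 < \<nu>" "\<nu> \<le> 1/2"
    and dt: "0 < dt"
    and a_sym: "\<forall>u\<in>V. \<forall>v\<in>V. a u v = a v u"
    and a_lin: "\<forall>u\<in>V. \<forall>w\<in>V. \<forall>v\<in>V. \<forall>\<alpha> \<beta>::real.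
                  a (\<lambda>x. \<alpha> * u x + \<beta> * w x) v = \<alpha> * a u v + \<beta> * a w v"
    and a_cont: "\<forall>u\<in>V. \<forall>v\<in>V. \<bar>a u v\<bar> \<le> Ccont * H1_norm Om u * H1_norm Om v"
    and a_coer: "\<forall>u\<in>V. a u u \<ge> ccoer * (H1_norm Om u)^2"
    and coer_cont: "0 < ccoer" "ccoer \<le> Ccont"
    and h_le: "mesh_size T \<le> h0"
    and Ceq: "0 < Ceq"
    and norm_eq: "\<forall>c\<in>coeffs Sig.
                    sqrt (lumped Sig d c c) / Ceq \<le> L2_norm Om (fun_of Sig b c) \<and>
                    L2_norm Om (fun_of Sig b c) \<le> Ceq * sqrt (lumped Sig d c c)"
    and quasi_unif: "\<forall>\<tau>\<in>T. hc / diameter \<tau> \<le> C_qu_c T Tc * real p"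
    and CFL: "(3 + Ccont / ccoer) * Ccont * Cinv^2 * (dt / hc)^2 \<le> \<nu> / (\<nu> + 1)"
  shows "\<forall>lam. is_eig_pnu Sig Sigf b d a p \<nu> dt lam \<longrightarrow>
           dt^2 * lam \<le> 4 - \<nu> / (\<nu> + 1) \<and>
           lam \<ge> 1/2 * min (ccoer / Ceq^2) (2 * \<nu> / ((\<nu> + 1) * dt^2))"
proof (intro allI impI)
  fix lam assume eig: "is_eig_pnu Sig Sigf b d a p \<nu> dt lam"
  define Cloc where "Cloc = C_inv_loc Om T m'"
  define Cqu where "Cqu = C_qu_c T Tc"
  define F where "F = fun_of Sig b"
  define E where "E = (\<lambda>u v. a (F u) (F v))"
  define N where "N = Pi_f Sigf \<circ> A_S Sig b d a"
  have T: "finite T" "\<And>\<tau>. \<tau> \<in> T \<Longrightarrow> d_simplex \<tau>" "\<Union>T = closure Om"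
    using mesh by (auto simp: conforming_mesh_def)
  have T_ne: "T \<noteq> {}" using T(3) dom closure_subset[of Om] unfolding lipschitz_domain_def by force
  have diam: "0 < diameter \<tau>" if "\<tau> \<in> T" for \<tau> by (rule d_simplex_props(6)[OF T(2)[OF that]])
  have hc: "0 < hc" "hc \<le> h0"
  proof -
    obtain \<tau> where \<tau>: "\<tau> \<in> T" using T_ne by blast
    have "diameter \<tau> \<le> hc" unfolding hc_def mesh_size_def using T(1) \<tau> by (intro Max_ge) auto
    then show "0 < hc" using diam[OF \<tau>] by linarith
    show "hc \<le> h0" using h_le by (simp add: hc_def)
  qed
  have SV: "S \<subseteq> V" by (auto simp: S_def fe_space_def)
  have V_comb: "(\<lambda>x. s * u x + t * v x) \<in> V" if "u \<in> V" "v \<in> V" for s t u v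
    using Vsub that by (simp add: H1_closed_subspace_def)
  have S_comb: "(\<lambda>x. s * u x + t * v x) \<in> S" if uv: "u \<in> S" "v \<in> S" for s t u v
    unfolding S_def fe_space_def
  proof (intro CollectI conjI ballI)
    show "(\<lambda>x. s * u x + t * v x) \<in> V" by (rule V_comb) (use SV uv in auto)
    fix \<tau> assume \<tau>: "\<tau> \<in> T"
    obtain f where f: "f \<in> P" "\<forall>x\<in>ref_simplex. u (\<phi> \<tau> x) = f x"
      using uv(1) \<tau> unfolding S_def fe_space_def by auto
    obtain g where g: "g \<in> P" "\<forall>x\<in>ref_simplex. v (\<phi> \<tau> x) = g x"
      using uv(2) \<tau> unfolding S_def fe_space_def by auto
    have "(\<lambda>x. s * f x + t * g x) \<in> P" using P_sub f(1) g(1) by simp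
    then show "\<exists>h\<in>P. \<forall>x\<in>ref_simplex. s * u (\<phi> \<tau> x) + t * v (\<phi> \<tau> x) = h x"
      using f(2) g(2) by (intro bexI[of _ "\<lambda>x. s * f x + t * g x"]) simp_all
  qed
  have S_zero: "(\<lambda>x. 0) \<in> S"
  proof -
    obtain f where "f \<in> P" "\<forall>x\<in>ref_simplex. f x = 0" using P_lo poly_deg_le_const[of m 0] by blast
    then show ?thesis using Vsub unfolding S_def fe_space_def H1_closed_subspace_def by auto
  qed
  have F_in: "F c \<in> S" for c
  proof -
    have "(\<lambda>x. \<Sum>z\<in>I. c z * b z x) \<in> S" if "I \<subseteq> Sig" for I
      using finite_subset[OF that Sig_fin] that
    proof (induction I)
      case (insert z I)
      then show ?case using S_comb[of "b z" "\<lambda>x. \<Sum>z\<in>I. c z * b z x" "c z" 1] b_in by simp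
    qed (simp add: S_zero)
    then show ?thesis by (simp add: F_def fun_of_def[abs_def])
  qed
  have F_V: "F c \<in> V" for c using F_in SV by blast
  have F_lin: "F (\<lambda>z. s * u z + t * v z) = (\<lambda>x. s * F u x + t * F v x)" for s t u v
    by (simp add: F_def fun_of_def fun_eq_iff sum_distrib_left sum.distrib[symmetric] algebra_simps)
  have E_lin: "E (\<lambda>z. s * u z + t * v z) w = s * E u w + t * E v w" for s t u v w
    unfolding E_def F_lin using a_lin F_V by blast
  have E_sym: "E u v = E v u" for u v unfolding E_def using a_sym F_V by blast
  have A_lin: "A_S Sig b d a (\<lambda>z. s * u z + t * v z)
      = (\<lambda>z. s * A_S Sig b d a u z + t * A_S Sig b d a v z)" for s t u v
  proof
    fix z
    show "A_S Sig b d a (\<lambda>z. s * u z + t * v z) z = s * A_S Sig b d a u z + t * A_S Sig b d a v z"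
    proof (cases "z \<in> Sig")
      case True
      then have "b z \<in> V" using b_in SV by blast
      then have "a (F (\<lambda>z. s * u z + t * v z)) (b z) = s * a (F u) (b z) + t * a (F v) (b z)"
        unfolding F_lin using a_lin F_V by blast
      then show ?thesis using True by (simp add: A_S_def F_def[symmetric] add_divide_distrib)
    qed (simp add: A_S_def)
  qed
  have N_lin: "linear_op N"
    unfolding linear_op_def N_def by (auto simp: A_lin Pi_f_def fun_eq_iff)
  have N_supp: "N u \<in> coeffs Sigf" for u by (simp add: N_def Pi_f_def coeffs_def)
  have A_E: "lumped Sig d (A_S Sig b d a u) v = E u v" for u v
  proof -
    have b_V: "b z \<in> V" if "z \<in> Sig" for z using b_in SV that by blast
    \<comment> \<open>Membership in V is carried along because \<open>a_lin\<close> applies only to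
      elements of V.\<close>
    have "(\<lambda>x. \<Sum>z\<in>I. v z * b z x) \<in> V
        \<and> a (\<lambda>x. \<Sum>z\<in>I. v z * b z x) (F u) = (\<Sum>z\<in>I. v z * a (b z) (F u))" if "I \<subseteq> Sig" for I
      using finite_subset[OF that Sig_fin] that
    proof (induction I)
      case empty
      have "(\<lambda>x. 0) \<in> V" using S_zero SV by blast
      moreover from this have "a (\<lambda>x. 0 * F u x + 0 * F u x) (F u) = 0 * a (F u) (F u) + 0 * a (F u) (F u)"
        using a_lin F_V by blast
      ultimately show ?case by simp
    next
      case (insert z I)
      let ?g = "\<lambda>x. \<Sum>z\<in>I. v z * b z x"
      have g: "?g \<in> V" "a ?g (F u) = (\<Sum>z\<in>I. v z * a (b z) (F u))" using insert by auto
      have bz: "b z \<in> V" using b_V insert by blast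
      have "a (\<lambda>x. v z * b z x + 1 * ?g x) (F u) = v z * a (b z) (F u) + 1 * a ?g (F u)"
        by (rule a_lin[rule_format, OF bz g(1) F_V])
      then show ?case using V_comb[OF bz g(1), of "v z" 1] g(2) insert by simp
    qed
    then have "a (F v) (F u) = (\<Sum>z\<in>Sig. v z * a (b z) (F u))" by (simp add: F_def fun_of_def[abs_def])
    also have "\<dots> = (\<Sum>z\<in>Sig. d z * A_S Sig b d a u z * v z)"
    proof (rule sum.cong[OF refl])
      fix z assume z: "z \<in> Sig"
      have "a (b z) (F u) = a (F u) (b z)" using a_sym b_V[OF z] F_V by blast
      then show "v z * a (b z) (F u) = d z * A_S Sig b d a u z * v z"
        using z d_pos by (auto simp: A_S_def F_def[symmetric])
    qed
    finally show ?thesis using E_sym[of u v] by (simp add: lumped_def E_def)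
  qed
  have N_E: "lumped Sig d (N u) v = E u (Pi_f Sigf v)" for u v
    unfolding A_E[symmetric] by (auto simp: lumped_def N_def Pi_f_def intro!: sum.cong)
  define ip where "ip = lumped Sig d"
  have L2_ip: "(L2_norm Om (F u))^2 \<le> Ceq^2 * ip u u" "ip u u \<le> Ceq^2 * (L2_norm Om (F u))^2" for u
  proof -
    \<comment> \<open>The norm equivalence is assumed for coefficients supported on
      \<open>Sig\<close>; values outside \<open>Sig\<close> affect neither the function nor the
      lumped product, so it extends to all u.\<close>
    define w where "w = Pi_f Sig u"
    have w: "w \<in> coeffs Sig" by (simp add: w_def Pi_f_def coeffs_def)
    have Fw: "F w = F u" by (simp add: F_def fun_of_def w_def Pi_f_def)
    have ipw: "lumped Sig d w w = ip u u" by (simp add: ip_def lumped_def w_def Pi_f_def)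
    have ip0: "0 \<le> ip u u" unfolding ip_def by (rule lumped_nonneg[OF d_pos])
    have n: "sqrt (ip u u) / Ceq \<le> L2_norm Om (F u)" "L2_norm Om (F u) \<le> Ceq * sqrt (ip u u)"
      using norm_eq w Fw ipw unfolding F_def by auto
    have "(L2_norm Om (F u))^2 \<le> (Ceq * sqrt (ip u u))^2" by (rule power_mono[OF n(2) L2_norm_nonneg])
    then show "(L2_norm Om (F u))^2 \<le> Ceq^2 * ip u u" using ip0 by (simp add: power_mult_distrib)
    have "sqrt (ip u u) \<le> Ceq * L2_norm Om (F u)" using n(1) Ceq by (simp add: divide_le_eq mult.commute)
    then have "(sqrt (ip u u))^2 \<le> (Ceq * L2_norm Om (F u))^2" using ip0 by (intro power_mono) auto
    then show "ip u u \<le> Ceq^2 * (L2_norm Om (F u))^2" using ip0 by (simp add: power_mult_distrib)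
  qed
  \<comment> \<open>\<open>c\<close> is twice the claimed lower bound, \<open>X\<close> is the end
    of the interval on which the Chebyshev estimates hold, and \<open>k\<close> will bound the
    energy of coarse functions.\<close>
  define c where "c = min (ccoer / Ceq^2) (2 * \<nu> / ((\<nu> + 1) * dt^2))"
  define X where "X = (real p)^2 / dt^2"
  define k where "k = Ccont * Cinv^2 / hc^2"
  have c0: "0 < c" using coer_cont Ceq nu dt by (simp add: c_def)
  have c_le: "c \<le> ccoer / Ceq^2" "c \<le> 2 * \<nu> / ((\<nu> + 1) * dt^2)" by (auto simp: c_def)
  \<comment> \<open>From \<nu> < 1 it follows that dt^2 c \<le> 2 \<nu> / (\<nu> + 1) < 1 \<le> p^2,
    so the interval for the fine spectrum is nondegenerate.\<close>
  have cX: "c < X"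
  proof -
    have "dt^2 * c \<le> 2 * \<nu> / (\<nu> + 1)" using c_le(2) dt nu by (simp add: pos_le_divide_eq ac_simps)
    also have "\<dots> < 1" using nu by (simp add: field_simps)
    also have "1 \<le> (real p)^2" using p by simp
    finally show ?thesis using dt by (simp add: X_def pos_less_divide_eq mult.commute)
  qed
  have coercive: "c * ip u u \<le> E u u" for u
  proof -
    have "c * ip u u \<le> ccoer / Ceq^2 * (Ceq^2 * (L2_norm Om (F u))^2)"
      using c_le(1) L2_ip(2) c0 coer_cont Ceq lumped_nonneg[OF d_pos] unfolding ip_def
      by (intro mult_mono) auto
    also have "\<dots> \<le> ccoer * (H1_norm Om (F u))^2" using Ceq coer_cont L2_norm_le_H1_norm by simp
    also have "\<dots> \<le> E u u" unfolding E_def using a_coer F_V by blast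
    finally show ?thesis .
  qed
  have F_Sk: "F u \<in> Sk Om T m'" "H1 Om (F u)" for u
    using fe_space_subset_Sk[OF mesh phi P_hi, of V] F_in F_V[of u] Vsub
    by (auto simp: S_def H1_closed_subspace_def)
  \<comment> \<open>Used with s = p on the whole mesh and with s = 1 on the coarse part. The summand
    1 from the L2 part of the H1 norm is absorbed into h0^2 / hc^2 by hc \<le> h0, which explains
    the h0 in \<open>C_inv\<close>.\<close>
  have energy: "E u u \<le> k * s^2 * ip u u"
    if vanish: "\<And>\<tau>. \<tau> \<in> T - T' \<Longrightarrow> AE x in lebesgue. x \<in> interior \<tau> \<longrightarrow> F u x = 0"
      and s: "1 \<le> s" "\<And>\<tau>. \<tau> \<in> T \<inter> T' \<Longrightarrow> hc / diameter \<tau> \<le> Cqu * s" for u T' s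
  proof -
    define K where "K = (Cloc * (Cqu * s / hc))^2"
    have "(H1_norm Om (F u))^2 \<le> (1 + K) * (L2_norm Om (F u))^2"
    proof (rule H1_norm_bound[OF dom mesh F_Sk vanish])
      fix \<tau> assume \<tau>: "\<tau> \<in> T \<inter> T'"
      have "1 / diameter \<tau> \<le> Cqu * s / hc" using s(2)[OF \<tau>] hc(1) by (simp add: pos_le_divide_eq mult.commute)
      moreover have "0 \<le> 1 / diameter \<tau>" using diam \<tau> by (simp add: less_imp_le)
      ultimately have "(1 / diameter \<tau>)^2 \<le> (Cqu * s / hc)^2" by (rule power_mono)
      then have "Cloc^2 * (1 / diameter \<tau>)^2 \<le> Cloc^2 * (Cqu * s / hc)^2" by (rule mult_left_mono) simp
      then show "(C_inv_loc Om T m' / diameter \<tau>)^2 \<le> K"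
        by (simp add: K_def power_mult_distrib power_divide Cloc_def)
    qed
    also have "\<dots> \<le> (1 + K) * (Ceq^2 * ip u u)" using L2_ip(1) by (intro mult_left_mono) (auto simp: K_def)
    also have "\<dots> \<le> (s^2 * (h0^2 + Cqu^2 * Cloc^2) / hc^2) * (Ceq^2 * ip u u)"
    proof (rule mult_right_mono)
      have "hc^2 \<le> h0^2" using hc by (intro power_mono) auto
      moreover have "1 * h0^2 \<le> s^2 * h0^2" using s(1) by (intro mult_right_mono) (auto simp: one_le_power)
      ultimately have "1 \<le> s^2 * h0^2 / hc^2" using hc(1) by (simp add: pos_le_divide_eq)
      then show "1 + K \<le> s^2 * (h0^2 + Cqu^2 * Cloc^2) / hc^2"
        by (simp add: K_def power_mult_distrib power_divide distrib_left add_divide_distrib ac_simps)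
      show "0 \<le> Ceq^2 * ip u u" using lumped_nonneg[OF d_pos] by (simp add: ip_def)
    qed
    finally have H: "(H1_norm Om (F u))^2 \<le> (s^2 * (h0^2 + Cqu^2 * Cloc^2) / hc^2) * (Ceq^2 * ip u u)" .
    have "E u u \<le> \<bar>a (F u) (F u)\<bar>" by (simp add: E_def)
    also have "\<dots> \<le> Ccont * H1_norm Om (F u) * H1_norm Om (F u)" using a_cont F_V by blast
    also have "\<dots> = Ccont * (H1_norm Om (F u))^2" by (simp add: power2_eq_square)
    also have "\<dots> \<le> Ccont * ((s^2 * (h0^2 + Cqu^2 * Cloc^2) / hc^2) * (Ceq^2 * ip u u))"
      using H coer_cont by (intro mult_left_mono) auto
    also have "\<dots> = k * s^2 * ip u u"
    proof -
      have "Cinv^2 = Ceq^2 * (h0^2 + Cqu^2 * Cloc^2)"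
        unfolding Cinv_def C_inv_def Cqu_def[symmetric] Cloc_def[symmetric] power_mult_distrib
        by (simp add: add_nonneg_nonneg)
      then show ?thesis by (simp add: k_def)
    qed
    finally show ?thesis .
  qed
  have k0: "0 < k"
  proof -
    have "0 < h0^2 + Cqu^2 * Cloc^2" using h0 by (intro add_pos_nonneg) auto
    then have "0 < Cinv" using Ceq
      unfolding Cinv_def C_inv_def Cqu_def[symmetric] Cloc_def[symmetric] by simp
    then show ?thesis using coer_cont hc(1) by (simp add: k_def)
  qed
  \<comment> \<open>Since Ccont \<ge> ccoer, the factor 3 + Ccont / ccoer in the CFL condition is at
    least 4.\<close>
  have kdt: "4 * (dt^2 * k) \<le> \<nu> / (\<nu> + 1)"
  proof -
    have "1 \<le> Ccont / ccoer" using coer_cont by simp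
    then have "4 * (dt^2 * k) \<le> (3 + Ccont / ccoer) * (dt^2 * k)" using k0 by (intro mult_right_mono) auto
    also have "\<dots> = (3 + Ccont / ccoer) * Ccont * Cinv^2 * (dt / hc)^2" by (simp add: k_def power_divide)
    finally show ?thesis using CFL by linarith
  qed
  have bounded: "E u u \<le> X * ip u u" for u
  proof -
    have "E u u \<le> k * (real p)^2 * ip u u"
      by (rule energy[of UNIV]) (use p quasi_unif in \<open>auto simp: Cqu_def\<close>)
    also have "\<dots> \<le> X * ip u u"
    proof (rule mult_right_mono)
      have "\<nu> / (\<nu> + 1) \<le> 1" using nu by simp
      then have "dt^2 * k \<le> 1" using kdt by linarith
      then have "dt^2 * k * (real p)^2 \<le> 1 * (real p)^2" by (rule mult_right_mono) simp
      then show "k * (real p)^2 \<le> X" using dt by (simp add: X_def pos_le_divide_eq ac_simps)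
      show "0 \<le> ip u u" unfolding ip_def by (rule lumped_nonneg[OF d_pos])
    qed
    finally show ?thesis .
  qed
  have coarse: "E u u \<le> k * ip u u" if u: "\<And>z. z \<in> Sigf \<Longrightarrow> u z = 0" for u
  proof -
    have "E u u \<le> k * 1^2 * ip u u"
    proof (rule energy[of Tc])
      fix \<tau> assume \<tau>: "\<tau> \<in> T \<inter> Tc"
      have "finite (diameter ` Tc)" using T(1) split by simp
      then have m: "Min (diameter ` Tc) \<le> diameter \<tau>" "Min (diameter ` Tc) \<in> diameter ` Tc"
        using \<tau> by (auto intro: Min_le Min_in)
      then have "0 < Min (diameter ` Tc)" using diam split by auto
      then show "hc / diameter \<tau> \<le> Cqu * 1" unfolding Cqu_def C_qu_c_def hc_def[symmetric]
        using m(1) hc(1) by (simp add: divide_left_mono)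
    next
      \<comment> \<open>A coarse function vanishes a.e. on a fine simplex: almost every interior
        point lies in no other simplex, so a basis function that is nonzero there has its node in
        \<tau>. Such a node belongs to \<open>Sigf\<close>, where the coefficient is zero.\<close>
      fix \<tau> assume "\<tau> \<in> T - Tc"
      then have \<tau>: "\<tau> \<in> T" "\<tau> \<in> Tf" using split by auto
      have sub: "interior \<tau> \<subseteq> Om" by (rule mesh_interior_subset[OF dom mesh \<tau>(1)])
      have "\<tau> \<subseteq> closure (interior (\<Union>Tf))"
      proof -
        have "closure (interior \<tau>) \<subseteq> closure (interior (\<Union>Tf))"
          using \<tau>(2) by (intro closure_mono interior_mono) auto
        then show ?thesis using d_simplex_props(4)[OF T(2)[OF \<tau>(1)]] by simp
      qed
      then have z\<tau>: "z \<in> Sigf" if "z \<in> Sig" "z \<in> \<tau>" for z using that by (auto simp: Sigf_def)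
      have "AE x in lebesgue. \<forall>\<tau>'\<in>T - {\<tau>}. x \<notin> \<tau> \<inter> \<tau>'"
      proof (subst AE_ball_countable, simp add: T(1) countable_finite, rule ballI)
        fix \<tau>' assume "\<tau>' \<in> T - {\<tau>}"
        then have "negligible (\<tau> \<inter> \<tau>')" using conforming_mesh_overlap(1)[OF mesh \<tau>(1)] by auto
        then show "AE x in lebesgue. x \<notin> \<tau> \<inter> \<tau>'" by (intro AE_not_in) (simp only: negligible_iff_null_sets)
      qed
      then show "AE x in lebesgue. x \<in> interior \<tau> \<longrightarrow> F u x = 0"
      proof eventually_elim
        case (elim x)
        show ?case
        proof
          assume x: "x \<in> interior \<tau>"
          have "u z * b z x = 0" if z: "z \<in> Sig" for z
          proof (cases "b z x = 0 \<or> z \<in> Sigf")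
            case True
            then show ?thesis using u by auto
          next
            case False
            have "x \<in> {x\<in>Om. b z x \<noteq> 0}" using False x sub by blast
            then have "x \<in> closure {x\<in>Om. b z x \<noteq> 0}" by (rule subsetD[OF closure_subset])
            then have "x \<in> \<Union>{\<tau>'\<in>T. z \<in> \<tau>'}" by (rule subsetD[OF b_supp[rule_format, OF z]])
            then obtain \<tau>' where \<tau>': "\<tau>' \<in> T" "z \<in> \<tau>'" "x \<in> \<tau>'" by blast
            have "\<tau>' \<noteq> \<tau>" using \<tau>'(2) z\<tau>[OF z] False by blast
            then have "x \<notin> \<tau> \<inter> \<tau>'" using elim \<tau>'(1) by blast
            then show ?thesis using \<tau>'(3) subsetD[OF interior_subset x] by simp
          qed
          then show "F u x = 0" unfolding F_def fun_of_def by (rule sum.neutral[OF ballI])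
        qed
      qed
    qed simp
    then show ?thesis by simp
  qed
  interpret split_energy Sig Sigf d E N c X
    using d_pos E_lin E_sym N_lin N_supp N_E c0 cX coercive bounded
    unfolding ip_def by unfold_locales blast+
  define R where "R = P_dt p \<nu> dt"
  \<comment> \<open>\<open>M\<close> bounds x R(x) itself, hence the division by dt^2.\<close>
  define M where "M = (2 + 2 / (1 + \<nu>)) / dt^2"
  note Rb = P_dt_bounds[OF p nu dt, folded R_def X_def]
  obtain \<eta> where \<eta>: "\<eta> \<in> coeffs Sig" "\<eta> \<noteq> (\<lambda>z. 0)"
    "\<And>v. v \<in> coeffs Sig \<Longrightarrow> a_pnu Sig Sigf b d a p \<nu> dt \<eta> v = lam * lumped Sig d \<eta> v"
    using eig unfolding is_eig_pnu_def by blast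
  have ip\<eta>: "0 < lumped Sig d \<eta> \<eta>"
  proof -
    obtain z where z: "\<eta> z \<noteq> 0" using \<eta>(2) by auto
    then have zS: "z \<in> Sig" using \<eta>(1) by (auto simp: coeffs_def)
    show ?thesis unfolding lumped_def mult.assoc
    proof (rule sum_pos2[OF Sig_fin zS])
      have "0 < \<eta> z * \<eta> z" using z by (auto simp: zero_less_mult_iff linorder_neq_iff)
      with d_pos zS show "0 < d z * (\<eta> z * \<eta> z)" by (intro mult_pos_pos[of "d z"]) auto
      show "0 \<le> d y * (\<eta> y * \<eta> y)" if "y \<in> Sig" for y
        using d_pos that by (intro mult_nonneg_nonneg[OF less_imp_le zero_le_square]) auto
    qed
  qed
  have "E (poly_op R N \<eta>) \<eta> = a_pnu Sig Sigf b d a p \<nu> dt \<eta> \<eta>"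
  proof -
    have "poly_op (Q_dt p \<nu> dt) N \<eta> = (\<lambda>z. 1 * \<eta> z + (-1) * poly_op R N \<eta> z)"
      using poly_op_lincomb[OF N_lin, of 1 1 "-1" R \<eta>] unfolding Q_dt_def R_def[symmetric]
      by (simp only: smult_1_left smult_minus_left poly_op_1 diff_conv_add_uminus)
    then have "poly_op R N \<eta> = (\<lambda>z. \<eta> z - poly_op (Q_dt p \<nu> dt) N \<eta> z)" by (simp add: fun_eq_iff)
    then show ?thesis by (simp add: a_pnu_def E_def F_def N_def)
  qed
  then have lam: "E (poly_op R N \<eta>) \<eta> = lam * lumped Sig d \<eta> \<eta>" using \<eta>(1,3) by simp
  have "c / 2 * lumped Sig d \<eta> \<eta> \<le> E (poly_op R N \<eta>) \<eta>"
  proof (rule stabilized_energy_lower)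
    show "poly R 0 = 1" unfolding R_def by (rule P_dt_properties(2)[OF p nu dt])
    show "poly R x \<le> 1 \<and> c \<le> (x + c) * poly R x" if "c \<le> x" "x \<le> X" for x
      using Rb(2,4)[of x] that c0 c_le(2) by auto
  qed
  then have lower: "c / 2 \<le> lam" unfolding lam using ip\<eta> by simp
  have "E (poly_op R N \<eta>) \<eta> \<le> (M + k) * lumped Sig d \<eta> \<eta>"
  proof (rule stabilized_energy_upper)
    show "0 < M" using nu dt by (simp add: M_def add_pos_pos)
    show "E u u \<le> k * lumped Sig d u u" if "\<And>z. z \<in> Sigf \<Longrightarrow> u z = 0" for u
      using coarse that by (simp add: ip_def)
    show "0 \<le> poly R x \<and> poly R x \<le> 1 \<and> x * poly R x \<le> M" if "0 \<le> x" "x \<le> X" for x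
      using Rb(1-3)[OF that] dt by (simp add: M_def pos_le_divide_eq mult.commute)
  qed (rule k0)
  then have "lam \<le> M + k" unfolding lam using ip\<eta> by simp
  \<comment> \<open>With y = \<nu> / (\<nu> + 1) the right-hand side is at most 4 - 2 y + y / 4,
    below the claimed 4 - y.\<close>
  then have "dt^2 * lam \<le> dt^2 * (M + k)" by (rule mult_left_mono) simp
  also have "\<dots> = dt^2 * M + dt^2 * k" by (rule distrib_left)
  also have "dt^2 * M = 2 + 2 / (1 + \<nu>)" using dt by (simp add: M_def)
  also have "2 / (1 + \<nu>) = 2 - 2 * (\<nu> / (\<nu> + 1))" using nu by (simp add: field_simps)
  also have "2 + (2 - 2 * (\<nu> / (\<nu> + 1))) + dt^2 * k \<le> 4 - \<nu> / (\<nu> + 1)"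
  proof -
    have "0 \<le> \<nu> / (\<nu> + 1)" using nu by simp
    then show ?thesis using kdt by linarith
  qed
  finally show "dt^2 * lam \<le> 4 - \<nu> / (\<nu> + 1) \<and>
      1/2 * min (ccoer / Ceq^2) (2 * \<nu> / ((\<nu> + 1) * dt^2)) \<le> lam"
    using lower by (simp add: c_def)
qed

end
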